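(* If $\phi\in L^\infty(\mathbb{T}^2)$, then $\|H_\phi\|=\mathrm{dist}_\infty(\phi,H_1)$, where $H_\phi$ is the Hankel operator with symbol $\phi$ and $\mathrm{dist}_\infty(\phi,H_1)=\inf\{\|\phi-g\|_{\mathbb{T}^2,\infty}:g\in H_1\}$ is the $L^\infty$-distance of $\phi$ from $H_1$.
   Context: $H_1$ is the closed subspace of $L^\infty(\mathbb{T}^2)$ of all functions whose Fourier series has the form $\sum_{m+n\ge 0}a_{m,n}z_1^mz_2^n$ (Fourier coefficients vanish whenever $m+n<0$). For $\phi\in L^\infty(\mathbb{T}^2)$ with Fourier series $\sum_{m,n\in\mathbb{Z}}a_{m,n}z_1^mz_2^n$ and $k\in\mathbb{Z}$, let $f_k^\phi(\lambda)=\sum_{m+n=k}a_{m,n}\lambda^n$, so that $\phi(z,\lambda z)=\sum_{k\in\mathbb{Z}}f_k^\phi(\lambda)z^k$; each $f_k^\phi$ is in $L^\infty(\mathbb{T})$. $M_{f}$ denotes multiplication by $f$ on $L^2(\mathbb{T})$. The Hankel operator $H_\phi$ is the operator from $L^2(\mathbb{T})\otimes\ell^2(\{0,1,2,\ldots\})$ to $L^2(\mathbb{T})\otimes\ell^2(\{-1,-2,\ldots\})$ obtained by restricting multiplication by $\phi$ and compressing; its block matrix (columns indexed by $j=0,1,2,\ldots$, rows indexed by $-1,-2,\ldots$, i.e. by $i=0,1,2,\dots$ with row $-(i+1)$) is \[H_\phi=\big(M_{f^\phi_{-(i+j+1)}}\big)_{i,j\ge 0}=\begin{pmatrix} M_{f^\phi_{-1}}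 & M_{f^\phi_{-2}} & M_{f^\phi_{-3}} & \cdots \\ M_{f^\phi_{-2}} & M_{f^\phi_{-3}} & M_{f^\phi_{-4}} & \cdots \\ \vdots & \vdots & \vdots & \end{pmatrix}.\] $\|\cdot\|_{\mathbb{T}^2,\infty}$ is the essential supremum norm. *)

theory Defs
  imports "HOL-Probability.Essential_Supremum"
begin

section \<open>The circle and the torus\<close>

(* Normalized Lebesgue measure on the unit circle and on the torus.  The underlying spaces are
   the circle and the torus themselves, so values of a function elsewhere are irrelevant. *)

definition circle :: "complex measure" where
  "circle = distr (uniform_measure lborel {0..1::real})
              (restrict_space borel (sphere 0 1)) (\<lambda>t. cis (2 * pi * t))"

definition torus :: "(complex \<times> complex) measure" where
  "torus = circle \<Otimes>\<^sub>M circle"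


section \<open>Lebesgue spaces\<close>

(* Elements of Lebesgue spaces are represented by functions; equality almost everywhere is not
   divided out, and the "norms" below are the corresponding seminorms.  They take values in the
   extended nonnegative reals, so that no value has to be invented where a norm is infinite. *)

definition ennreal_sqrt :: "ennreal \<Rightarrow> ennreal" where
  "ennreal_sqrt x = (if x = top then top else ennreal (sqrt (enn2real x)))"

definition L2_norm :: "'a measure \<Rightarrow> ('a \<Rightarrow> complex) \<Rightarrow> ennreal" where
  "L2_norm M f = ennreal_sqrt (\<integral>\<^sup>+x. (ennreal (cmod (f x)))\<^sup>2 \<partial>M)"

definition L2 :: "'a measure \<Rightarrow> ('a \<Rightarrow> complex) set" where
  "L2 M = {f \<in> borel_measurable M. L2_norm M f < top}"

definition Linf_norm :: "'a measure \<Rightarrow> ('a \<Rightarrow> complex) \<Rightarrow> ennreal" where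
  "Linf_norm M f = esssup M (\<lambda>x. ennreal (cmod (f x)))"

definition Linf :: "'a measure \<Rightarrow> ('a \<Rightarrow> complex) set" where
  "Linf M = {f \<in> borel_measurable M. Linf_norm M f < top}"


section \<open>Fourier coefficients\<close>

definition fourier_circle :: "(complex \<Rightarrow> complex) \<Rightarrow> int \<Rightarrow> complex" where
  "fourier_circle f n = (LINT z|circle. f z * z powi (- n))"

definition fourier_torus :: "(complex \<times> complex \<Rightarrow> complex) \<Rightarrow> int \<Rightarrow> int \<Rightarrow> complex" where
  "fourier_torus \<phi> m n = (LINT (z1, z2)|torus. \<phi> (z1, z2) * z1 powi (- m) * z2 powi (- n))"

definition H1 :: "(complex \<times> complex \<Rightarrow> complex) set" where
  "H1 = {g \<in> Linf torus. \<forall>m n. m + n < 0 \<longrightarrow> fourier_torus g m n = 0}"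

definition dist_inf ::
    "(complex \<times> complex \<Rightarrow> complex) \<Rightarrow> (complex \<times> complex \<Rightarrow> complex) set \<Rightarrow> ennreal" where
  "dist_inf \<phi> S = (INF g\<in>S. Linf_norm torus (\<lambda>x. \<phi> x - g x))"

(* slice phi k is the function with Fourier series  sum_{m+n=k} a_{m,n} lambda^n,  where a_{m,n}
   are the Fourier coefficients of phi.  The Fourier coefficients determine it up to a null set. *)

definition slice :: "(complex \<times> complex \<Rightarrow> complex) \<Rightarrow> int \<Rightarrow> complex \<Rightarrow> complex" where
  "slice \<phi> k = (SOME f. f \<in> Linf circle \<and>
                 (\<forall>n. fourier_circle f n = fourier_torus \<phi> (k - n) n))"


section \<open>Hankel operators\<close>

(* The Hilbert space tensor product of L2(circle) with l2(nat), as the space of square summable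
   sequences in L2(circle).  It also serves as the tensor product with l2({-1,-2,...}): the
   component with index i is then the one belonging to -(i+1). *)

definition L2l2_norm :: "(nat \<Rightarrow> complex \<Rightarrow> complex) \<Rightarrow> ennreal" where
  "L2l2_norm h = ennreal_sqrt (\<Sum>j. (L2_norm circle (h j))\<^sup>2)"

definition L2l2 :: "(nat \<Rightarrow> complex \<Rightarrow> complex) set" where
  "L2l2 = {h. (\<forall>j. h j \<in> L2 circle) \<and> L2l2_norm h < top}"

definition L2_sums :: "(nat \<Rightarrow> complex \<Rightarrow> complex) \<Rightarrow> (complex \<Rightarrow> complex) \<Rightarrow> bool" where
  "L2_sums u s \<longleftrightarrow> s \<in> L2 circle \<and>
     (\<lambda>N. L2_norm circle (\<lambda>x. s x - (\<Sum>j<N. u j x))) \<longlonglongrightarrow> 0"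

(* The operator whose block matrix has, in row i and column j, multiplication by
   slice phi (-(i+j+1)).  The series in each row is summed in the norm of L2(circle). *)

definition hankel ::
    "(complex \<times> complex \<Rightarrow> complex) \<Rightarrow> (nat \<Rightarrow> complex \<Rightarrow> complex) \<Rightarrow> nat \<Rightarrow> complex \<Rightarrow> complex" where
  "hankel \<phi> h i =
     (SOME s. L2_sums (\<lambda>j x. slice \<phi> (- (int i + int j + 1)) x * h j x) s)"

definition op_norm ::
    "((nat \<Rightarrow> complex \<Rightarrow> complex) \<Rightarrow> (nat \<Rightarrow> complex \<Rightarrow> complex)) \<Rightarrow> ennreal" where
  "op_norm T = (SUP h\<in>{h \<in> L2l2. L2l2_norm h \<le> 1}. L2l2_norm (T h))"

end

theory Submission
  imports Defs "HOL-Probability.Probability_Measure"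
begin

text \<open>
  In the coordinates \<open>(l, z)\<close> with \<open>z1 = z\<close> and \<open>z2 = l z\<close> everything happens separately for each \<open>l\<close>: the
  elements of \<open>H1\<close> are the bounded functions whose sections in \<open>z\<close> have no negative frequencies, and the
  operator applies to a vector of functions of \<open>l\<close> the scalar Hankel matrix of the section
  \<open>\<Phi> (l, _)\<close> of the sheared symbol \<open>\<Phi> (l, z) = \<phi> (z, l z)\<close>.

  That the norm is at most the distance follows from Bessel's inequality: for a scalar symbol, the
  Hankel matrix maps a vector to the coefficients of negative index of a product, so its norm is at
  most the supremum of the symbol (\<open>hankel_scalar_bound\<close>).  Subtracting an element of \<open>H1\<close> from \<open>\<phi>\<close>
  does not change the operator (\<open>hankel_diff_H1\<close>).

  The converse is a version of Nehari's theorem.  Applying the scalar theorem on each section would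
  require a measurable choice of best approximations.  Instead, an approximation is found on the whole
  torus as the solution of a convex minimization problem, which takes care of measurability.

  Let \<open>C\<close> be the norm of the operator.  If \<open>w = \<bar>h\<bar>\<^sup>2\<close> with \<open>h\<close> and \<open>1 / h\<close> analytic and bounded, then the
  distance of \<open>\<Phi>\<close> from the analytic functions in the weighted space \<open>L\<^sup>2(w)\<close> is the norm of the
  part of \<open>h \<Phi>\<close> with negative frequencies, which is at most \<open>C \<parallel>h\<parallel>\<close>, so its square is at most
  \<open>C\<^sup>2\<close> times the integral of \<open>w\<close>.  Every weight between two positive constants has such a
  factorization, by Szego's extremal problem (\<open>outer_factorization\<close>).  Now let \<open>g\<close> minimize the integral
  of a convex increasing function \<open>\<theta>\<close> of \<open>\<bar>\<Phi> - g\<bar>\<^sup>2\<close>.  The first variation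
  (\<open>variational_principle\<close>) says that \<open>g\<close> is the best approximation in \<open>L\<^sup>2(w)\<close> for the weight
  \<open>w = \<theta>' (\<bar>\<Phi> - g\<bar>\<^sup>2)\<close>, so the integral of \<open>w (\<bar>\<Phi> - g\<bar>\<^sup>2 - C\<^sup>2)\<close> is at most zero.  If \<open>\<theta>'\<close> is tiny below \<open>C\<^sup>2\<close>
  and grows above, this forces \<open>\<bar>\<Phi> - g\<bar>\<close> to exceed \<open>C\<close> only slightly
  (\<open>nearly_optimal_approximant\<close>), and in the limit not at all (\<open>optimal_approximant\<close>).

  Existence of minimizers and the final limit rest on one Hilbert space argument,
  \<open>nested_convex_limit\<close>.
\<close>

section \<open>Square integrable functions\<close>

definition square_integrable :: "'a measure \<Rightarrow> ('a \<Rightarrow> complex) \<Rightarrow> bool" where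
  "square_integrable M f \<longleftrightarrow>
     f \<in> borel_measurable M \<and> integrable M (\<lambda>x. (cmod (f x))\<^sup>2)"

text \<open>The unqualified name refers to the gauge integral.\<close>

lemmas Lebesgue_cong = Bochner_Integration.integral_cong

abbreviation L2sq :: "'a measure \<Rightarrow> ('a \<Rightarrow> complex) \<Rightarrow> real" where
  "L2sq M f \<equiv> (\<integral>x. (cmod (f x))\<^sup>2 \<partial>M)"

lemma measurable_cnj [measurable]:
  "f \<in> borel_measurable M \<Longrightarrow> (\<lambda>x. cnj (f x)) \<in> borel_measurable M"
  by (rule borel_measurable_continuous_on[OF continuous_on_cnj[OF continuous_on_id]])

lemma square_integrable_measurable [measurable_dest]:
  "square_integrable M f \<Longrightarrow> f \<in> borel_measurable M"
  by (simp add: square_integrable_def)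

lemma square_integrable_integrable:
  "square_integrable M f \<Longrightarrow> integrable M (\<lambda>x. (cmod (f x))\<^sup>2)"
  by (simp add: square_integrable_def)

lemma square_integrable_bound:
  assumes "f \<in> borel_measurable M" "integrable M g" "AE x in M. (cmod (f x))\<^sup>2 \<le> g x"
  shows "square_integrable M f"
  unfolding square_integrable_def using assms
  by (auto intro: Bochner_Integration.integrable_bound elim!: eventually_mono)

lemma cmod_add_power2_le: "(cmod (a + b))\<^sup>2 \<le> 2 * (cmod a)\<^sup>2 + 2 * (cmod b)\<^sup>2"
proof -
  have "(cmod (a + b))\<^sup>2 \<le> (cmod a + cmod b)\<^sup>2"
    by (intro power_mono norm_triangle_ineq) auto
  also have "\<dots> \<le> 2 * (cmod a)\<^sup>2 + 2 * (cmod b)\<^sup>2"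
    using sum_squares_bound[of "cmod a" "cmod b"] by (simp add: power2_sum)
  finally show ?thesis .
qed

lemma square_integrable_add:
  assumes "square_integrable M f" "square_integrable M g"
  shows "square_integrable M (\<lambda>x. f x + g x)"
proof (rule square_integrable_bound)
  show "integrable M (\<lambda>x. 2 * (cmod (f x))\<^sup>2 + 2 * (cmod (g x))\<^sup>2)"
    using assms by (auto intro!: square_integrable_integrable)
qed (use assms in \<open>auto simp: cmod_add_power2_le intro!: borel_measurable_add square_integrable_measurable\<close>)

lemma square_integrable_bounded_mult:
  assumes f: "square_integrable M f" and a: "a \<in> borel_measurable M" "AE x in M. cmod (a x) \<le> B"
  shows "square_integrable M (\<lambda>x. a x * f x)"
proof (rule square_integrable_bound)
  show "integrable M (\<lambda>x. B\<^sup>2 * (cmod (f x))\<^sup>2)"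
    using f by (auto intro!: square_integrable_integrable)
  show "AE x in M. (cmod (a x * f x))\<^sup>2 \<le> B\<^sup>2 * (cmod (f x))\<^sup>2"
    using a(2) by eventually_elim
      (auto simp: norm_mult power_mult_distrib intro!: mult_right_mono power_mono)
qed (use f a in \<open>auto intro!: borel_measurable_times square_integrable_measurable\<close>)

lemma square_integrable_cmult:
  "square_integrable M f \<Longrightarrow> square_integrable M (\<lambda>x. c * f x)"
  by (rule square_integrable_bounded_mult[where B = "cmod c"]) auto

lemma square_integrable_diff:
  assumes "square_integrable M f" "square_integrable M g"
  shows "square_integrable M (\<lambda>x. f x - g x)"
  using square_integrable_add[OF assms(1) square_integrable_cmult[OF assms(2), of "-1"]] by simp

lemma square_integrable_cnj:
  "square_integrable M f \<Longrightarrow> square_integrable M (\<lambda>x. cnj (f x))"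
  by (simp add: square_integrable_def measurable_cnj)

lemma square_integrable_sum:
  "(\<And>i. i \<in> I \<Longrightarrow> square_integrable M (f i)) \<Longrightarrow> square_integrable M (\<lambda>x. \<Sum>i\<in>I. f i x)"
proof (induction I rule: infinite_finite_induct)
  case (insert i I)
  then show ?case by (simp add: square_integrable_add)
qed (auto simp: square_integrable_def)

lemma integrable_mult_square_integrable:
  assumes f: "square_integrable M f" and g: "square_integrable M g"
  shows "integrable M (\<lambda>x. f x * g x)"
proof (rule Bochner_Integration.integrable_bound)
  show "integrable M (\<lambda>x. (cmod (f x))\<^sup>2 + (cmod (g x))\<^sup>2)"
    using f g by (auto intro!: square_integrable_integrable)
  show "AE x in M. norm (f x * g x) \<le> norm ((cmod (f x))\<^sup>2 + (cmod (g x))\<^sup>2)"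
  proof (intro always_eventually allI)
    fix x
    have "0 \<le> (cmod (f x))\<^sup>2 + (cmod (g x))\<^sup>2 - cmod (f x) * cmod (g x)"
      using sum_squares_bound[of "cmod (f x)" "cmod (g x)"]
        mult_nonneg_nonneg[OF norm_ge_zero norm_ge_zero, of "f x" "g x"] by linarith
    then show "norm (f x * g x) \<le> norm ((cmod (f x))\<^sup>2 + (cmod (g x))\<^sup>2)"
      by (simp add: norm_mult)
  qed
qed (use f g in \<open>auto intro!: borel_measurable_times square_integrable_measurable\<close>)

lemma (in finite_measure) square_integrable_bounded:
  "f \<in> borel_measurable M \<Longrightarrow> AE x in M. cmod (f x) \<le> B \<Longrightarrow> square_integrable M f"
  by (rule square_integrable_bound[where g = "\<lambda>_. B\<^sup>2"])
     (auto elim!: eventually_mono intro!: power_mono)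

lemma (in finite_measure) square_integrable_const: "square_integrable M (\<lambda>_. c)"
  by (rule square_integrable_bounded[where B = "cmod c"]) auto

lemma (in finite_measure) integrable_of_square_integrable:
  "square_integrable M f \<Longrightarrow> integrable M f"
  using integrable_mult_square_integrable[OF _ square_integrable_const[of 1], of f] by simp

lemma Cauchy_Schwarz_integral:
  assumes f: "square_integrable M f" and g: "square_integrable M g"
  shows "(\<integral>x. cmod (f x * g x) \<partial>M)\<^sup>2
          \<le> L2sq M f * L2sq M g"
proof -
  have [measurable]: "f \<in> borel_measurable M" "g \<in> borel_measurable M"
    using f g by (auto intro: square_integrable_measurable)
  have nn: "(\<integral>\<^sup>+x. (ennreal (cmod (h x)))\<^sup>2 \<partial>M) = ennreal (L2sq M h)"
    if "square_integrable M h" for h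
    using nn_integral_eq_integral[OF square_integrable_integrable[OF that]]
    by (simp add: ennreal_power)
  have fg: "integrable M (\<lambda>x. cmod (f x * g x))"
    using integrable_mult_square_integrable[OF f g] by (rule integrable_norm)
  have "(\<integral>\<^sup>+x. ennreal (cmod (f x)) * ennreal (cmod (g x)) \<partial>M)\<^sup>2
          \<le> (\<integral>\<^sup>+x. (ennreal (cmod (f x)))\<^sup>2 \<partial>M) * (\<integral>\<^sup>+x. (ennreal (cmod (g x)))\<^sup>2 \<partial>M)"
    by (rule Cauchy_Schwarz_nn_integral) auto
  also have "(\<integral>\<^sup>+x. ennreal (cmod (f x)) * ennreal (cmod (g x)) \<partial>M)
               = ennreal (\<integral>x. cmod (f x * g x) \<partial>M)"
    using nn_integral_eq_integral[OF fg] by (simp add: norm_mult ennreal_mult)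
  finally have "ennreal ((\<integral>x. cmod (f x * g x) \<partial>M)\<^sup>2)
      \<le> ennreal (L2sq M f * L2sq M g)"
    unfolding nn[OF f] nn[OF g] by (simp add: ennreal_power ennreal_mult)
  then show ?thesis
    by (simp add: ennreal_le_iff)
qed

lemma Cauchy_Schwarz_norm_integral:
  assumes "square_integrable M f" "square_integrable M g"
  shows "(cmod (\<integral>x. f x * g x \<partial>M))\<^sup>2
          \<le> L2sq M f * L2sq M g"
proof -
  have "(cmod (\<integral>x. f x * g x \<partial>M))\<^sup>2 \<le> (\<integral>x. cmod (f x * g x) \<partial>M)\<^sup>2"
    by (intro power_mono integral_norm_bound) simp
  also note Cauchy_Schwarz_integral[OF assms]
  finally show ?thesis .
qed

lemma (in prob_space) integral_cmod_power2_le: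
  assumes "square_integrable M f"
  shows "(\<integral>x. cmod (f x) \<partial>M)\<^sup>2 \<le> L2sq M f"
  using Cauchy_Schwarz_integral[OF assms square_integrable_const[of 1]] by (simp add: prob_space)

text \<open>Membership in the spaces below is described by integrals against fixed test functions, so this
  is what makes those spaces closed.\<close>

lemma L2_tendsto_inner:
  assumes s: "\<And>n. square_integrable M (s n)" and g: "square_integrable M g"
    and f: "square_integrable M f"
    and lim: "(\<lambda>n. L2sq M (\<lambda>x. s n x - g x)) \<longlonglongrightarrow> 0"
  shows "(\<lambda>n. \<integral>x. f x * s n x \<partial>M) \<longlonglongrightarrow> (\<integral>x. f x * g x \<partial>M)"
proof -
  have "(\<lambda>n. (cmod ((\<integral>x. f x * s n x \<partial>M) - (\<integral>x. f x * g x \<partial>M)))\<^sup>2) \<longlonglongrightarrow> 0"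
  proof (rule tendsto_sandwich[OF _ _ tendsto_const])
    show "(\<lambda>n. L2sq M f * L2sq M (\<lambda>x. s n x - g x)) \<longlonglongrightarrow> 0"
      using tendsto_mult_right_zero[OF lim] by simp
    show "\<forall>\<^sub>F n in sequentially. (cmod ((\<integral>x. f x * s n x \<partial>M) - (\<integral>x. f x * g x \<partial>M)))\<^sup>2
        \<le> L2sq M f * L2sq M (\<lambda>x. s n x - g x)"
    proof (intro always_eventually allI)
      fix n
      have "(\<integral>x. f x * s n x \<partial>M) - (\<integral>x. f x * g x \<partial>M) = (\<integral>x. f x * (s n x - g x) \<partial>M)"
        using s f g
        by (simp add: right_diff_distrib integrable_mult_square_integrable flip: Bochner_Integration.integral_diff)
      then show "(cmod ((\<integral>x. f x * s n x \<partial>M) - (\<integral>x. f x * g x \<partial>M)))\<^sup>2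
        \<le> L2sq M f * L2sq M (\<lambda>x. s n x - g x)"
        using Cauchy_Schwarz_norm_integral[OF f square_integrable_diff[OF s g]] by simp
    qed
  qed auto
  then have "(\<lambda>n. cmod ((\<integral>x. f x * s n x \<partial>M) - (\<integral>x. f x * g x \<partial>M))) \<longlonglongrightarrow> 0"
    using tendsto_real_sqrt by fastforce
  then show ?thesis
    by (simp add: LIM_zero_iff tendsto_norm_zero_iff)
qed

text \<open>Fatou's lemma in the form used for lower semicontinuity: bounds on the integrals pass to a
  limit of functions that is only known almost everywhere.\<close>

lemma Fatou_integral:
  fixes X :: "nat \<Rightarrow> 'a \<Rightarrow> real"
  assumes int: "\<And>n. integrable M (X n)" and nonneg: "\<And>n x. 0 \<le> X n x"
    and Y [measurable]: "Y \<in> borel_measurable M" and lim: "AE x in M. (\<lambda>n. X n x) \<longlonglongrightarrow> Y x"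
    and le: "\<forall>\<^sub>F n in sequentially. (\<integral>x. X n x \<partial>M) \<le> c n" and c: "c \<longlonglongrightarrow> C"
  shows "integrable M Y" and "(\<integral>x. Y x \<partial>M) \<le> C"
proof -
  have [measurable]: "\<And>n. X n \<in> borel_measurable M" using int by auto
  have Y0: "AE x in M. 0 \<le> Y x"
    using lim by eventually_elim (auto intro: LIMSEQ_le_const nonneg)
  have "(\<integral>\<^sup>+x. ennreal (Y x) \<partial>M) = (\<integral>\<^sup>+x. liminf (\<lambda>n. ennreal (X n x)) \<partial>M)"
  proof (rule nn_integral_cong_AE)
    show "AE x in M. ennreal (Y x) = liminf (\<lambda>n. ennreal (X n x))"
      using lim by eventually_elim (auto intro!: lim_imp_Liminf[symmetric] tendsto_ennrealI)
  qed
  also have "\<dots> \<le> liminf (\<lambda>n. \<integral>\<^sup>+x. ennreal (X n x) \<partial>M)"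
    by (rule nn_integral_liminf) auto
  also have "\<dots> = liminf (\<lambda>n. ennreal (\<integral>x. X n x \<partial>M))"
    by (simp add: nn_integral_eq_integral int nonneg)
  also have "\<dots> \<le> liminf (\<lambda>n. ennreal (c n))"
    by (rule Liminf_mono) (use le in \<open>auto elim!: eventually_mono intro: ennreal_leI\<close>)
  also have "\<dots> = ennreal C"
    by (intro lim_imp_Liminf tendsto_ennrealI c) auto
  finally have nn: "(\<integral>\<^sup>+x. ennreal (Y x) \<partial>M) \<le> ennreal C" .
  then have "(\<integral>\<^sup>+x. ennreal (Y x) \<partial>M) < \<infinity>"
    by (simp add: le_less_trans)
  then show Yi: "integrable M Y"
    by (intro integrableI_nonneg Y Y0) auto
  have "0 \<le> C"
  proof (rule tendsto_le[OF _ c tendsto_const])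
    show "\<forall>\<^sub>F n in sequentially. 0 \<le> c n"
      using le by eventually_elim
        (meson Bochner_Integration.integral_nonneg nonneg order_trans)
  qed auto
  then show "(\<integral>x. Y x \<partial>M) \<le> C"
    using nn nn_integral_eq_integral[OF Yi Y0] by simp
qed

text \<open>The Riesz--Fischer theorem.  An \<open>L\<^sup>2\<close> Cauchy sequence is Cauchy in \<open>L\<^sup>1\<close>, hence some
  subsequence converges almost everywhere, and Fatou's lemma shows that its limit is the limit in
  \<open>L\<^sup>2\<close>.  The almost everywhere convergent subsequence is part of the conclusion because nonlinear
  functionals are later passed to the limit along it.\<close>

lemma (in prob_space) L2_complete:
  assumes s: "\<And>n. square_integrable M (s n)"
    and cauchy: "\<And>e. 0 < e \<Longrightarrow> \<exists>N. \<forall>i\<ge>N. \<forall>j\<ge>N. L2sq M (\<lambda>x. s i x - s j x) < e"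
  obtains g r where "square_integrable M g" "strict_mono (r :: nat \<Rightarrow> nat)"
    "AE x in M. (\<lambda>n. s (r n) x) \<longlonglongrightarrow> g x"
    "(\<lambda>n. L2sq M (\<lambda>x. s n x - g x)) \<longlonglongrightarrow> 0"
proof -
  have [measurable]: "\<And>n. s n \<in> borel_measurable M"
    using s by (auto intro: square_integrable_measurable)
  have "\<exists>N. \<forall>i\<ge>N. \<forall>j\<ge>N. (\<integral>x. norm (s i x - s j x) \<partial>M) < e" if "0 < e" for e :: real
  proof -
    have e2: "0 < e\<^sup>2" using that by simp
    obtain N where N: "\<forall>i\<ge>N. \<forall>j\<ge>N. L2sq M (\<lambda>x. s i x - s j x) < e\<^sup>2"
      using cauchy[OF e2] by blast
    have "(\<integral>x. norm (s i x - s j x) \<partial>M) < e" if "i \<ge> N" "j \<ge> N" for i j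
    proof (rule power_less_imp_less_base)
      show "(\<integral>x. norm (s i x - s j x) \<partial>M)\<^sup>2 < e\<^sup>2"
        using integral_cmod_power2_le[OF square_integrable_diff[OF s s], of i j] N that
        by (auto intro: le_less_trans)
    qed (use \<open>0 < e\<close> in auto)
    then show ?thesis by blast
  qed
  then obtain r where r: "strict_mono r" and C: "AE x in M. Cauchy (\<lambda>i. s (r i) x)"
    using cauchy_L1_AE_cauchy_subseq[of M s] integrable_of_square_integrable[OF s] by metis
  define g where "g x = lim (\<lambda>i. s (r i) x)" for x
  have [measurable]: "g \<in> borel_measurable M"
    unfolding g_def by (rule borel_measurable_lim_metric) auto
  have conv: "AE x in M. (\<lambda>n. s (r n) x) \<longlonglongrightarrow> g x"
    using C by eventually_elim (auto simp: g_def Cauchy_convergent_iff convergent_LIMSEQ_iff)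
  have key: "\<exists>N. \<forall>n\<ge>N. square_integrable M (\<lambda>x. s n x - g x) \<and>
                L2sq M (\<lambda>x. s n x - g x) \<le> e" if "0 < e" for e
  proof -
    obtain N where N: "\<forall>i\<ge>N. \<forall>j\<ge>N. L2sq M (\<lambda>x. s i x - s j x) < e"
      using cauchy[OF \<open>0 < e\<close>] by blast
    have "integrable M (\<lambda>x. (cmod (s n x - g x))\<^sup>2) \<and> L2sq M (\<lambda>x. s n x - g x) \<le> e"
      if n: "n \<ge> N" for n
    proof -
      have "AE x in M. (\<lambda>i. (cmod (s n x - s (r i) x))\<^sup>2) \<longlonglongrightarrow> (cmod (s n x - g x))\<^sup>2"
        using conv by eventually_elim (auto intro!: tendsto_intros)
      moreover have "\<forall>\<^sub>F i in sequentially. L2sq M (\<lambda>x. s n x - s (r i) x) \<le> e"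
        unfolding eventually_sequentially
      proof (intro exI[of _ N] allI impI)
        fix i assume "N \<le> i"
        then have "N \<le> r i" using seq_suble[OF r, of i] by linarith
        with N n show "L2sq M (\<lambda>x. s n x - s (r i) x) \<le> e" by (simp add: less_imp_le)
      qed
      moreover have "integrable M (\<lambda>x. (cmod (s n x - s (r i) x))\<^sup>2)" for i
        by (intro square_integrable_integrable square_integrable_diff s)
      ultimately show ?thesis
        using Fatou_integral[of M "\<lambda>i x. (cmod (s n x - s (r i) x))\<^sup>2" "\<lambda>x. (cmod (s n x - g x))\<^sup>2" "\<lambda>_. e" e]
        by simp
    qed
    then show ?thesis by (auto simp: square_integrable_def)
  qed
  obtain n where "square_integrable M (\<lambda>x. s n x - g x)" using key[of 1] by auto
  from square_integrable_diff[OF s[of n] this] have g: "square_integrable M g" by simp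
  have "(\<lambda>n. L2sq M (\<lambda>x. s n x - g x)) \<longlonglongrightarrow> 0"
  proof (rule LIMSEQ_I)
    fix e :: real assume "0 < e"
    with key[of "e/2"] obtain N where "\<forall>n\<ge>N. L2sq M (\<lambda>x. s n x - g x) \<le> e/2" by auto
    with \<open>0 < e\<close> show "\<exists>N. \<forall>n\<ge>N. norm (L2sq M (\<lambda>x. s n x - g x) - 0) < e"
      by (intro exI[of _ N]) (auto intro: le_less_trans)
  qed
  with g r conv that show ?thesis by blast
qed

lemma parallelogram_integral:
  assumes "square_integrable M f" "square_integrable M g"
  shows "L2sq M (\<lambda>x. f x - g x) =
    2 * L2sq M f + 2 * L2sq M g
      - 4 * L2sq M (\<lambda>x. (f x + g x) / 2)"
proof -
  note I = assms[THEN square_integrable_integrable]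
    square_integrable_cmult[OF square_integrable_add[OF assms], of "1/2", THEN square_integrable_integrable]
  have eq: "(cmod (a - b))\<^sup>2 = 2 * (cmod a)\<^sup>2 + 2 * (cmod b)\<^sup>2 - 4 * (cmod ((a + b) / 2))\<^sup>2" for a b
    by (simp add: cmod_power2 norm_divide power_divide algebra_simps) (simp add: power2_eq_square algebra_simps)
  show ?thesis
    unfolding eq using I by (simp add: mult.commute)
qed

text \<open>A substitute for the weak compactness of balls.  Instead of a weak limit of arbitrary elements,
  elements of nearly minimal norm are chosen.  The minimal norms increase with the index and are
  bounded, and since midpoints stay in the larger of two sets, the parallelogram law makes the
  chosen elements a Cauchy sequence.\<close>

lemma (in prob_space) nested_convex_limit:
  fixes A :: "nat \<Rightarrow> ('a \<Rightarrow> complex) set"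
  assumes sq: "\<And>n f. f \<in> A n \<Longrightarrow> square_integrable M f" and dec: "decseq A"
    and mid: "\<And>n f g. f \<in> A n \<Longrightarrow> g \<in> A n \<Longrightarrow> (\<lambda>x. (f x + g x) / 2) \<in> A n"
    and bdd: "\<And>n. \<exists>f\<in>A n. L2sq M f \<le> R"
  obtains s g where "\<And>n. s n \<in> A n" "square_integrable M g"
    "AE x in M. (\<lambda>n. s n x) \<longlonglongrightarrow> g x" "(\<lambda>n. L2sq M (\<lambda>x. s n x - g x)) \<longlonglongrightarrow> 0"
proof -
  define N where "N f = L2sq M f" for f
  define d where "d n = (INF f\<in>A n. N f)" for n
  have ne: "A n \<noteq> {}" for n using bdd by blast
  have N0: "0 \<le> N f" for f by (simp add: N_def)
  then have bb: "bdd_below (N ` A n)" for n by (intro bdd_belowI[of _ 0]) auto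
  have dle: "d n \<le> N f" if "f \<in> A n" for n f
    unfolding d_def using bb that by (rule cINF_lower)
  have "d m \<le> d n" if "m \<le> n" for m n
    using decseqD[OF dec that] ne bb unfolding d_def by (intro cINF_superset_mono) auto
  then have "incseq d" by (simp add: incseq_def)
  moreover have "d n \<le> R" for n
    using bdd[of n] dle[of _ n] N_def by force
  ultimately obtain D where D: "d \<longlonglongrightarrow> D" using incseq_convergent by blast
  have "\<exists>f\<in>A n. N f < d n + 1 / Suc n" for n
    using ne bb by (subst cINF_less_iff[symmetric]) (auto simp: d_def)
  then obtain s where s: "\<And>n. s n \<in> A n" and "\<And>n. N (s n) < d n + 1 / Suc n" by metis
  moreover define \<delta> where "\<delta> n = 1 / real (Suc n)" for n
  ultimately have s2: "\<And>n. N (s n) < d n + \<delta> n" by simp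
  \<comment> \<open>the midpoint of the two functions lies in the larger set, so its norm is at least the infimum there\<close>
  have close: "N (\<lambda>x. s i x - s j x) \<le> 2 * (d j - d i) + 2 * \<delta> i + 2 * \<delta> j"
    if "i \<le> j" for i j
  proof -
    have "s j \<in> A i" using s decseqD[OF dec that] by blast
    moreover define m where "m = (\<lambda>x. (s i x + s j x) / 2)"
    ultimately have "d i \<le> N m" using mid s dle by blast
    moreover have "N (\<lambda>x. s i x - s j x) = 2 * N (s i) + 2 * N (s j) - 4 * N m"
      unfolding N_def m_def by (rule parallelogram_integral) (use s sq in blast)+
    moreover have "2 * N (s i) \<le> 2 * d i + 2 * \<delta> i" "2 * N (s j) \<le> 2 * d j + 2 * \<delta> j"
      using s2[of i] s2[of j] by simp_all
    ultimately show ?thesis by simp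
  qed
  have "\<exists>K. \<forall>i\<ge>K. \<forall>j\<ge>K. N (\<lambda>x. s i x - s j x) < e" if "0 < e" for e
  proof -
    have "\<delta> \<longlonglongrightarrow> 0" using LIMSEQ_inverse_real_of_nat unfolding \<delta>_def by (simp add: inverse_eq_divide)
    from order_tendstoD(2)[OF this, of "e/8"] order_tendstoD(1)[OF D, of "D - e/8"] that
    have "\<forall>\<^sub>F n in sequentially. \<delta> n < e/8 \<and> D - e/8 < d n"
      by (auto intro: eventually_conj)
    then obtain K where K: "\<And>n. n \<ge> K \<Longrightarrow> \<delta> n < e/8 \<and> D - e/8 < d n"
      by (auto simp: eventually_sequentially)
    have le: "N (\<lambda>x. s i x - s j x) < e" if "i \<ge> K" "i \<le> j" for i j
      by (rule le_less_trans[OF close[OF that(2)]])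
        (use K[OF that(1)] K[OF order_trans[OF that]] incseq_le[OF \<open>incseq d\<close> D, of j] \<open>0 < e\<close> in auto)
    have "N (\<lambda>x. s i x - s j x) < e" if "i \<ge> K" "j \<ge> K" for i j
      using le[of i j] le[of j i] that unfolding N_def
      by (cases "i \<le> j") (auto simp: norm_minus_commute)
    then show ?thesis by blast
  qed
  then obtain g r where g: "square_integrable M g" "strict_mono (r :: nat \<Rightarrow> nat)"
    "AE x in M. (\<lambda>n. s (r n) x) \<longlonglongrightarrow> g x"
    "(\<lambda>n. L2sq M (\<lambda>x. s n x - g x)) \<longlonglongrightarrow> 0"
    by (rule L2_complete[OF sq[OF s], unfolded N_def[symmetric]]) (auto simp: N_def)
  show ?thesis
  proof (rule that[of "\<lambda>n. s (r n)" g])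
    show "s (r n) \<in> A n" for n using s[of "r n"] decseqD[OF dec seq_suble[OF g(2), of n]] by blast
    show "(\<lambda>n. L2sq M (\<lambda>x. s (r n) x - g x)) \<longlonglongrightarrow> 0"
      using LIMSEQ_subseq_LIMSEQ[OF g(4) g(2)] by (simp add: o_def)
  qed (use g in auto)
qed

section \<open>The circle\<close>

lemma measurable_cis_circle:
  "(\<lambda>t. cis (2 * pi * t)) \<in> borel \<rightarrow>\<^sub>M restrict_space borel (sphere 0 1)"
proof (rule measurable_restrict_space2)
  have "continuous_on UNIV (\<lambda>t. cis (2 * pi * t))" by (intro continuous_intros)
  then show "(\<lambda>t. cis (2 * pi * t)) \<in> borel_measurable borel"
    by (rule borel_measurable_continuous_onI)
qed auto

lemma space_circle [simp]: "space circle = sphere 0 1"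
  by (simp add: circle_def space_restrict_space)

lemma sets_circle [measurable_cong]: "sets circle = sets (restrict_space borel (sphere 0 1))"
  by (simp add: circle_def)

lemma nn_integral_circle:
  assumes "f \<in> borel_measurable circle"
  shows "(\<integral>\<^sup>+z. f z \<partial>circle) = (\<integral>\<^sup>+t. f (cis (2 * pi * t)) * indicator {0..1} t \<partial>lborel)"
proof -
  have [measurable]: "f \<in> borel_measurable (restrict_space borel (sphere 0 1))"
    using assms by (simp cong: measurable_cong_sets add: sets_circle)
  note measurable_cis_circle [measurable]
  have "(\<integral>\<^sup>+z. f z \<partial>circle) = (\<integral>\<^sup>+t. f (cis (2 * pi * t)) \<partial>uniform_measure lborel {0..1})"
    unfolding circle_def by (rule nn_integral_distr) measurable
  also have "\<dots> = (\<integral>\<^sup>+t. f (cis (2 * pi * t)) * indicator {0..1} t \<partial>lborel) / emeasure lborel {0..1::real}"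
    by (rule nn_integral_uniform_measure) measurable
  finally show ?thesis by (simp add: divide_ennreal_def)
qed

lemma prob_space_circle: "prob_space circle"
proof
  show "emeasure circle (space circle) = 1"
    using nn_integral_circle[of "\<lambda>_. 1"] by simp
qed

interpretation circle: prob_space circle by (rule prob_space_circle)

lemma prob_circle [simp]: "measure circle (sphere 0 1) = 1"
  using circle.prob_space by simp

lemma AE_circle_norm: "AE z in circle. cmod z = 1"
  by (rule AE_I2) simp

lemma circle_mult_cnj: "z \<in> space circle \<Longrightarrow> z * cnj z = 1"
  by (simp add: complex_norm_square[symmetric])

lemma measurable_ident_circle [measurable]: "(\<lambda>z. z) \<in> borel_measurable circle"
  by (simp cong: measurable_cong_sets add: sets_circle measurable_restrict_space1)

lemma measurable_circleI:
  "f \<in> borel_measurable M \<Longrightarrow> (\<And>x. x \<in> space M \<Longrightarrow> cmod (f x) = 1) \<Longrightarrow> f \<in> M \<rightarrow>\<^sub>M circle"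
  by (simp cong: measurable_cong_sets add: sets_circle measurable_restrict_space2_iff Pi_iff)

lemma measurable_rotate: "cmod \<zeta> = 1 \<Longrightarrow> (\<lambda>z. \<zeta> * z) \<in> circle \<rightarrow>\<^sub>M circle"
  by (rule measurable_circleI) (auto simp: norm_mult)

text \<open>In the angular parameter a rotation is a translation of a function of period one.  The window
  from \<open>a\<close> to \<open>a + 1\<close> is cut at \<open>1\<close>, and its second part is moved back by one period.\<close>

lemma nn_integral_rotate:
  assumes f [measurable]: "f \<in> borel_measurable circle" and \<zeta>: "cmod \<zeta> = 1"
  shows "(\<integral>\<^sup>+z. f (\<zeta> * z) \<partial>circle) = (\<integral>\<^sup>+z. f z \<partial>circle)"
proof -
  obtain \<theta> where \<theta>: "0 \<le> \<theta>" "\<theta> < 2 * pi" "\<zeta> = cis \<theta>"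
    using complex_unimodular_polar[of \<zeta>] \<zeta> by (metis cis_conv_exp cis.code)
  define a where "a = \<theta> / (2 * pi)"
  have a: "0 \<le> a" "a < 1" "\<zeta> = cis (2 * pi * a)" using \<theta> by (auto simp: a_def)
  define F where "F t = f (cis (2 * pi * t))" for t
  have F [measurable]: "F \<in> borel_measurable borel"
    unfolding F_def
    by (rule measurable_compose[OF measurable_cis_circle])
      (use f in \<open>simp cong: measurable_cong_sets add: sets_circle\<close>)
  have per: "F (t + 1) = F t" for t
  proof -
    have "cis (2 * pi * (t + 1)) = cis (2 * pi * t) * cis (2 * pi)"
      by (simp add: cis_mult algebra_simps)
    then show ?thesis by (simp add: F_def)
  qed
  have half_open: "(\<integral>\<^sup>+t. G t * indicator {0..1} t \<partial>lborel) = (\<integral>\<^sup>+t. G t * indicator {0..<1} t \<partial>lborel)"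
    for G :: "real \<Rightarrow> ennreal"
  proof (rule nn_integral_cong_AE)
    show "AE t in lborel. G t * indicator {0..1} t = G t * indicator {0..<1} t"
      using AE_lborel_singleton[of 1] by eventually_elim (auto split: split_indicator)
  qed
  have "(\<integral>\<^sup>+z. f (\<zeta> * z) \<partial>circle) = (\<integral>\<^sup>+t. F (a + t) * indicator {0..1} t \<partial>lborel)"
    using measurable_compose[OF measurable_rotate[OF \<zeta>] f]
    by (subst nn_integral_circle) (auto simp: F_def a cis_mult algebra_simps)
  also have "\<dots> = (\<integral>\<^sup>+t. F (a + t) * indicator {0..<1} t \<partial>lborel)" by (rule half_open)
  also have "\<dots> = (\<integral>\<^sup>+t. F t * indicator {a..<a + 1} t \<partial>lborel)"
    using nn_integral_real_affine[of "\<lambda>t. F t * indicator {a..<a + 1} t" 1 a]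
    by (auto intro!: nn_integral_cong split: split_indicator)
  also have "\<dots> = (\<integral>\<^sup>+t. F t * indicator {a..<1} t + F t * indicator {1..<a + 1} t \<partial>lborel)"
    using a by (intro nn_integral_cong) (auto split: split_indicator)
  also have "\<dots> = (\<integral>\<^sup>+t. F t * indicator {a..<1} t \<partial>lborel) + (\<integral>\<^sup>+t. F t * indicator {1..<a + 1} t \<partial>lborel)"
    by (rule nn_integral_add) auto
  also have "(\<integral>\<^sup>+t. F t * indicator {1..<a + 1} t \<partial>lborel) = (\<integral>\<^sup>+t. F t * indicator {0..<a} t \<partial>lborel)"
    using nn_integral_real_affine[of "\<lambda>t. F t * indicator {1..<a + 1} t" 1 1] per
    by (auto intro!: nn_integral_cong split: split_indicator simp: add.commute)
  also have "(\<integral>\<^sup>+t. F t * indicator {a..<1} t \<partial>lborel) + (\<integral>\<^sup>+t. F t * indicator {0..<a} t \<partial>lborel)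
      = (\<integral>\<^sup>+t. F t * indicator {a..<1} t + F t * indicator {0..<a} t \<partial>lborel)"
    by (rule nn_integral_add[symmetric]) auto
  also have "\<dots> = (\<integral>\<^sup>+t. F t * indicator {0..<1} t \<partial>lborel)"
    using a by (intro nn_integral_cong) (auto split: split_indicator)
  also have "\<dots> = (\<integral>\<^sup>+z. f z \<partial>circle)"
    by (simp add: nn_integral_circle[OF f] half_open F_def)
  finally show ?thesis .
qed

lemma distr_rotate:
  assumes "cmod \<zeta> = 1"
  shows "distr circle circle (\<lambda>z. \<zeta> * z) = circle"
proof (rule measure_eqI)
  fix A assume "A \<in> sets (distr circle circle (\<lambda>z. \<zeta> * z))"
  then have A [measurable]: "A \<in> sets circle" by simp
  note measurable_rotate[OF assms, measurable]
  have "emeasure (distr circle circle (\<lambda>z. \<zeta> * z)) A = (\<integral>\<^sup>+z. indicator A z \<partial>distr circle circle (\<lambda>z. \<zeta> * z))"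
    by simp
  also have "\<dots> = (\<integral>\<^sup>+z. indicator A (\<zeta> * z) \<partial>circle)"
    by (rule nn_integral_distr) auto
  also have "\<dots> = (\<integral>\<^sup>+z. indicator A z \<partial>circle)"
    by (rule nn_integral_rotate[OF _ assms]) simp
  finally show "emeasure (distr circle circle (\<lambda>z. \<zeta> * z)) A = emeasure circle A" by simp
qed simp

text \<open>Rotation by a \<open>k\<close>-th root of \<open>-1\<close> preserves the measure but changes the sign of the integrand.\<close>

lemma integral_circle_power:
  assumes "0 < k"
  shows "(\<integral>z. z ^ k \<partial>circle) = 0"
proof -
  define \<zeta> where "\<zeta> = cis (pi / k)"
  have "\<zeta> ^ k = -1" using assms by (simp add: \<zeta>_def Complex.DeMoivre)
  have \<zeta>: "cmod \<zeta> = 1" by (simp add: \<zeta>_def)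
  note measurable_rotate[OF \<zeta>, measurable]
  have "(\<integral>z. z ^ k \<partial>circle) = (\<integral>z. z ^ k \<partial>distr circle circle (\<lambda>z. \<zeta> * z))"
    by (simp add: distr_rotate[OF \<zeta>])
  also have "\<dots> = (\<integral>z. (\<zeta> * z) ^ k \<partial>circle)"
    by (rule integral_distr) auto
  also have "\<dots> = - (\<integral>z. z ^ k \<partial>circle)"
    by (simp add: power_mult_distrib \<open>\<zeta> ^ k = -1\<close>)
  finally show ?thesis by simp
qed

lemma circle_square_integrable_power [simp]: "square_integrable circle (\<lambda>z. z ^ k)"
  by (rule circle.square_integrable_bounded[where B = 1])
    (use AE_circle_norm in \<open>auto simp: norm_power elim!: eventually_mono\<close>)

lemma integrable_bounded_mult:
  fixes f a :: "'a \<Rightarrow> complex"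
  assumes "integrable M f" "a \<in> borel_measurable M" "AE x in M. cmod (a x) \<le> B"
  shows "integrable M (\<lambda>x. f x * a x)"
proof (rule Bochner_Integration.integrable_bound)
  show "integrable M (\<lambda>x. B * f x)" using assms(1) by simp
  show "AE x in M. norm (f x * a x) \<le> norm (complex_of_real B * f x)"
    using assms(3) by eventually_elim
      (auto simp: norm_mult mult.commute intro!: mult_right_mono elim: order_trans)
qed (use assms in auto)

lemma circle_integrable_mult:
  fixes f :: "complex \<Rightarrow> complex"
  assumes "integrable circle f"
  shows "integrable circle (\<lambda>z. f z * z ^ k)" "integrable circle (\<lambda>z. f z * cnj z ^ k)"
  by (rule integrable_bounded_mult[OF assms, where B = 1];
      use AE_circle_norm in \<open>auto simp: norm_power elim!: eventually_mono\<close>)+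

lemma integral_power_cnj_power:
  "(\<integral>z. z ^ i * cnj z ^ j \<partial>circle) = (if i = j then 1 else 0)"
proof -
  have gt: "(\<integral>z. z ^ i * cnj z ^ j \<partial>circle) = 0" if "j < i" for i j
  proof -
    have "(\<integral>z. z ^ i * cnj z ^ j \<partial>circle) = (\<integral>z. z ^ (i - j) \<partial>circle)"
    proof (rule Lebesgue_cong)
      fix z assume "z \<in> space circle"
      then have "z ^ j * cnj z ^ j = 1" by (simp add: circle_mult_cnj flip: power_mult_distrib)
      moreover have "z ^ i = z ^ (i - j) * z ^ j" using that by (simp flip: power_add)
      ultimately show "z ^ i * cnj z ^ j = z ^ (i - j)" by (simp add: mult.assoc)
    qed simp
    then show ?thesis using that by (simp add: integral_circle_power)
  qed
  consider "j < i" | "i < j" | "i = j" by linarith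
  then show ?thesis
  proof cases
    case 2
    have "(\<integral>z. z ^ i * cnj z ^ j \<partial>circle) = cnj (\<integral>z. z ^ j * cnj z ^ i \<partial>circle)"
      using Bochner_Integration.integral_cnj[of circle "\<lambda>z. z ^ j * cnj z ^ i"] by (simp add: mult.commute)
    with 2 gt show ?thesis by simp
  next
    case 3
    have "(\<integral>z. z ^ i * cnj z ^ i \<partial>circle) = (\<integral>z. 1 \<partial>circle)"
      by (rule Lebesgue_cong) (simp_all add: circle_mult_cnj flip: power_mult_distrib)
    with 3 show ?thesis by (simp add: circle.prob_space)
  qed (use gt in simp)
qed

subsection \<open>Uniqueness of Fourier coefficients\<close>

text \<open>The uniqueness theorem concerns the integrable functions all of whose Fourier coefficients are
  zero.  They form a space that is stable under multiplication by \<open>z\<close> and by its conjugate, hence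
  under multiplication by every real polynomial in the real and imaginary parts of \<open>z\<close>; the
  Stone--Weierstrass theorem then shows that such a function annihilates all continuous functions.\<close>

definition fourier_vanishes :: "(complex \<Rightarrow> complex) \<Rightarrow> bool" where
  "fourier_vanishes f \<longleftrightarrow> integrable circle f \<and>
     (\<forall>n. (\<integral>z. f z * z ^ n \<partial>circle) = 0) \<and> (\<forall>n. (\<integral>z. f z * cnj z ^ n \<partial>circle) = 0)"

lemma fourier_vanishes_add:
  "fourier_vanishes f \<Longrightarrow> fourier_vanishes g \<Longrightarrow> fourier_vanishes (\<lambda>z. f z + g z)"
  by (simp add: fourier_vanishes_def distrib_right circle_integrable_mult)

lemma fourier_vanishes_cmult: "fourier_vanishes f \<Longrightarrow> fourier_vanishes (\<lambda>z. c * f z)"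
  by (simp add: fourier_vanishes_def mult.assoc)

lemma fourier_vanishes_mult_ident:
  assumes "fourier_vanishes f"
  shows "fourier_vanishes (\<lambda>z. f z * z)"
  unfolding fourier_vanishes_def
proof (intro conjI allI)
  have f: "integrable circle f" using assms by (simp add: fourier_vanishes_def)
  from circle_integrable_mult(1)[OF f, of 1] show "integrable circle (\<lambda>z. f z * z)" by simp
  fix n
  show "(\<integral>z. f z * z * z ^ n \<partial>circle) = 0"
    using assms by (auto simp: fourier_vanishes_def mult.assoc simp flip: power_Suc)
  show "(\<integral>z. f z * z * cnj z ^ n \<partial>circle) = 0"
  proof (cases n)
    case 0
    have "(\<integral>z. f z * z ^ 1 \<partial>circle) = 0"
      using assms unfolding fourier_vanishes_def by blast
    with 0 show ?thesis by simp
  next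
    case (Suc m)
    have "(\<integral>z. f z * z * cnj z ^ n \<partial>circle) = (\<integral>z. f z * cnj z ^ m \<partial>circle)"
      using circle_mult_cnj by (intro Lebesgue_cong) (auto simp: Suc)
    with assms show ?thesis by (simp add: fourier_vanishes_def)
  qed
qed

lemma fourier_vanishes_cnj: "fourier_vanishes f \<Longrightarrow> fourier_vanishes (\<lambda>z. cnj (f z))"
  unfolding fourier_vanishes_def
proof (elim conjE, intro conjI allI)
  fix n
  assume *: "\<forall>n. (\<integral>z. f z * z ^ n \<partial>circle) = 0" "\<forall>n. (\<integral>z. f z * cnj z ^ n \<partial>circle) = 0"
  have "(\<integral>z. cnj (f z) * z ^ n \<partial>circle) = cnj (\<integral>z. f z * cnj z ^ n \<partial>circle)"
    using Bochner_Integration.integral_cnj[of circle "\<lambda>z. f z * cnj z ^ n"] by simp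
  with * show "(\<integral>z. cnj (f z) * z ^ n \<partial>circle) = 0" by simp
  have "(\<integral>z. cnj (f z) * cnj z ^ n \<partial>circle) = cnj (\<integral>z. f z * z ^ n \<partial>circle)"
    using Bochner_Integration.integral_cnj[of circle "\<lambda>z. f z * z ^ n"] by simp
  with * show "(\<integral>z. cnj (f z) * cnj z ^ n \<partial>circle) = 0" by simp
qed simp

lemma fourier_vanishes_mult_cnj:
  assumes "fourier_vanishes f"
  shows "fourier_vanishes (\<lambda>z. f z * cnj z)"
  using fourier_vanishes_cnj[OF fourier_vanishes_mult_ident[OF fourier_vanishes_cnj[OF assms]]] by simp

text \<open>A real linear functional of \<open>z\<close> is a complex linear combination of \<open>z\<close> and \<open>cnj z\<close>.\<close>

lemma fourier_vanishes_mult_polynomial: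
  assumes "real_polynomial_function p" "fourier_vanishes f"
  shows "fourier_vanishes (\<lambda>z. f z * complex_of_real (p z))"
  using assms
proof (induction arbitrary: f)
  case lin: (linear h)
  then interpret bounded_linear h by simp
  have hz: "h z = Re z * h 1 + Im z * h \<i>" for z
  proof -
    have "z = Re z *\<^sub>R 1 + Im z *\<^sub>R \<i>" by (simp add: complex_eq_iff)
    then have "h z = h (Re z *\<^sub>R 1 + Im z *\<^sub>R \<i>)" by simp
    then show ?thesis by (simp only: add scaleR real_scaleR_def)
  qed
  have h: "complex_of_real (h z) = (h 1 / 2 - \<i> * h \<i> / 2) * z + (h 1 / 2 + \<i> * h \<i> / 2) * cnj z" for z
    by (subst hz[of z]) (simp add: complex_eq_iff)
  have "fourier_vanishes (\<lambda>z. (h 1 / 2 - \<i> * h \<i> / 2) * (f z * z) + (h 1 / 2 + \<i> * h \<i> / 2) * (f z * cnj z))"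
    using lin by (intro fourier_vanishes_add fourier_vanishes_cmult
        fourier_vanishes_mult_ident fourier_vanishes_mult_cnj)
  moreover have "f z * complex_of_real (h z)
      = (h 1 / 2 - \<i> * h \<i> / 2) * (f z * z) + (h 1 / 2 + \<i> * h \<i> / 2) * (f z * cnj z)" for z
    by (subst h[of z]) (simp only: distrib_left mult_ac)
  ultimately show ?case by (simp only:)
next
  case (const c)
  then show ?case using fourier_vanishes_cmult[of f "of_real c"] by (simp add: mult.commute)
next
  case (add p q)
  then show ?case using fourier_vanishes_add by (simp add: distrib_left)
next
  case (mult p q)
  then show ?case using mult.IH(2)[OF mult.IH(1)] by (simp add: mult.assoc)
qed

lemma fourier_vanishes_integral_continuous:
  assumes f: "fourier_vanishes f" and g: "continuous_on UNIV (g :: complex \<Rightarrow> real)"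
  shows "(\<integral>z. f z * complex_of_real (g z) \<partial>circle) = 0"
proof -
  have fi: "integrable circle f" using f by (simp add: fourier_vanishes_def)
  have small: "cmod (\<integral>z. f z * complex_of_real (g z) \<partial>circle) \<le> e * (\<integral>z. cmod (f z) \<partial>circle)"
    if "0 < e" for e
  proof -
    obtain p where p: "real_polynomial_function p" and close: "\<And>z. z \<in> sphere 0 1 \<Longrightarrow> \<bar>g z - p z\<bar> < e"
      using Stone_Weierstrass_real_polynomial_function
        [OF compact_sphere[of "0 :: complex" 1] continuous_on_subset[OF g subset_UNIV] \<open>0 < e\<close>] by blast
    have pv: "fourier_vanishes (\<lambda>z. f z * complex_of_real (p z))"
      using fourier_vanishes_mult_polynomial[OF p f] .
    have p0: "(\<integral>z. f z * complex_of_real (p z) \<partial>circle) = 0"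
      using pv unfolding fourier_vanishes_def by (metis (no_types, lifting) mult.right_neutral power_0 Lebesgue_cong)
    have [measurable]: "g \<in> borel_measurable borel"
      using g by (rule borel_measurable_continuous_onI)
    have [measurable]: "p \<in> borel_measurable borel"
      using p by (intro borel_measurable_continuous_onI continuous_on_polymonial_function)
        (simp flip: real_polynomial_function_eq)
    have di: "integrable circle (\<lambda>z. f z * complex_of_real (g z - p z))"
      by (rule integrable_bounded_mult[OF fi, where B = e])
        (use close in \<open>auto intro!: AE_I2 less_imp_le simp del: of_real_diff\<close>)
    have pi: "integrable circle (\<lambda>z. f z * complex_of_real (p z))"
      using pv by (simp add: fourier_vanishes_def)
    have "(\<integral>z. f z * complex_of_real (g z) \<partial>circle)
        = (\<integral>z. f z * complex_of_real (g z - p z) + f z * complex_of_real (p z) \<partial>circle)"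
      by (simp add: algebra_simps)
    also have "\<dots> = (\<integral>z. f z * complex_of_real (g z - p z) \<partial>circle)"
      using di pi p0 by (simp add: Bochner_Integration.integral_add)
    also have "cmod \<dots> \<le> (\<integral>z. cmod (f z * complex_of_real (g z - p z)) \<partial>circle)" by simp
    also have "\<dots> \<le> (\<integral>z. e * cmod (f z) \<partial>circle)"
    proof (rule integral_mono)
      fix z assume "z \<in> space circle"
      then show "cmod (f z * complex_of_real (g z - p z)) \<le> e * cmod (f z)"
        using close[of z] mult_right_mono[of "\<bar>g z - p z\<bar>" e "cmod (f z)"]
          by (simp add: norm_mult mult.commute del: of_real_diff)
    qed (use di fi in auto)
    finally show ?thesis by simp
  qed
  have "cmod (\<integral>z. f z * complex_of_real (g z) \<partial>circle) \<le> 0"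
  proof (rule tendsto_lowerbound[where F = "at_right 0"])
    show "((\<lambda>e. e * (\<integral>z. cmod (f z) \<partial>circle)) \<longlongrightarrow> 0) (at_right 0)"
      by (auto intro!: tendsto_eq_intros)
    show "\<forall>\<^sub>F e in at_right 0. cmod (\<integral>z. f z * complex_of_real (g z) \<partial>circle) \<le> e * (\<integral>z. cmod (f z) \<partial>circle)"
      using small by (auto simp: eventually_at_right_less eventually_at_filter)
  qed simp
  then show ?thesis by simp
qed

text \<open>Indicators of closed sets are decreasing limits of continuous functions, so the integral of
  the function over every closed set is zero; closed sets generate the Borel sets and are stable
  under intersection, so the integral over every Borel set is zero.\<close>

theorem fourier_vanishes_AE_zero:
  assumes "fourier_vanishes f"
  shows "AE z in circle. f z = 0"
proof -
  have fi [measurable]: "integrable circle f" using assms by (simp add: fourier_vanishes_def)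
  note fm = borel_measurable_integrable[OF fi, measurable]
  have total: "(\<integral>z. f z \<partial>circle) = 0"
    using fourier_vanishes_integral_continuous[OF assms, of "\<lambda>_. 1"] by simp
  have ident: "(\<lambda>z. z) \<in> circle \<rightarrow>\<^sub>M borel" by simp
  have meas [measurable]: "B \<in> sets borel \<Longrightarrow> (indicator B :: complex \<Rightarrow> real) \<in> borel_measurable circle" for B
    using measurable_compose[OF ident, of "indicator B"] by simp
  have main: "(\<integral>z. indicator B z *\<^sub>R f z \<partial>circle) = 0" if "B \<in> sets borel" for B
  proof -
    have "Int_stable (Collect closed)" "Collect closed \<subseteq> Pow (UNIV :: complex set)"
      and "B \<in> sigma_sets UNIV (Collect closed)"
      using that by (auto simp: Int_stable_def borel_eq_closed)
    then show ?thesis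
    proof (induction rule: sigma_sets_induct_disjoint)
      case (basic C)
      then have C: "closed C" by simp
      show ?case
      proof (cases "C = {}")
        case False
        define g where "g n z = max 0 (1 - real n * infdist z C)" for n z
        have gc: "continuous_on UNIV (g n)" for n
          unfolding g_def by (intro continuous_intros)
        have [measurable]: "g n \<in> borel_measurable borel" for n
          using gc by (rule borel_measurable_continuous_onI)
        have "(\<lambda>n. \<integral>z. f z * complex_of_real (g n z) \<partial>circle) \<longlonglongrightarrow> (\<integral>z. indicator C z *\<^sub>R f z \<partial>circle)"
        proof (rule integral_dominated_convergence[where w = "\<lambda>z. cmod (f z)"])
          show "AE z in circle. (\<lambda>n. f z * complex_of_real (g n z)) \<longlonglongrightarrow> indicator C z *\<^sub>R f z"
          proof (rule AE_I2)
            fix z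
            have "(\<lambda>n. g n z) \<longlonglongrightarrow> indicator C z"
            proof (cases "z \<in> C")
              case True
              then show ?thesis by (simp add: g_def)
            next
              case zC: False
              then have "0 < infdist z C" using C False in_closed_iff_infdist_zero infdist_nonneg
                by (metis less_eq_real_def)
              then obtain N where N: "1 < real N * infdist z C" using reals_Archimedean3 by blast
              have "g n z = 0" if "n \<ge> N" for n
              proof -
                have "real N * infdist z C \<le> real n * infdist z C"
                  using that by (intro mult_right_mono infdist_nonneg) simp
                with N show ?thesis by (simp add: g_def)
              qed
              then show ?thesis using zC
                by (intro tendsto_eventually) (auto simp: eventually_sequentially)
            qed
            then have "(\<lambda>n. f z * complex_of_real (g n z)) \<longlonglongrightarrow> f z * complex_of_real (indicator C z)"
              by (intro tendsto_intros)
            then show "(\<lambda>n. f z * complex_of_real (g n z)) \<longlonglongrightarrow> indicator C z *\<^sub>R f z"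
              by (simp add: scaleR_conv_of_real mult.commute)
          qed
          show "AE z in circle. norm (f z * complex_of_real (g n z)) \<le> cmod (f z)" for n
            by (intro AE_I2) (auto simp: norm_mult g_def infdist_nonneg intro!: mult_left_le)
        qed (use fi that C in \<open>auto simp: borel_closed intro!: borel_measurable_scaleR meas\<close>)
        then show ?thesis
          by (simp add: fourier_vanishes_integral_continuous[OF assms gc] LIMSEQ_const_iff)
      qed simp
    next
      case empty
      then show ?case by simp
    next
      case (compl A)
      then have "A \<in> sets borel" by (simp add: borel_eq_closed)
      then have "integrable circle (\<lambda>z. indicator A z *\<^sub>R f z)"
        using meas fi by (intro Bochner_Integration.integrable_bound[OF fi]) (auto split: split_indicator)
      then have "(\<integral>z. f z - indicator A z *\<^sub>R f z \<partial>circle) = 0"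
        using compl fi total by simp
      also have "(\<lambda>z. f z - indicator A z *\<^sub>R f z) = (\<lambda>z. indicator (UNIV - A) z *\<^sub>R f z)"
        by (auto split: split_indicator)
      finally show ?case .
    next
      case (union A)
      then have A: "A i \<in> sets borel" for i by (auto simp: borel_eq_closed)
      have ii: "integrable circle (\<lambda>z. indicator (A i) z *\<^sub>R f z)" for i
        using meas A fi by (intro Bochner_Integration.integrable_bound[OF fi]) (auto split: split_indicator)
      have "(\<lambda>n. \<integral>z. indicator (\<Union>i<n. A i) z *\<^sub>R f z \<partial>circle) \<longlonglongrightarrow> (\<integral>z. indicator (\<Union>i. A i) z *\<^sub>R f z \<partial>circle)"
      proof (rule integral_dominated_convergence[where w = "\<lambda>z. cmod (f z)"])
        show "AE z in circle. (\<lambda>n. indicator (\<Union>i<n. A i) z *\<^sub>R f z) \<longlonglongrightarrow> indicator (\<Union>i. A i) z *\<^sub>R f z"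
          by (intro AE_I2 tendsto_intros LIMSEQ_indicator_UN)
      qed (use fi A in \<open>auto intro!: borel_measurable_scaleR meas split: split_indicator\<close>)
      moreover have "(\<integral>z. indicator (\<Union>i<n. A i) z *\<^sub>R f z \<partial>circle) = 0" for n
      proof -
        have "indicator (\<Union>i<n. A i) z = (\<Sum>i<n. indicator (A i) z :: real)" for z
          by (rule indicator_UN_disjoint) (use union in \<open>auto intro: disjoint_family_on_mono\<close>)
        then have "(\<integral>z. indicator (\<Union>i<n. A i) z *\<^sub>R f z \<partial>circle)
            = (\<integral>z. (\<Sum>i<n. indicator (A i) z *\<^sub>R f z) \<partial>circle)"
          by (simp only: scaleR_sum_left)
        also have "\<dots> = 0" using union ii by (subst Bochner_Integration.integral_sum) auto
        finally show ?thesis .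
      qed
      ultimately show ?case by (simp add: LIMSEQ_const_iff)
    qed
  qed
  show ?thesis
  proof (rule circle.density_zero[OF fi])
    fix A assume "A \<in> sets circle"
    then obtain B where B: "B \<in> sets borel" "A = sphere 0 1 \<inter> B"
      by (auto simp: sets_circle sets_restrict_space)
    have "set_lebesgue_integral circle A f = (\<integral>z. indicator B z *\<^sub>R f z \<partial>circle)"
      unfolding set_lebesgue_integral_def using B
      by (intro Lebesgue_cong) (auto split: split_indicator)
    with main B show "set_lebesgue_integral circle A f = 0" by simp
  qed
qed

section \<open>One-sided Fourier series\<close>

lemma square_integrable_trig [intro]:
  "square_integrable circle (\<lambda>z. \<Sum>j\<in>F. c j * z ^ j)"
  by (intro square_integrable_sum square_integrable_cmult circle_square_integrable_power)

lemma integral_trig_norm: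
  assumes "finite F"
  shows "L2sq circle (\<lambda>z. \<Sum>j\<in>F. c j * z ^ j) = (\<Sum>j\<in>F. (cmod (c j))\<^sup>2)"
proof -
  have "complex_of_real (L2sq circle (\<lambda>z. \<Sum>j\<in>F. c j * z ^ j))
      = (\<integral>z. (\<Sum>i\<in>F. c i * z ^ i) * cnj (\<Sum>j\<in>F. c j * z ^ j) \<partial>circle)"
    by (simp only: complex_norm_square flip: integral_complex_of_real)
  also have "\<dots> = (\<integral>z. (\<Sum>i\<in>F. \<Sum>j\<in>F. (c i * cnj (c j)) * (z ^ i * cnj z ^ j)) \<partial>circle)"
    by (simp add: sum_product algebra_simps)
  also have "\<dots> = (\<Sum>i\<in>F. \<Sum>j\<in>F. (c i * cnj (c j)) * (if i = j then 1 else 0))"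
    using integrable_mult_square_integrable[OF circle_square_integrable_power square_integrable_cnj[OF circle_square_integrable_power]]
    by (simp add: Bochner_Integration.integral_sum Bochner_Integration.integrable_sum integral_power_cnj_power)
  also have "\<dots> = (\<Sum>i\<in>F. c i * cnj (c i))"
    by (rule sum.cong) (simp_all add: assms sum.delta if_distrib[of "\<lambda>x. _ * x"] cong: if_cong)
  also have "\<dots> = complex_of_real (\<Sum>j\<in>F. (cmod (c j))\<^sup>2)"
    by (simp only: complex_norm_square of_real_sum)
  finally show ?thesis by (simp only: of_real_eq_iff)
qed

text \<open>The Cauchy--Schwarz inequality for \<open>q\<close> and its own partial sum \<open>p\<close>: the inner product of the
  two is the squared norm of \<open>p\<close>.\<close>

lemma Bessel_inequality:
  assumes q: "square_integrable circle q" and F: "finite F"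
  shows "(\<Sum>j\<in>F. (cmod (\<integral>z. q z * cnj z ^ j \<partial>circle))\<^sup>2) \<le> L2sq circle q"
proof -
  define c where "c j = (\<integral>z. q z * cnj z ^ j \<partial>circle)" for j
  define p where "p z = (\<Sum>j\<in>F. c j * z ^ j)" for z
  define S where "S = (\<Sum>j\<in>F. (cmod (c j))\<^sup>2)"
  have p: "square_integrable circle p" unfolding p_def by (rule square_integrable_trig)
  have S0: "0 \<le> S" by (simp add: S_def sum_nonneg)
  have qi: "integrable circle (\<lambda>z. q z * cnj z ^ j)" for j
    by (rule circle_integrable_mult(2)[OF circle.integrable_of_square_integrable[OF q]])
  have "(\<integral>z. q z * cnj (p z) \<partial>circle) = (\<integral>z. (\<Sum>j\<in>F. cnj (c j) * (q z * cnj z ^ j)) \<partial>circle)"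
    by (simp add: p_def sum_distrib_left mult_ac)
  also have "\<dots> = (\<Sum>j\<in>F. c j * cnj (c j))"
    using qi by (subst Bochner_Integration.integral_sum) (auto simp: c_def mult.commute)
  also have "\<dots> = complex_of_real S"
    by (simp only: S_def complex_norm_square of_real_sum)
  finally have "S\<^sup>2 \<le> L2sq circle q * L2sq circle p"
    using Cauchy_Schwarz_norm_integral[OF q square_integrable_cnj[OF p]] by simp
  also have "L2sq circle p = S"
    unfolding p_def S_def using F by (rule integral_trig_norm)
  finally have "S * S \<le> L2sq circle q * S"
    by (simp add: power2_eq_square)
  then have "S \<le> L2sq circle q"
    using S0 by (cases "S = 0") auto
  then show ?thesis by (simp add: S_def c_def)
qed

lemma Bessel_inequality_negative:
  assumes q: "square_integrable circle q" and F: "finite F"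
  shows "(\<Sum>j\<in>F. (cmod (\<integral>z. q z * z ^ j \<partial>circle))\<^sup>2) \<le> L2sq circle q"
proof -
  have "cmod (\<integral>z. cnj (q z) * cnj z ^ j \<partial>circle) = cmod (\<integral>z. q z * z ^ j \<partial>circle)" for j
    using Bochner_Integration.integral_cnj[of circle "\<lambda>z. q z * z ^ j"]
    by (metis (no_types, lifting) Lebesgue_cong complex_cnj_mult complex_cnj_power complex_mod_cnj)
  then show ?thesis
    using Bessel_inequality[OF square_integrable_cnj[OF q] F] by simp
qed

text \<open>If the Fourier series of \<open>q\<close> has no negative frequencies, its partial sums form a Cauchy
  sequence by Bessel's inequality.  Their limit has the same Fourier coefficients as \<open>q\<close>, and the
  uniqueness theorem identifies it with \<open>q\<close>.  Every statement below about products of analytic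
  functions is an instance of the resulting expansion.\<close>

theorem analytic_Parseval:
  assumes q: "square_integrable circle q"
    and an: "\<And>k. 0 < k \<Longrightarrow> (\<integral>z. q z * z ^ k \<partial>circle) = 0"
    and f: "square_integrable circle f"
  shows "(\<lambda>j. (\<integral>z. q z * cnj z ^ j \<partial>circle) * (\<integral>z. f z * z ^ j \<partial>circle)) sums (\<integral>z. f z * q z \<partial>circle)"
proof -
  define c where "c j = (\<integral>z. q z * cnj z ^ j \<partial>circle)" for j
  define s where "s n z = (\<Sum>j<n. c j * z ^ j)" for n z
  have s: "square_integrable circle (s n)" for n
    unfolding s_def by (rule square_integrable_trig)
  have "summable (\<lambda>j. (cmod (c j))\<^sup>2)"
    by (rule summableI_nonneg_bounded[where x = "L2sq circle q"])
      (auto simp: c_def intro: Bessel_inequality[OF q])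
  then have cau: "\<exists>N. \<forall>m\<ge>N. \<forall>n. norm (sum (\<lambda>j. (cmod (c j))\<^sup>2) {m..<n}) < e" if "0 < e" for e
    using that by (auto simp: summable_Cauchy)
  have dist: "L2sq circle (\<lambda>z. s i z - s j z) = sum (\<lambda>j. (cmod (c j))\<^sup>2) {min i j..<max i j}" for i j
  proof -
    have "s j z - s i z = (\<Sum>k\<in>{i..<j}. c k * z ^ k)" if "i \<le> j" for i j z
      using that sum_diff_nat_ivl[of 0 i j "\<lambda>k. c k * z ^ k"] by (simp add: s_def lessThan_atLeast0)
    then have "L2sq circle (\<lambda>z. s j z - s i z) = sum (\<lambda>j. (cmod (c j))\<^sup>2) {i..<j}" if "i \<le> j" for i j
      using that by (simp add: integral_trig_norm)
    from this[of i j] this[of j i] show ?thesis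
      by (cases "i \<le> j") (auto simp: norm_minus_commute)
  qed
  have "\<exists>N. \<forall>i\<ge>N. \<forall>j\<ge>N. L2sq circle (\<lambda>z. s i z - s j z) < e" if "0 < e" for e
  proof -
    obtain N where N: "\<forall>m\<ge>N. \<forall>n. norm (sum (\<lambda>j. (cmod (c j))\<^sup>2) {m..<n}) < e"
      using cau[OF \<open>0 < e\<close>] by blast
    show ?thesis
    proof (intro exI allI impI)
      fix i j assume "N \<le> i" "N \<le> j"
      then have "N \<le> min i j" by simp
      with N have "norm (sum (\<lambda>j. (cmod (c j))\<^sup>2) {min i j..<max i j}) < e" by blast
      then show "L2sq circle (\<lambda>z. s i z - s j z) < e" by (simp add: dist)
    qed
  qed
  then obtain g where g: "square_integrable circle g"
    and lim: "(\<lambda>n. L2sq circle (\<lambda>z. s n z - g z)) \<longlonglongrightarrow> 0"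
    by (rule circle.L2_complete[of s, OF s]) blast
  note inner = L2_tendsto_inner[OF s g _ lim]
  have s_int: "(\<integral>z. f z * s n z \<partial>circle) = (\<Sum>j<n. c j * (\<integral>z. f z * z ^ j \<partial>circle))"
    if "square_integrable circle f" for f n
  proof -
    have "(\<integral>z. f z * s n z \<partial>circle) = (\<integral>z. (\<Sum>j<n. c j * (f z * z ^ j)) \<partial>circle)"
      by (simp add: s_def sum_distrib_left mult_ac)
    also have "\<dots> = (\<Sum>j<n. c j * (\<integral>z. f z * z ^ j \<partial>circle))"
      using circle_integrable_mult(1)[OF circle.integrable_of_square_integrable[OF that]]
      by (subst Bochner_Integration.integral_sum) auto
    finally show ?thesis .
  qed
  have "AE z in circle. q z - g z = 0"
  proof (rule fourier_vanishes_AE_zero)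
    have qg: "integrable circle q" "integrable circle g"
      using q g by (auto intro: circle.integrable_of_square_integrable)
    have pos: "(\<integral>z. g z * z ^ k \<partial>circle) = (if k = 0 then c 0 else 0)" for k
    proof (rule LIMSEQ_unique)
      show "(\<lambda>n. \<integral>z. z ^ k * s n z \<partial>circle) \<longlonglongrightarrow> (\<integral>z. g z * z ^ k \<partial>circle)"
        using inner[of "\<lambda>z. z ^ k"] by (simp add: mult.commute)
      have "(\<integral>z. z ^ k * s n z \<partial>circle) = (if k = 0 then c 0 else 0)" if "0 < n" for n
      proof -
        have "(\<integral>z. z ^ k * s n z \<partial>circle) = (\<Sum>j<n. c j * (if k = 0 \<and> j = 0 then 1 else 0))"
          using integral_circle_power[of "k + _"]
          by (subst s_int) (auto intro!: sum.cong simp flip: power_add)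
        also have "\<dots> = (if k = 0 then c 0 else 0)"
          using that by (auto simp: sum.delta if_distrib[of "\<lambda>x. _ * x"] cong: if_cong)
        finally show ?thesis .
      qed
      then show "(\<lambda>n. \<integral>z. z ^ k * s n z \<partial>circle) \<longlonglongrightarrow> (if k = 0 then c 0 else 0)"
        by (intro tendsto_eventually) (auto simp: eventually_sequentially intro!: exI[of _ 1])
    qed
    have neg: "(\<integral>z. g z * cnj z ^ k \<partial>circle) = c k" for k
    proof (rule LIMSEQ_unique)
      have sk: "square_integrable circle (\<lambda>z. cnj z ^ k)"
        using square_integrable_cnj[OF circle_square_integrable_power, of k] by simp
      show "(\<lambda>n. \<integral>z. cnj z ^ k * s n z \<partial>circle) \<longlonglongrightarrow> (\<integral>z. g z * cnj z ^ k \<partial>circle)"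
        using inner[OF sk] by (simp add: mult.commute)
      have "(\<integral>z. cnj z ^ k * s n z \<partial>circle) = c k" if "k < n" for n
      proof -
        have "(\<integral>z. cnj z ^ k * s n z \<partial>circle) = (\<Sum>j<n. c j * (if j = k then 1 else 0))"
          unfolding s_int[OF sk] by (subst mult.commute[of "cnj _ ^ _"]) (simp only: integral_power_cnj_power)
        also have "\<dots> = c k"
          using that by (simp add: sum.delta if_distrib[of "\<lambda>x. _ * x"] cong: if_cong)
        finally show ?thesis .
      qed
      then show "(\<lambda>n. \<integral>z. cnj z ^ k * s n z \<partial>circle) \<longlonglongrightarrow> c k"
        by (intro tendsto_eventually) (auto simp: eventually_sequentially intro!: exI[of _ "Suc k"])
    qed
    have "(\<integral>z. (q z - g z) * z ^ n \<partial>circle) = 0" for n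
      using qg an[of n] pos[of n]
      by (cases "n = 0") (auto simp: left_diff_distrib circle_integrable_mult c_def)
    moreover have "(\<integral>z. (q z - g z) * cnj z ^ n \<partial>circle) = 0" for n
      using qg neg[of n] by (simp add: left_diff_distrib circle_integrable_mult c_def)
    ultimately show "fourier_vanishes (\<lambda>z. q z - g z)"
      using qg by (simp add: fourier_vanishes_def)
  qed
  then have "(\<integral>z. f z * g z \<partial>circle) = (\<integral>z. f z * q z \<partial>circle)"
    using f q g by (intro integral_cong_AE) (auto intro!: borel_measurable_times square_integrable_measurable elim!: eventually_mono)
  with inner[OF f] s_int[OF f] show ?thesis
    by (simp add: sums_def c_def)
qed

text \<open>The product of two functions without negative frequencies has none either: in the expansion
  of \<open>q\<close> every term is multiplied by a vanishing coefficient of \<open>p\<close>.\<close>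

lemma analytic_product_vanishes:
  assumes p: "square_integrable circle p" and q: "square_integrable circle q"
    and pan: "\<And>k. 0 < k \<Longrightarrow> (\<integral>z. p z * z ^ k \<partial>circle) = 0"
    and qan: "\<And>k. 0 < k \<Longrightarrow> (\<integral>z. q z * z ^ k \<partial>circle) = 0"
    and k: "0 < k"
  shows "(\<integral>z. p z * q z * z ^ k \<partial>circle) = 0"
proof -
  have pk: "square_integrable circle (\<lambda>z. z ^ k * p z)"
    by (rule square_integrable_bounded_mult[OF p, where B = 1])
      (use AE_circle_norm in \<open>auto simp: norm_power elim!: eventually_mono\<close>)
  have "(\<lambda>j. (\<integral>z. q z * cnj z ^ j \<partial>circle) * (\<integral>z. z ^ k * p z * z ^ j \<partial>circle))
      sums (\<integral>z. z ^ k * p z * q z \<partial>circle)"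
    by (rule analytic_Parseval[OF q qan pk])
  moreover have "(\<integral>z. z ^ k * p z * z ^ j \<partial>circle) = 0" for j
    using pan[of "k + j"] k by (simp add: power_add mult_ac)
  ultimately have "(\<integral>z. z ^ k * p z * q z \<partial>circle) = 0"
    by (simp add: sums_iff)
  then show ?thesis by (simp add: mult_ac)
qed

section \<open>Hankel matrices with bounded scalar symbols\<close>

text \<open>The rows of the Hankel matrix of \<open>\<psi>\<close> applied to a finite vector \<open>h\<close> are the Fourier coefficients
  of negative index of \<open>\<psi> p\<close>, where \<open>p\<close> is the polynomial with coefficients \<open>h\<close>.  Bessel's inequality
  bounds their sum of squares by the squared norm of \<open>\<psi> p\<close>.\<close>

lemma hankel_scalar_finite:
  assumes \<psi>: "\<psi> \<in> borel_measurable circle" "AE z in circle. cmod (\<psi> z) \<le> B"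
    and I: "finite I" and F: "finite F"
  shows "(\<Sum>i\<in>I. (cmod (\<Sum>j\<in>F. (\<integral>z. \<psi> z * z ^ (i + j + 1) \<partial>circle) * h j))\<^sup>2)
          \<le> B\<^sup>2 * (\<Sum>j\<in>F. (cmod (h j))\<^sup>2)"
proof -
  define p where "p z = (\<Sum>j\<in>F. h j * z ^ j)" for z
  have p: "square_integrable circle p" unfolding p_def by (rule square_integrable_trig)
  have [measurable]: "p \<in> borel_measurable circle" using p by (rule square_integrable_measurable)
  have \<psi>b: "AE z in circle. cmod (\<psi> z * z) \<le> B"
    using \<psi>(2) AE_circle_norm by eventually_elim (simp add: norm_mult)
  have \<psi>p: "square_integrable circle (\<lambda>z. \<psi> z * z * p z)"
    by (rule square_integrable_bounded_mult[OF p _ \<psi>b]) (use \<psi> in simp)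
  have "(\<Sum>j\<in>F. (\<integral>z. \<psi> z * z ^ (i + j + 1) \<partial>circle) * h j) = (\<integral>z. \<psi> z * z * p z * z ^ i \<partial>circle)" for i
  proof -
    have \<psi>i: "integrable circle \<psi>"
      by (intro circle.integrable_of_square_integrable circle.square_integrable_bounded[OF \<psi>])
    have "(\<integral>z. \<psi> z * z * p z * z ^ i \<partial>circle) = (\<integral>z. (\<Sum>j\<in>F. (\<psi> z * z ^ (i + j + 1)) * h j) \<partial>circle)"
      by (simp add: p_def sum_distrib_left sum_distrib_right power_add mult_ac)
    also have "\<dots> = (\<Sum>j\<in>F. (\<integral>z. \<psi> z * z ^ (i + j + 1) \<partial>circle) * h j)"
      using circle_integrable_mult(1)[OF \<psi>i, of "_ + _ + 1"]
      by (subst Bochner_Integration.integral_sum) auto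
    finally show ?thesis by simp
  qed
  then have "(\<Sum>i\<in>I. (cmod (\<Sum>j\<in>F. (\<integral>z. \<psi> z * z ^ (i + j + 1) \<partial>circle) * h j))\<^sup>2)
      \<le> L2sq circle (\<lambda>z. \<psi> z * z * p z)"
    using Bessel_inequality_negative[OF \<psi>p I] by simp
  also have "\<dots> \<le> (\<integral>z. B\<^sup>2 * (cmod (p z))\<^sup>2 \<partial>circle)"
  proof (rule integral_mono_AE)
    show "AE z in circle. (cmod (\<psi> z * z * p z))\<^sup>2 \<le> B\<^sup>2 * (cmod (p z))\<^sup>2"
      using \<psi>b by eventually_elim
        (subst norm_mult, subst power_mult_distrib, intro mult_right_mono power_mono, auto)
  qed (use \<psi>p p in \<open>auto intro!: square_integrable_integrable integrable_mult_right\<close>)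
  also have "\<dots> = B\<^sup>2 * (\<Sum>j\<in>F. (cmod (h j))\<^sup>2)"
    by (simp add: p_def integral_trig_norm F)
  finally show ?thesis .
qed

text \<open>The passage to square summable vectors.  The estimate for the tail is what later gives the
  convergence of the rows of the operator in the norm of \<open>L\<^sup>2\<close>.\<close>

lemma hankel_scalar:
  assumes \<psi>: "\<psi> \<in> borel_measurable circle" "AE z in circle. cmod (\<psi> z) \<le> B"
    and h: "summable (\<lambda>j. (cmod (h j))\<^sup>2)"
  defines "a \<equiv> \<lambda>i j. (\<integral>z. \<psi> z * z ^ (i + j + 1) \<partial>circle) * h j"
  shows hankel_scalar_summable: "summable (a i)"
    and hankel_scalar_tail: "(cmod (suminf (a i) - (\<Sum>j<N. a i j)))\<^sup>2 \<le> B\<^sup>2 * (\<Sum>j. (cmod (h (j + N)))\<^sup>2)"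
    and hankel_scalar_bound: "(\<Sum>i<n. (cmod (suminf (a i)))\<^sup>2) \<le> B\<^sup>2 * (\<Sum>j. (cmod (h j))\<^sup>2)"
proof -
  have single: "(cmod (\<Sum>j\<in>F. a i j))\<^sup>2 \<le> B\<^sup>2 * (\<Sum>j\<in>F. (cmod (h j))\<^sup>2)" if "finite F" for i F
    using hankel_scalar_finite[OF \<psi>, of "{i}" F] that unfolding a_def by simp
  show sm: "summable (a i)" for i
    unfolding summable_Cauchy
  proof (intro allI impI)
    fix e :: real assume e: "0 < e"
    then have "0 < e\<^sup>2 / (B\<^sup>2 + 1)" by (simp add: add_nonneg_pos)
    with h obtain N where N: "\<forall>m\<ge>N. \<forall>n. norm (sum (\<lambda>j. (cmod (h j))\<^sup>2) {m..<n}) < e\<^sup>2 / (B\<^sup>2 + 1)"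
      unfolding summable_Cauchy by blast
    show "\<exists>N. \<forall>m\<ge>N. \<forall>n. norm (sum (a i) {m..<n}) < e"
    proof (intro exI allI impI)
      fix m n assume "N \<le> m"
      with N have *: "sum (\<lambda>j. (cmod (h j))\<^sup>2) {m..<n} < e\<^sup>2 / (B\<^sup>2 + 1)" by (simp add: sum_nonneg)
      have "(norm (sum (a i) {m..<n}))\<^sup>2 \<le> B\<^sup>2 * sum (\<lambda>j. (cmod (h j))\<^sup>2) {m..<n}" by (rule single) simp
      also have "\<dots> \<le> (B\<^sup>2 + 1) * sum (\<lambda>j. (cmod (h j))\<^sup>2) {m..<n}"
        by (intro mult_right_mono sum_nonneg) auto
      also have "\<dots> < e\<^sup>2"
        using * by (simp add: pos_less_divide_eq add_nonneg_pos mult.commute)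
      finally show "norm (sum (a i) {m..<n}) < e" using e by (simp add: power_less_imp_less_base)
    qed
  qed
  have "(\<lambda>M. (cmod (\<Sum>j<M. a i (j + N)))\<^sup>2) \<longlonglongrightarrow> (cmod (\<Sum>j. a i (j + N)))\<^sup>2"
    using summable_LIMSEQ[OF summable_ignore_initial_segment[OF sm]] by (intro tendsto_intros)
  moreover have "(cmod (\<Sum>j<M. a i (j + N)))\<^sup>2 \<le> B\<^sup>2 * (\<Sum>j. (cmod (h (j + N)))\<^sup>2)" for M
  proof -
    have "(cmod (\<Sum>j<M. a i (j + N)))\<^sup>2 = (cmod (\<Sum>j\<in>(\<lambda>j. j + N) ` {..<M}. a i j))\<^sup>2"
      by (subst sum.reindex) (auto simp: inj_on_def)
    also have "\<dots> \<le> B\<^sup>2 * (\<Sum>j\<in>(\<lambda>j. j + N) ` {..<M}. (cmod (h j))\<^sup>2)"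
      by (rule single) simp
    also have "\<dots> = B\<^sup>2 * (\<Sum>j<M. (cmod (h (j + N)))\<^sup>2)"
      by (subst sum.reindex) (auto simp: inj_on_def)
    also have "\<dots> \<le> B\<^sup>2 * (\<Sum>j. (cmod (h (j + N)))\<^sup>2)"
      by (intro mult_left_mono sum_le_suminf summable_ignore_initial_segment h) auto
    finally show ?thesis .
  qed
  ultimately have "(cmod (\<Sum>j. a i (j + N)))\<^sup>2 \<le> B\<^sup>2 * (\<Sum>j. (cmod (h (j + N)))\<^sup>2)"
    by (intro LIMSEQ_le_const2) auto
  then show "(cmod (suminf (a i) - (\<Sum>j<N. a i j)))\<^sup>2 \<le> B\<^sup>2 * (\<Sum>j. (cmod (h (j + N)))\<^sup>2)"
    using suminf_minus_initial_segment[OF sm] by simp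
  have "(\<lambda>M. \<Sum>i<n. (cmod (\<Sum>j<M. a i j))\<^sup>2) \<longlonglongrightarrow> (\<Sum>i<n. (cmod (suminf (a i)))\<^sup>2)"
    using summable_LIMSEQ[OF sm] by (intro tendsto_intros)
  moreover have "(\<Sum>i<n. (cmod (\<Sum>j<M. a i j))\<^sup>2) \<le> B\<^sup>2 * (\<Sum>j. (cmod (h j))\<^sup>2)" for M
  proof -
    have "(\<Sum>i<n. (cmod (\<Sum>j<M. a i j))\<^sup>2) \<le> B\<^sup>2 * (\<Sum>j<M. (cmod (h j))\<^sup>2)"
      unfolding a_def by (rule hankel_scalar_finite[OF \<psi>]) auto
    also have "\<dots> \<le> B\<^sup>2 * (\<Sum>j. (cmod (h j))\<^sup>2)"
      by (intro mult_left_mono sum_le_suminf h) auto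
    finally show ?thesis .
  qed
  ultimately show "(\<Sum>i<n. (cmod (suminf (a i)))\<^sup>2) \<le> B\<^sup>2 * (\<Sum>j. (cmod (h j))\<^sup>2)"
    by (intro LIMSEQ_le_const2) auto
qed

section \<open>A variational principle\<close>

text \<open>Fermat's rule for a function that is not known to be differentiable but lies below a quadratic
  polynomial with linear term \<open>- 2 * t * X\<close>.\<close>

lemma linear_term_zero:
  fixes X Y :: real
  assumes "\<And>t. \<bar>t\<bar> \<le> 1 \<Longrightarrow> 0 \<le> - 2 * t * X + t\<^sup>2 * Y"
  shows "X = 0"
proof (rule ccontr)
  assume X: "X \<noteq> 0"
  define D where "D = \<bar>X\<bar> + \<bar>Y\<bar> + 1"
  have D: "D > 0" "\<bar>X\<bar> \<le> D" "Y \<le> D" by (auto simp: D_def)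
  have "\<bar>X / D\<bar> \<le> 1" using D by simp
  from assms[OF this] have "0 \<le> - 2 * (X / D) * X + (X / D)\<^sup>2 * Y" .
  also have "\<dots> \<le> - 2 * (X / D) * X + (X / D)\<^sup>2 * D"
    using D by (intro add_left_mono mult_left_mono) auto
  also have "\<dots> = - X\<^sup>2 / D" using D by (simp add: power2_eq_square field_simps)
  also have "\<dots> < 0" using D X by simp
  finally show False by simp
qed

text \<open>A convex increasing function of \<open>\<bar>z\<bar>\<^sup>2\<close> is convex in \<open>z\<close>.  Convexity and monotonicity are expressed
  through the nonnegative subgradient \<open>\<theta>'\<close>.\<close>

lemma subgradient_midpoint:
  fixes \<theta> \<theta>' :: "real \<Rightarrow> real"
  assumes lower: "\<And>s t. 0 \<le> s \<Longrightarrow> 0 \<le> t \<Longrightarrow> \<theta> s + \<theta>' s * (t - s) \<le> \<theta> t"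
    and nonneg: "\<And>s. 0 \<le> s \<Longrightarrow> 0 \<le> \<theta>' s"
  shows "\<theta> ((cmod ((u + v) / 2))\<^sup>2) \<le> (\<theta> ((cmod u)\<^sup>2) + \<theta> ((cmod v)\<^sup>2)) / 2"
proof -
  define m where "m = (cmod ((u + v) / 2))\<^sup>2"
  define q where "q = ((cmod u)\<^sup>2 + (cmod v)\<^sup>2) / 2"
  have "m \<le> q"
    using cmod_add_power2_le[of u v] by (simp add: m_def q_def norm_divide power_divide)
  then have "0 \<le> \<theta>' m * (q - m)" by (intro mult_nonneg_nonneg nonneg) (simp_all add: m_def)
  then have "\<theta> m \<le> \<theta> q" using lower[of m q] by (simp add: m_def q_def)
  moreover have "\<theta> q + \<theta>' q * ((cmod u)\<^sup>2 - q) \<le> \<theta> ((cmod u)\<^sup>2)"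
    "\<theta> q + \<theta>' q * ((cmod v)\<^sup>2 - q) \<le> \<theta> ((cmod v)\<^sup>2)"
    by (intro lower; simp add: q_def)+
  moreover have "\<theta>' q * ((cmod u)\<^sup>2 - q) + \<theta>' q * ((cmod v)\<^sup>2 - q) = 0"
    by (simp add: q_def field_simps)
  moreover have "x \<le> k \<Longrightarrow> k + y \<le> y' \<Longrightarrow> k + z \<le> z' \<Longrightarrow> y + z = 0 \<Longrightarrow> x \<le> (y' + z') / 2"
    for x k y y' z z' :: real by simp
  ultimately show ?thesis unfolding m_def by blast
qed

text \<open>The functional that maps \<open>g\<close> to the integral of \<open>\<theta> x (\<bar>\<Phi> - g\<bar>\<^sup>2)\<close> is minimized over a closed subspace.  It
  is convex and comparable to the squared distance, so its sublevel sets satisfy the hypotheses of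
  \<open>nested_convex_limit\<close>, and Fatou's lemma shows that the limit is a minimizer.  The first variation
  at the minimizer \<open>g\<close> says that \<open>g\<close> is also the best approximation of \<open>\<Phi>\<close> in the weighted space
  with weight \<open>\<theta>' x (\<bar>\<Phi> - g\<bar>\<^sup>2)\<close>, a weight that depends on \<open>g\<close> itself.  Directions are restricted to
  bounded functions because the second order term then is integrable.

  The lemma serves twice: with a linear \<open>\<theta>\<close> for a fixed weight, and with a nonlinear \<open>\<theta>\<close> that
  penalizes errors above a threshold.\<close>

lemma (in prob_space) variational_principle:
  fixes K :: "('a \<Rightarrow> complex) set" and \<theta> \<theta>' :: "'a \<Rightarrow> real \<Rightarrow> real"
  assumes \<Phi>: "square_integrable M \<Phi>"
    and K: "\<And>f. f \<in> K \<Longrightarrow> square_integrable M f"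
    and K_0: "(\<lambda>_. 0) \<in> K"
    and K_add: "\<And>f g. f \<in> K \<Longrightarrow> g \<in> K \<Longrightarrow> (\<lambda>x. f x + g x) \<in> K"
    and K_cmult: "\<And>f c. f \<in> K \<Longrightarrow> (\<lambda>x. c * f x) \<in> K"
    and K_closed: "\<And>s g. (\<And>n. s n \<in> K) \<Longrightarrow> square_integrable M g \<Longrightarrow>
          (\<lambda>n. L2sq M (\<lambda>x. s n x - g x)) \<longlonglongrightarrow> 0 \<Longrightarrow> g \<in> K"
    and \<theta>_meas: "\<And>s. s \<in> borel_measurable M \<Longrightarrow> (\<lambda>x. \<theta> x (s x)) \<in> borel_measurable M"
    and \<theta>'_meas: "\<And>s. s \<in> borel_measurable M \<Longrightarrow> (\<lambda>x. \<theta>' x (s x)) \<in> borel_measurable M"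
    and \<theta>_0: "\<And>x. \<theta> x 0 = 0"
    and lower: "\<And>x s t. 0 \<le> s \<Longrightarrow> 0 \<le> t \<Longrightarrow> \<theta> x s + \<theta>' x s * (t - s) \<le> \<theta> x t"
    and upper: "\<And>x s t. 0 \<le> s \<Longrightarrow> 0 \<le> t \<Longrightarrow> \<theta> x t \<le> \<theta> x s + \<theta>' x s * (t - s) + (t - s)\<^sup>2"
    and c: "0 < c" and \<theta>'_bounds: "\<And>x s. 0 \<le> s \<Longrightarrow> c \<le> \<theta>' x s \<and> \<theta>' x s \<le> b"
  obtains g where "g \<in> K"
    "\<And>f B. f \<in> K \<Longrightarrow> AE x in M. cmod (f x) \<le> B \<Longrightarrow>
       (\<integral>x. of_real (\<theta>' x ((cmod (\<Phi> x - g x))\<^sup>2)) * cnj (\<Phi> x - g x) * f x \<partial>M) = 0"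
proof -
  have b: "0 < b" using c \<theta>'_bounds[of 0] by fastforce
  have \<theta>_lb: "c * s \<le> \<theta> x s" if "0 \<le> s" for x s
    using lower[of 0 s x] \<theta>'_bounds[of 0 x] that \<theta>_0[of x] mult_right_mono[of c "\<theta>' x 0" s] by auto
  have \<theta>_nonneg: "0 \<le> \<theta> x s" if "0 \<le> s" for x s
    using \<theta>_lb[OF that, of x] c that by (meson mult_nonneg_nonneg less_imp_le order_trans)
  have \<theta>_ub: "\<theta> x s \<le> b * s" if "0 \<le> s" for x s
    using lower[of s 0 x] \<theta>'_bounds[of s x] that \<theta>_0[of x] mult_right_mono[of "\<theta>' x s" b s] by auto
  have \<theta>_mid: "\<theta> x ((cmod ((u + v) / 2))\<^sup>2) \<le> (\<theta> x ((cmod u)\<^sup>2) + \<theta> x ((cmod v)\<^sup>2)) / 2" for x u v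
    by (rule subgradient_midpoint[where \<theta>' = "\<theta>' x"])
      (use lower \<theta>'_bounds c in \<open>auto intro: order_trans[OF less_imp_le[OF c]]\<close>)
  have \<theta>_lim: "(\<lambda>n. \<theta> x (s n)) \<longlonglongrightarrow> \<theta> x t" if "s \<longlonglongrightarrow> t" "\<And>n. 0 \<le> s n" for x s t
  proof -
    have t: "0 \<le> t" using that by (intro LIMSEQ_le_const) auto
    have d: "(\<lambda>n. s n - t) \<longlonglongrightarrow> 0" using that(1) by (simp add: LIM_zero)
    have "(\<lambda>n. \<theta> x t + \<theta>' x t * (s n - t)) \<longlonglongrightarrow> \<theta> x t + \<theta>' x t * 0"
      "(\<lambda>n. \<theta> x t + \<theta>' x t * (s n - t) + (s n - t)\<^sup>2) \<longlonglongrightarrow> \<theta> x t + \<theta>' x t * 0 + 0\<^sup>2"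
      by (intro tendsto_intros d)+
    then have lims: "(\<lambda>n. \<theta> x t + \<theta>' x t * (s n - t)) \<longlonglongrightarrow> \<theta> x t"
      "(\<lambda>n. \<theta> x t + \<theta>' x t * (s n - t) + (s n - t)\<^sup>2) \<longlonglongrightarrow> \<theta> x t"
      by simp_all
    show ?thesis
    proof (rule tendsto_sandwich[OF _ _ lims])
      show "\<forall>\<^sub>F n in sequentially. \<theta> x t + \<theta>' x t * (s n - t) \<le> \<theta> x (s n)"
        using lower t that by auto
      show "\<forall>\<^sub>F n in sequentially. \<theta> x (s n) \<le> \<theta> x t + \<theta>' x t * (s n - t) + (s n - t)\<^sup>2"
        using upper t that by auto
    qed
  qed
  define J where "J g = (\<integral>x. \<theta> x ((cmod (\<Phi> x - g x))\<^sup>2) \<partial>M)" for g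
  have J_int: "integrable M (\<lambda>x. \<theta> x ((cmod (\<Phi> x - g x))\<^sup>2))" if "square_integrable M g" for g
  proof (rule Bochner_Integration.integrable_bound)
    show "integrable M (\<lambda>x. b * (cmod (\<Phi> x - g x))\<^sup>2)"
      using \<Phi> that by (intro integrable_mult_right square_integrable_integrable square_integrable_diff)
    show "(\<lambda>x. \<theta> x ((cmod (\<Phi> x - g x))\<^sup>2)) \<in> borel_measurable M"
      using \<Phi> that by (intro \<theta>_meas) (auto intro!: borel_measurable_power borel_measurable_norm
          borel_measurable_diff square_integrable_measurable)
    show "AE x in M. norm (\<theta> x ((cmod (\<Phi> x - g x))\<^sup>2)) \<le> norm (b * (cmod (\<Phi> x - g x))\<^sup>2)"
      using \<theta>_ub \<theta>_nonneg b by (intro always_eventually allI) simp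
  qed
  have J_nonneg: "0 \<le> J g" for g unfolding J_def by (simp add: \<theta>_nonneg)
  define I where "I = (INF g\<in>K. J g)"
  have bb: "bdd_below (J ` K)" using J_nonneg by (intro bdd_belowI[of _ 0]) auto
  have I_le: "I \<le> J g" if "g \<in> K" for g unfolding I_def using bb that by (rule cINF_lower)
  define A where "A n = {g \<in> K. J g \<le> I + 1 / Suc n}" for n
  have J_mid: "J (\<lambda>x. (f x + g x) / 2) \<le> (J f + J g) / 2" if "f \<in> K" "g \<in> K" for f g
  proof -
    have sq: "square_integrable M (\<lambda>x. (f x + g x) / 2)"
      using square_integrable_cmult[OF square_integrable_add[OF K K], of f g "1/2"] that by simp
    have "J (\<lambda>x. (f x + g x) / 2)
        \<le> (\<integral>x. (\<theta> x ((cmod (\<Phi> x - f x))\<^sup>2) + \<theta> x ((cmod (\<Phi> x - g x))\<^sup>2)) / 2 \<partial>M)"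
      unfolding J_def
    proof (rule integral_mono)
      show "integrable M (\<lambda>x. (\<theta> x ((cmod (\<Phi> x - f x))\<^sup>2) + \<theta> x ((cmod (\<Phi> x - g x))\<^sup>2)) / 2)"
        using J_int[OF K] that by auto
      fix x
      have eq: "\<Phi> x - (f x + g x) / 2 = ((\<Phi> x - f x) + (\<Phi> x - g x)) / 2" by (simp add: field_simps)
      show "\<theta> x ((cmod (\<Phi> x - (f x + g x) / 2))\<^sup>2)
          \<le> (\<theta> x ((cmod (\<Phi> x - f x))\<^sup>2) + \<theta> x ((cmod (\<Phi> x - g x))\<^sup>2)) / 2"
        unfolding eq by (rule \<theta>_mid)
    qed (rule J_int[OF sq])
    also have "\<dots> = (J f + J g) / 2"
      unfolding J_def using J_int[OF K] that by simp
    finally show ?thesis .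
  qed
  have norm_le: "L2sq M g \<le> 2 * L2sq M \<Phi> + 2 / c * J g" if g: "g \<in> K" for g
  proof -
    have "L2sq M g
        \<le> (\<integral>x. 2 * (cmod (\<Phi> x))\<^sup>2 + 2 / c * \<theta> x ((cmod (\<Phi> x - g x))\<^sup>2) \<partial>M)"
    proof (rule integral_mono)
      fix x
      have "(cmod (g x))\<^sup>2 \<le> 2 * (cmod (\<Phi> x))\<^sup>2 + 2 * (cmod (\<Phi> x - g x))\<^sup>2"
        using cmod_add_power2_le[of "\<Phi> x" "g x - \<Phi> x"] by (simp add: norm_minus_commute)
      also have "(cmod (\<Phi> x - g x))\<^sup>2 \<le> 1 / c * \<theta> x ((cmod (\<Phi> x - g x))\<^sup>2)"
        using \<theta>_lb[of "(cmod (\<Phi> x - g x))\<^sup>2" x] c by (simp add: field_simps)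
      finally show "(cmod (g x))\<^sup>2 \<le> 2 * (cmod (\<Phi> x))\<^sup>2 + 2 / c * \<theta> x ((cmod (\<Phi> x - g x))\<^sup>2)"
        by simp
    qed (use \<Phi> K[OF g] J_int[OF K[OF g]] in
        \<open>auto intro!: square_integrable_integrable integrable_mult_right Bochner_Integration.integrable_add\<close>)
    also have "\<dots> = 2 * L2sq M \<Phi> + 2 / c * J g"
      unfolding J_def using \<Phi> J_int[OF K[OF g]]
      by (subst Bochner_Integration.integral_add) (auto intro!: square_integrable_integrable integrable_mult_right)
    finally show ?thesis .
  qed
  have dec: "decseq A"
    unfolding decseq_def A_def by (auto elim!: order_trans simp: frac_le)
  have bounded: "\<exists>f\<in>A n. L2sq M f \<le> 2 * L2sq M \<Phi> + 2 / c * (I + 1)" for n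
  proof -
    have "\<exists>f\<in>K. J f < I + 1 / Suc n"
      using K_0 bb by (subst cINF_less_iff[symmetric]) (auto simp: I_def)
    then obtain f where f: "f \<in> K" "J f < I + 1 / Suc n" by blast
    have "2 / c * J f \<le> 2 / c * (I + 1)"
    proof (rule mult_left_mono)
      have "1 / real (Suc n) \<le> 1" by simp
      then show "J f \<le> I + 1" using f by linarith
    qed (use c in simp)
    then have "L2sq M f \<le> 2 * L2sq M \<Phi> + 2 / c * (I + 1)"
      using norm_le[OF f(1)] by linarith
    moreover have "f \<in> A n" using f by (simp add: A_def less_imp_le)
    ultimately show ?thesis by blast
  qed
  have mid: "(\<lambda>x. (f x + g x) / 2) \<in> A n" if "f \<in> A n" "g \<in> A n" for f g n
  proof -
    have fg: "f \<in> K" "g \<in> K" "J f \<le> I + 1 / Suc n" "J g \<le> I + 1 / Suc n" using that by (auto simp: A_def)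
    have "(\<lambda>x. 1 / 2 * (f x + g x)) \<in> K" by (intro K_cmult K_add fg)
    with fg J_mid[OF fg(1,2)] show ?thesis by (simp add: A_def)
  qed
  obtain s g where s: "\<And>n. s n \<in> A n" and g: "square_integrable M g"
    and ae: "AE x in M. (\<lambda>n. s n x) \<longlonglongrightarrow> g x"
    and lim: "(\<lambda>n. L2sq M (\<lambda>x. s n x - g x)) \<longlonglongrightarrow> 0"
    by (rule nested_convex_limit[of A, OF _ dec mid bounded]) (auto simp: A_def intro: K)
  have sK: "s n \<in> K" and sJ: "J (s n) \<le> I + 1 / Suc n" for n using s[of n] by (auto simp: A_def)
  have gK: "g \<in> K" using K_closed[OF sK g lim] .
  have "J g \<le> I"
    unfolding J_def
  proof (rule Fatou_integral(2)[where X = "\<lambda>n x. \<theta> x ((cmod (\<Phi> x - s n x))\<^sup>2)"])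
    show "(\<lambda>x. \<theta> x ((cmod (\<Phi> x - g x))\<^sup>2)) \<in> borel_measurable M" using J_int[OF g] by auto
    show "AE x in M. (\<lambda>n. \<theta> x ((cmod (\<Phi> x - s n x))\<^sup>2)) \<longlonglongrightarrow> \<theta> x ((cmod (\<Phi> x - g x))\<^sup>2)"
      using ae by eventually_elim (auto intro!: \<theta>_lim tendsto_intros)
    show "\<forall>\<^sub>F n in sequentially. (\<integral>x. \<theta> x ((cmod (\<Phi> x - s n x))\<^sup>2) \<partial>M) \<le> I + 1 / Suc n"
      using sJ by (simp add: J_def)
    have "(\<lambda>n. 1 / real (Suc n)) \<longlonglongrightarrow> 0"
      using LIMSEQ_inverse_real_of_nat by (simp add: inverse_eq_divide)
    from tendsto_add[OF tendsto_const this] show "(\<lambda>n. I + 1 / real (Suc n)) \<longlonglongrightarrow> I" by simp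
  qed (use J_int[OF K[OF sK]] \<theta>_nonneg in auto)
  define e where "e x = \<Phi> x - g x" for x
  define w where "w x = \<theta>' x ((cmod (e x))\<^sup>2)" for x
  have e: "square_integrable M e" unfolding e_def by (rule square_integrable_diff[OF \<Phi> g])
  have [measurable]: "e \<in> borel_measurable M" using e by (rule square_integrable_measurable)
  have [measurable]: "w \<in> borel_measurable M" unfolding w_def by (rule \<theta>'_meas) simp
  have w: "c \<le> w x" "w x \<le> b" for x using \<theta>'_bounds by (auto simp: w_def)
  have we: "square_integrable M (\<lambda>x. of_real (w x) * cnj (e x))"
    by (rule square_integrable_bounded_mult[OF square_integrable_cnj[OF e], where B = b])
      (use w c in \<open>auto intro!: always_eventually simp: abs_of_nonneg order_trans[of 0 c]\<close>)
  have real_part: "Re (\<integral>x. of_real (w x) * cnj (e x) * f x \<partial>M) = 0"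
    if f: "f \<in> K" and fB: "AE x in M. cmod (f x) \<le> B" for f B
  proof -
    have sf: "square_integrable M f" using K[OF f] .
    have [measurable]: "f \<in> borel_measurable M" using sf by (rule square_integrable_measurable)
    \<comment> \<open>the coefficient of the square of t: the first term comes from the subgradient, the others
      bound the square of the change of the squared error when t is at most one\<close>
    define Y where "Y x = b * (cmod (f x))\<^sup>2 + (8 * B\<^sup>2 * (cmod (e x))\<^sup>2 + 2 * B ^ 4)" for x
    have Yi: "integrable M Y"
      unfolding Y_def using sf e
      by (intro Bochner_Integration.integrable_add integrable_mult_right square_integrable_integrable) auto
    have Xi: "integrable M (\<lambda>x. of_real (w x) * cnj (e x) * f x)"
      by (rule integrable_mult_square_integrable[OF we sf])
    then have Xr: "integrable M (\<lambda>x. Re (of_real (w x) * cnj (e x) * f x))"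
      by (rule integrable_Re)
    have "0 \<le> - 2 * t * (\<integral>x. Re (of_real (w x) * cnj (e x) * f x) \<partial>M) + t\<^sup>2 * (\<integral>x. Y x \<partial>M)"
      if t: "\<bar>t\<bar> \<le> 1" for t :: real
    proof -
      have gt: "(\<lambda>x. g x + of_real t * f x) \<in> K" by (intro K_add K_cmult gK f)
      have "J g \<le> J (\<lambda>x. g x + of_real t * f x)" using \<open>J g \<le> I\<close> I_le[OF gt] by linarith
      also have "\<dots> \<le> (\<integral>x. \<theta> x ((cmod (e x))\<^sup>2) + (- 2 * t * Re (of_real (w x) * cnj (e x) * f x) + t\<^sup>2 * Y x) \<partial>M)"
        unfolding J_def
      proof (rule integral_mono_AE)
        show "AE x in M. \<theta> x ((cmod (\<Phi> x - (g x + of_real t * f x)))\<^sup>2)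
          \<le> \<theta> x ((cmod (e x))\<^sup>2) + (- 2 * t * Re (of_real (w x) * cnj (e x) * f x) + t\<^sup>2 * Y x)"
          using fB
        proof eventually_elim
          case (elim x)
          define r where "r = - 2 * t * Re (cnj (e x) * f x) + t\<^sup>2 * (cmod (f x))\<^sup>2"
          have "(cmod (e x - of_real t * f x))\<^sup>2 = (cmod (e x))\<^sup>2 + r"
            unfolding r_def cmod_power2 by (simp add: power2_eq_square algebra_simps)
          moreover have "\<Phi> x - (g x + of_real t * f x) = e x - of_real t * f x" by (simp add: e_def)
          ultimately have "\<theta> x ((cmod (\<Phi> x - (g x + of_real t * f x)))\<^sup>2)
              \<le> \<theta> x ((cmod (e x))\<^sup>2) + w x * r + r\<^sup>2"
            using upper[of "(cmod (e x))\<^sup>2" "(cmod (e x))\<^sup>2 + r" x] unfolding w_def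
            by (metis add_diff_cancel_left' zero_le_power2)
          moreover have "r\<^sup>2 \<le> t\<^sup>2 * (8 * B\<^sup>2 * (cmod (e x))\<^sup>2 + 2 * B ^ 4)"
          proof -
            have "\<bar>Re (cnj (e x) * f x)\<bar> \<le> cmod (e x) * B"
              using abs_Re_le_cmod[of "cnj (e x) * f x"] elim
              by (simp add: norm_mult) (meson mult_left_mono norm_ge_zero order_trans)
            then have "2 * \<bar>t\<bar> * \<bar>Re (cnj (e x) * f x)\<bar> \<le> \<bar>t\<bar> * (2 * B * cmod (e x))"
              by (simp add: mult.assoc mult_left_mono mult.commute)
            moreover have "t\<^sup>2 * (cmod (f x))\<^sup>2 \<le> \<bar>t\<bar> * B\<^sup>2"
            proof (rule mult_mono)
              show "t\<^sup>2 \<le> \<bar>t\<bar>" using t by (metis abs_ge_zero mult_left_le power2_abs power2_eq_square)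
              show "(cmod (f x))\<^sup>2 \<le> B\<^sup>2" using elim by (intro power_mono) auto
            qed auto
            moreover have "\<bar>r\<bar> \<le> 2 * \<bar>t\<bar> * \<bar>Re (cnj (e x) * f x)\<bar> + t\<^sup>2 * (cmod (f x))\<^sup>2"
              unfolding r_def by (rule order_trans[OF abs_triangle_ineq]) (simp add: abs_mult)
            ultimately have "\<bar>r\<bar> \<le> \<bar>t\<bar> * (2 * B * cmod (e x) + B\<^sup>2)" by (simp add: distrib_left)
            then have "\<bar>r\<bar>\<^sup>2 \<le> (\<bar>t\<bar> * (2 * B * cmod (e x) + B\<^sup>2))\<^sup>2" by (intro power_mono) auto
            also have "\<dots> = t\<^sup>2 * (2 * B * cmod (e x) + B\<^sup>2)\<^sup>2" by (simp add: power_mult_distrib)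
            also have "\<dots> \<le> t\<^sup>2 * (8 * B\<^sup>2 * (cmod (e x))\<^sup>2 + 2 * B ^ 4)"
              using sum_squares_bound[of "2 * B * cmod (e x)" "B\<^sup>2"]
              by (intro mult_left_mono) (auto simp: power2_sum power_mult_distrib)
            finally show ?thesis by simp
          qed
          moreover have "w x * r \<le> - 2 * t * Re (of_real (w x) * cnj (e x) * f x) + t\<^sup>2 * (b * (cmod (f x))\<^sup>2)"
            using w(2)[of x] mult_right_mono[of "w x" b "t\<^sup>2 * (cmod (f x))\<^sup>2"]
            by (simp add: r_def algebra_simps)
          ultimately show ?case by (simp add: Y_def distrib_left)
        qed
        show "integrable M (\<lambda>x. \<theta> x ((cmod (e x))\<^sup>2) + (- 2 * t * Re (of_real (w x) * cnj (e x) * f x) + t\<^sup>2 * Y x))"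
          using J_int[OF g] Xr Yi unfolding e_def[symmetric]
          by (intro Bochner_Integration.integrable_add integrable_mult_right)
      qed (rule J_int[OF K[OF gt]])
      also have "\<dots> = J g + (- 2 * t * (\<integral>x. Re (of_real (w x) * cnj (e x) * f x) \<partial>M) + t\<^sup>2 * (\<integral>x. Y x \<partial>M))"
        unfolding J_def e_def[symmetric] using J_int[OF g] Xr Yi unfolding e_def[symmetric]
        by (subst Bochner_Integration.integral_add, simp, force intro: Bochner_Integration.integrable_add integrable_mult_right)
           (subst Bochner_Integration.integral_add, auto)
      finally show ?thesis by simp
    qed
    then have "(\<integral>x. Re (of_real (w x) * cnj (e x) * f x) \<partial>M) = 0" by (rule linear_term_zero)
    then show ?thesis using integral_Re[OF Xi] by simp
  qed
  show ?thesis
  proof (rule that[OF gK])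
    fix f B assume f: "f \<in> K" and fB: "AE x in M. cmod (f x) \<le> B"
    \<comment> \<open>up to sign, the imaginary part is the real part for the direction i f\<close>
    have "Re (\<integral>x. of_real (w x) * cnj (e x) * (\<i> * f x) \<partial>M) = 0"
      by (rule real_part[OF K_cmult[OF f]]) (use fB in \<open>simp add: norm_mult\<close>)
    also have "(\<integral>x. of_real (w x) * cnj (e x) * (\<i> * f x) \<partial>M) = \<i> * (\<integral>x. of_real (w x) * cnj (e x) * f x \<partial>M)"
      by (subst integral_mult_right_zero[symmetric]) (simp add: mult_ac)
    finally have "(\<integral>x. of_real (w x) * cnj (e x) * f x \<partial>M) = 0"
      using real_part[OF f fB] by (simp add: complex_eq_iff)
    then show "(\<integral>x. of_real (\<theta>' x ((cmod (\<Phi> x - g x))\<^sup>2)) * cnj (\<Phi> x - g x) * f x \<partial>M) = 0"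
      by (simp add: w_def e_def)
  qed
qed

section \<open>Sections of functions on the torus\<close>

interpretation circle2: pair_prob_space circle circle ..

lemma prob_space_torus: "prob_space torus"
  unfolding torus_def by (rule circle2.P.prob_space_axioms)

interpretation torus: prob_space torus by (rule prob_space_torus)

lemma space_torus [simp]: "space torus = sphere 0 1 \<times> sphere 0 1"
  by (simp add: torus_def space_pair_measure)

lemma measurable_torus_cong [measurable_cong]: "sets torus = sets (circle \<Otimes>\<^sub>M circle)"
  by (simp add: torus_def)

lemma measurable_section:
  assumes "f \<in> borel_measurable torus" "l \<in> space circle"
  shows "(\<lambda>z. f (l, z)) \<in> borel_measurable circle"
  by (rule measurable_compose[OF measurable_Pair1'[OF assms(2)]]) (use assms in \<open>simp add: torus_def\<close>)

lemma measurable_section_integral: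
  fixes f :: "complex \<times> complex \<Rightarrow> 'b::{banach, second_countable_topology}"
  assumes "f \<in> borel_measurable torus"
  shows "(\<lambda>l. \<integral>z. f (l, z) \<partial>circle) \<in> borel_measurable circle"
  by (rule circle.borel_measurable_lebesgue_integral) (use assms in \<open>simp add: torus_def\<close>)

lemma torus_AE_section: "AE x in torus. P x \<Longrightarrow> AE l in circle. AE z in circle. P (l, z)"
  unfolding torus_def by (rule circle2.AE_pair)

lemma torus_AE_sectionI:
  "{x \<in> space torus. P x} \<in> sets torus \<Longrightarrow> AE l in circle. AE z in circle. P (l, z) \<Longrightarrow> AE x in torus. P x"
  unfolding torus_def by (rule circle2.AE_pair_measure)

lemma
  fixes f :: "complex \<times> complex \<Rightarrow> 'b::{banach, second_countable_topology}"
  assumes "integrable torus f"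
  shows torus_AE_integrable: "AE l in circle. integrable circle (\<lambda>z. f (l, z))"
    and torus_integrable_section: "integrable circle (\<lambda>l. \<integral>z. f (l, z) \<partial>circle)"
    and torus_Fubini: "(\<integral>l. (\<integral>z. f (l, z) \<partial>circle) \<partial>circle) = (\<integral>x. f x \<partial>torus)"
  using assms unfolding torus_def
  by (rule circle2.AE_integrable_fst' circle2.integrable_fst' circle2.integral_fst')+

lemma torus_square_integrable_section:
  assumes "square_integrable torus f"
  shows "AE l in circle. square_integrable circle (\<lambda>z. f (l, z))"
proof -
  have f: "f \<in> borel_measurable torus" using assms by (rule square_integrable_measurable)
  show ?thesis
    using torus_AE_integrable[OF square_integrable_integrable[OF assms]] AE_space
    by eventually_elim (auto simp: square_integrable_def intro: measurable_section[OF f])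
qed

lemma torus_measurable_fst [measurable]: "fst \<in> torus \<rightarrow>\<^sub>M circle"
  and torus_measurable_snd [measurable]: "snd \<in> torus \<rightarrow>\<^sub>M circle"
  by (simp_all add: torus_def)

lemma torus_measurable_coordinates [measurable]:
  "fst \<in> borel_measurable torus" "snd \<in> borel_measurable torus"
  using measurable_compose[OF torus_measurable_fst measurable_ident_circle]
    measurable_compose[OF torus_measurable_snd measurable_ident_circle] by simp_all

lemma torus_measurable_compose_fst [measurable]:
  "a \<in> borel_measurable circle \<Longrightarrow> (\<lambda>x. a (fst x)) \<in> borel_measurable torus"
  by (rule measurable_compose[OF torus_measurable_fst])

lemma torus_AE_norm: "AE x in torus. cmod (fst x) = 1 \<and> cmod (snd x) = 1"
  by (rule AE_I2) auto

text \<open>Testing against functions of the first variable detects whether almost all sections of a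
  function have integral zero.\<close>

lemma section_integral_AE_zero:
  fixes X :: "complex \<times> complex \<Rightarrow> complex"
  assumes X: "integrable torus X"
    and test: "\<And>a. a \<in> borel_measurable circle \<Longrightarrow> (\<And>l. cmod (a l) \<le> 1) \<Longrightarrow> (\<integral>x. X x * a (fst x) \<partial>torus) = 0"
  shows "AE l in circle. (\<integral>z. X (l, z) \<partial>circle) = 0"
proof -
  define Y where "Y l = (\<integral>z. X (l, z) \<partial>circle)" for l
  have Yi: "integrable circle Y" unfolding Y_def by (rule torus_integrable_section[OF X])
  have Ym [measurable]: "Y \<in> borel_measurable circle" using Yi by (rule borel_measurable_integrable)
  \<comment> \<open>the conjugate sign of Y, equal to zero where Y vanishes\<close>
  define a where "a l = cnj (Y l) / of_real (cmod (Y l))" for l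
  have a [measurable]: "a \<in> borel_measurable circle"
    unfolding a_def by measurable
  have a1: "cmod (a l) \<le> 1" for l by (simp add: a_def norm_divide)
  have Xa: "integrable torus (\<lambda>x. X x * a (fst x))"
    by (rule integrable_bounded_mult[OF X, where B = 1]) (use a1 in auto)
  have "0 = (\<integral>x. X x * a (fst x) \<partial>torus)" using test[OF a a1] by simp
  also have "\<dots> = (\<integral>l. Y l * a l \<partial>circle)"
    unfolding torus_Fubini[OF Xa, symmetric] by (simp add: Y_def)
  also have "\<dots> = (\<integral>l. complex_of_real (cmod (Y l)) \<partial>circle)"
  proof (rule Lebesgue_cong)
    fix l
    have "Y l * cnj (Y l) = complex_of_real (cmod (Y l)) * complex_of_real (cmod (Y l))"
      by (simp add: complex_norm_square[symmetric] power2_eq_square)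
    then show "Y l * a l = complex_of_real (cmod (Y l))" by (cases "Y l = 0") (simp_all add: a_def)
  qed simp
  finally have "(\<integral>l. cmod (Y l) \<partial>circle) = 0"
    by (simp only: integral_complex_of_real) (metis of_real_eq_0_iff)
  then have "AE l in circle. cmod (Y l) = 0"
    using integral_nonneg_eq_0_iff_AE[OF integrable_norm[OF Yi]] by simp
  then show ?thesis by (simp add: Y_def)
qed

section \<open>Functions with analytic sections\<close>

text \<open>For \<open>m = 1\<close> these are the functions whose sections \<open>g (l, _)\<close> have no negative frequencies, for
  \<open>m = 0\<close> those whose sections have positive frequencies only.  The coefficient of index \<open>-k\<close> is the
  integral against \<open>z ^ k\<close>.\<close>

definition hardy :: "nat \<Rightarrow> (complex \<times> complex \<Rightarrow> complex) set" where
  "hardy m = {g. square_integrable torus g \<and>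
     (AE l in circle. \<forall>k\<ge>m. (\<integral>z. g (l, z) * z ^ k \<partial>circle) = 0)}"

lemma hardy_square_integrable: "g \<in> hardy m \<Longrightarrow> square_integrable torus g"
  by (simp add: hardy_def)

lemma hardy_sectionD:
  "g \<in> hardy m \<Longrightarrow> AE l in circle. square_integrable circle (\<lambda>z. g (l, z)) \<and>
     (\<forall>k\<ge>m. (\<integral>z. g (l, z) * z ^ k \<partial>circle) = 0)"
  unfolding hardy_def using torus_square_integrable_section by auto

lemma torus_bounded_mult:
  "square_integrable torus g \<Longrightarrow> a \<in> borel_measurable circle \<Longrightarrow> (\<And>l. cmod (a l) \<le> B) \<Longrightarrow>
     square_integrable torus (\<lambda>x. a (fst x) * snd x ^ k * g x)"
proof (rule square_integrable_bounded_mult[where B = B])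
  assume B: "\<And>l. cmod (a l) \<le> B"
  show "AE x in torus. cmod (a (fst x) * snd x ^ k) \<le> B"
    using torus_AE_norm by eventually_elim (simp add: norm_mult norm_power B)
qed auto

text \<open>The pointwise description of the space is convenient for products, the description by test
  functions for limits and for the conclusions of variational arguments.\<close>

lemma hardy_iff_test:
  "g \<in> hardy m \<longleftrightarrow> square_integrable torus g \<and>
     (\<forall>k\<ge>m. \<forall>a\<in>borel_measurable circle. (\<forall>l. cmod (a l) \<le> 1) \<longrightarrow>
        (\<integral>x. (a (fst x) * snd x ^ k) * g x \<partial>torus) = 0)"
proof (intro iffI conjI allI impI ballI)
  fix k a assume g: "g \<in> hardy m" and k: "m \<le> k" and a: "a \<in> borel_measurable circle" "\<forall>l. cmod (a l) \<le> 1"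
  have "integrable torus (\<lambda>x. a (fst x) * snd x ^ k * g x)"
    using a by (intro torus.integrable_of_square_integrable torus_bounded_mult[where B = 1] hardy_square_integrable[OF g]) auto
  from torus_Fubini[OF this]
  have "(\<integral>x. a (fst x) * snd x ^ k * g x \<partial>torus) = (\<integral>l. a l * (\<integral>z. g (l, z) * z ^ k \<partial>circle) \<partial>circle)"
    by (simp add: mult_ac flip: integral_mult_right_zero)
  also have "\<dots> = (\<integral>l. 0 \<partial>circle)"
  proof (rule integral_cong_AE)
    show "AE l in circle. a l * (\<integral>z. g (l, z) * z ^ k \<partial>circle) = 0"
      using hardy_sectionD[OF g] by eventually_elim (use k in simp)
    have "(\<lambda>x. g x * snd x ^ k) \<in> borel_measurable torus"
      using square_integrable_measurable[OF hardy_square_integrable[OF g]] by measurable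
    from measurable_section_integral[OF this]
    show "(\<lambda>l. a l * (\<integral>z. g (l, z) * z ^ k \<partial>circle)) \<in> borel_measurable circle"
      using a by simp
  qed simp
  finally show "(\<integral>x. (a (fst x) * snd x ^ k) * g x \<partial>torus) = 0" by simp
next
  assume *: "square_integrable torus g \<and>
     (\<forall>k\<ge>m. \<forall>a\<in>borel_measurable circle. (\<forall>l. cmod (a l) \<le> 1) \<longrightarrow>
        (\<integral>x. (a (fst x) * snd x ^ k) * g x \<partial>torus) = 0)"
  then have g: "square_integrable torus g" by simp
  have "AE l in circle. (\<integral>z. g (l, z) * z ^ k \<partial>circle) = 0" if "m \<le> k" for k
  proof -
    have "integrable torus (\<lambda>x. g x * snd x ^ k)"
      using torus.integrable_of_square_integrable[OF torus_bounded_mult[OF g, of "\<lambda>_. 1" 1 k]]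
      by (simp add: mult.commute)
    from section_integral_AE_zero[OF this] show ?thesis
      using * that by (simp add: mult_ac)
  qed
  then show "g \<in> hardy m"
    unfolding hardy_def using g by (auto simp: AE_all_countable)
qed (auto simp: hardy_def)

lemma hardy_zero: "(\<lambda>_. 0) \<in> hardy m"
  by (simp add: hardy_def torus.square_integrable_const)

lemma hardy_add: "f \<in> hardy m \<Longrightarrow> g \<in> hardy m \<Longrightarrow> (\<lambda>x. f x + g x) \<in> hardy m"
proof -
  assume f: "f \<in> hardy m" and g: "g \<in> hardy m"
  have "AE l in circle. \<forall>k\<ge>m. (\<integral>z. (f (l, z) + g (l, z)) * z ^ k \<partial>circle) = 0"
    using hardy_sectionD[OF f] hardy_sectionD[OF g]
    by eventually_elim (auto simp: distrib_right circle_integrable_mult circle.integrable_of_square_integrable)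
  with f g show ?thesis by (auto simp: hardy_def intro: square_integrable_add)
qed

lemma hardy_cmult: "f \<in> hardy m \<Longrightarrow> (\<lambda>x. c * f x) \<in> hardy m"
  unfolding hardy_def by (auto simp: mult.assoc intro: square_integrable_cmult elim!: eventually_mono)

lemma hardy_closed:
  assumes s: "\<And>n. s n \<in> hardy m" and g: "square_integrable torus g"
    and lim: "(\<lambda>n. L2sq torus (\<lambda>x. s n x - g x)) \<longlonglongrightarrow> 0"
  shows "g \<in> hardy m"
  unfolding hardy_iff_test
proof (intro conjI allI impI ballI g)
  fix k a assume k: "m \<le> k" and a: "a \<in> borel_measurable circle" "\<forall>l. cmod (a l) \<le> 1"
  have "square_integrable torus (\<lambda>x. a (fst x) * snd x ^ k)"
    using torus_bounded_mult[OF torus.square_integrable_const[of 1] a(1), of 1 k] a(2) by simp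
  from L2_tendsto_inner[OF hardy_square_integrable[OF s] g this lim]
  have "(\<lambda>n. \<integral>x. (a (fst x) * snd x ^ k) * s n x \<partial>torus) \<longlonglongrightarrow> (\<integral>x. (a (fst x) * snd x ^ k) * g x \<partial>torus)" .
  moreover have "(\<integral>x. (a (fst x) * snd x ^ k) * s n x \<partial>torus) = 0" for n
    using s[of n] k a unfolding hardy_iff_test by blast
  ultimately show "(\<integral>x. (a (fst x) * snd x ^ k) * g x \<partial>torus) = 0"
    by (simp add: LIMSEQ_const_iff)
qed

lemma hardy_monomial_mult:
  assumes g: "g \<in> hardy (Suc 0)" and a: "a \<in> borel_measurable circle" "\<And>l. cmod (a l) \<le> B"
    and k: "1 \<le> m + k"
  shows "(\<lambda>x. a (fst x) * snd x ^ k * g x) \<in> hardy m"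
proof -
  have "AE l in circle. \<forall>j\<ge>m. (\<integral>z. (a l * z ^ k * g (l, z)) * z ^ j \<partial>circle) = 0"
    using hardy_sectionD[OF g]
  proof eventually_elim
    case (elim l)
    have "(\<integral>z. (a l * z ^ k * g (l, z)) * z ^ j \<partial>circle) = a l * (\<integral>z. g (l, z) * z ^ (k + j) \<partial>circle)" for j
      by (subst integral_mult_right_zero[symmetric]) (simp add: power_add mult_ac)
    with elim k show ?case by auto
  qed
  with torus_bounded_mult[OF hardy_square_integrable[OF g] a] show ?thesis by (simp add: hardy_def)
qed

lemma hardy_const: "(\<lambda>_. c) \<in> hardy (Suc 0)"
proof -
  have "(\<integral>z. c * z ^ k \<partial>circle) = 0" if "Suc 0 \<le> k" for k
    using integral_circle_power[of k] that by simp
  then show ?thesis by (simp add: hardy_def torus.square_integrable_const)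
qed

section \<open>Outer factorization\<close>

text \<open>Szego's extremal problem, solved for all sections at once: \<open>F = 1 - G\<close> is the function of mean
  value one on sections, without negative frequencies, whose norm with respect to the weight \<open>w\<close>
  is minimal.  By the first variation \<open>w cnj F\<close> has no negative frequencies.  Hence neither has its
  product with \<open>F\<close>, which is \<open>w \<bar>F\<bar>\<^sup>2\<close>; being real, this function is constant on sections.  If \<open>C\<close>, a function
  of \<open>l\<close>, is the constant, then \<open>h = w cnj F / sqrt C\<close> and \<open>h' = F / sqrt C\<close> are analytic, inverse to each other, and
  satisfy \<open>\<bar>h\<bar>\<^sup>2 = w\<close>.\<close>

theorem outer_factorization:
  assumes w_meas [measurable]: "w \<in> borel_measurable torus"
    and c: "0 < c" and w: "\<And>x. c \<le> w x \<and> w x \<le> (b :: real)"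
  obtains h h' where "h \<in> hardy (Suc 0)" "h' \<in> hardy (Suc 0)"
    "AE x in torus. (cmod (h x))\<^sup>2 = w x" "AE x in torus. h x * h' x = 1"
proof -
  obtain G where G: "G \<in> hardy 0" and opt: "\<And>f B. f \<in> hardy 0 \<Longrightarrow> AE x in torus. cmod (f x) \<le> B \<Longrightarrow>
       (\<integral>x. of_real (w x) * cnj (1 - G x) * f x \<partial>torus) = 0"
  proof (rule torus.variational_principle[where K = "hardy 0" and \<theta> = "\<lambda>x s. w x * s"
        and \<theta>' = "\<lambda>x s. w x" and c = c and b = b and \<Phi> = "\<lambda>_. 1"])
    show "g \<in> hardy 0" if "\<And>n. s n \<in> hardy 0" "square_integrable torus g"
      "(\<lambda>n. L2sq torus (\<lambda>x. s n x - g x)) \<longlonglongrightarrow> 0" for s g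
      using that by (rule hardy_closed)
  qed (use c w in \<open>auto simp: torus.square_integrable_const hardy_zero hardy_add hardy_cmult
        hardy_square_integrable algebra_simps\<close>)
  define F where "F x = 1 - G x" for x
  have F: "F \<in> hardy (Suc 0)"
  proof -
    have "G \<in> hardy (Suc 0)" using G by (auto simp: hardy_def elim!: eventually_mono)
    from hardy_add[OF hardy_const[of 1] hardy_cmult[OF this, of "-1"]] show ?thesis by (simp add: F_def[abs_def])
  qed
  have Fm [measurable]: "F \<in> borel_measurable torus"
    using hardy_square_integrable[OF F] by (rule square_integrable_measurable)
  define W where "W x = of_real (w x) * cnj (F x)" for x
  have W: "square_integrable torus W"
    unfolding W_def
    by (rule square_integrable_bounded_mult[OF square_integrable_cnj[OF hardy_square_integrable[OF F]], where B = b])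
      (use w c in \<open>auto intro!: always_eventually simp: abs_of_nonneg order_trans[of 0 c]\<close>)
  have Wm [measurable]: "W \<in> borel_measurable torus" using W by (rule square_integrable_measurable)
  have W_hardy: "W \<in> hardy (Suc 0)"
    unfolding hardy_iff_test
  proof (intro conjI allI impI ballI W)
    fix k a assume k: "Suc 0 \<le> k" and a: "a \<in> borel_measurable circle" "\<forall>l. cmod (a l) \<le> 1"
    have "(\<lambda>x. a (fst x) * snd x ^ k * 1) \<in> hardy 0"
      by (rule hardy_monomial_mult[OF hardy_const a(1), of 1]) (use a k in auto)
    moreover have "AE x in torus. cmod (a (fst x) * snd x ^ k * 1) \<le> 1"
      using torus_AE_norm by eventually_elim (use a in \<open>auto simp: norm_mult norm_power\<close>)
    ultimately have "(\<integral>x. W x * (a (fst x) * snd x ^ k) \<partial>torus) = 0"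
      using opt[of "\<lambda>x. a (fst x) * snd x ^ k" 1] by (simp add: W_def F_def)
    then show "(\<integral>x. (a (fst x) * snd x ^ k) * W x \<partial>torus) = 0" by (simp add: mult.commute)
  qed
  define C where "C l = Re (\<integral>z. W (l, z) * F (l, z) \<partial>circle)" for l
  have Cm [measurable]: "C \<in> borel_measurable circle"
    unfolding C_def using measurable_section_integral[of "\<lambda>x. W x * F x"] by measurable
  have WF: "W x * F x = of_real (w x * (cmod (F x))\<^sup>2)" for x
    by (simp only: W_def complex_norm_square of_real_mult) (simp add: mult_ac)
  have G0: "AE l in circle. (\<integral>z. G (l, z) \<partial>circle) = 0"
    using hardy_sectionD[OF G] by eventually_elim (auto dest: spec[of _ 0])
  have C: "AE l in circle. 0 < C l \<and> (AE z in circle. w (l, z) * (cmod (F (l, z)))\<^sup>2 = C l)"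
    using hardy_sectionD[OF F] hardy_sectionD[OF W_hardy] hardy_sectionD[OF G] G0
  proof eventually_elim
    case (elim l)
    then have sF: "square_integrable circle (\<lambda>z. F (l, z))" and sW: "square_integrable circle (\<lambda>z. W (l, z))"
      and sG: "square_integrable circle (\<lambda>z. G (l, z))" by auto
    have WFi: "integrable circle (\<lambda>z. W (l, z) * F (l, z))"
      by (rule integrable_mult_square_integrable[OF sW sF])
    have pos: "(\<integral>z. W (l, z) * F (l, z) * z ^ k \<partial>circle) = 0" if "0 < k" for k
      by (rule analytic_product_vanishes[OF sW sF _ _ that]) (use elim in auto)
    have neg: "(\<integral>z. W (l, z) * F (l, z) * cnj z ^ k \<partial>circle) = 0" if "0 < k" for k
    proof -
      have "(\<integral>z. W (l, z) * F (l, z) * cnj z ^ k \<partial>circle) = (\<integral>z. cnj (W (l, z) * F (l, z) * z ^ k) \<partial>circle)"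
        by (simp only: WF complex_cnj_mult complex_cnj_complex_of_real complex_cnj_power)
      also have "\<dots> = 0" using pos[OF that] by (simp only: Bochner_Integration.integral_cnj complex_cnj_zero)
      finally show ?thesis .
    qed
    have Cl: "(\<integral>z. W (l, z) * F (l, z) \<partial>circle) = of_real (C l)"
      unfolding C_def WF by (simp only: integral_complex_of_real Re_complex_of_real)
    have Ck: "(\<integral>z. z ^ k \<partial>circle) = (if k = 0 then 1 else 0)" "(\<integral>z. cnj z ^ k \<partial>circle) = (if k = 0 then 1 else 0)" for k
      using integral_power_cnj_power[of k 0] integral_power_cnj_power[of 0 k] by auto
    have "AE z in circle. W (l, z) * F (l, z) - of_real (C l) = 0"
    proof (rule fourier_vanishes_AE_zero)
      show "fourier_vanishes (\<lambda>z. W (l, z) * F (l, z) - of_real (C l))"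
        unfolding fourier_vanishes_def
      proof (intro conjI allI)
        fix n
        show "(\<integral>z. (W (l, z) * F (l, z) - of_real (C l)) * z ^ n \<partial>circle) = 0"
          using circle_integrable_mult(1)[OF WFi, of n] circle_integrable_mult(1)[of "\<lambda>_. 1" n] pos[of n] Cl Ck[of n]
          by (cases "n = 0") (simp_all add: left_diff_distrib)
        show "(\<integral>z. (W (l, z) * F (l, z) - of_real (C l)) * cnj z ^ n \<partial>circle) = 0"
          using circle_integrable_mult(2)[OF WFi, of n] circle_integrable_mult(2)[of "\<lambda>_. 1" n] neg[of n] Cl Ck[of n]
          by (cases "n = 0") (simp_all add: left_diff_distrib)
      qed (use WFi in simp)
    qed
    then have eq: "AE z in circle. w (l, z) * (cmod (F (l, z)))\<^sup>2 = C l"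
    proof eventually_elim
      case (elim z)
      then have "of_real (w (l, z) * (cmod (F (l, z)))\<^sup>2) = complex_of_real (C l)" using WF[of "(l, z)"] by simp
      then show ?case by (simp only: of_real_eq_iff)
    qed
    have w0: "0 < w x" for x using w[of x] c by linarith
    have "C l \<noteq> 0"
    proof
      \<comment> \<open>otherwise the section of F would vanish, but its mean value is one\<close>
      assume Cl0: "C l = 0"
      have "AE z in circle. F (l, z) = 0"
        using eq by eventually_elim (use w0 Cl0 in \<open>auto simp: less_le\<close>)
      then have "(\<integral>z. F (l, z) \<partial>circle) = 0" by (simp add: integral_eq_zero_AE)
      moreover have "(\<integral>z. F (l, z) \<partial>circle) = 1"
        using elim circle.integrable_of_square_integrable[OF sG] by (simp add: F_def circle.prob_space)
      ultimately show False by simp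
    qed
    moreover have "0 \<le> C l"
      unfolding C_def WF integral_complex_of_real Re_complex_of_real
      by (rule Bochner_Integration.integral_nonneg) (use w0 in \<open>simp add: less_imp_le\<close>)
    ultimately show ?case using eq by simp
  qed
  have meas_eq: "{x \<in> space torus. 0 < C (fst x) \<and> w x * (cmod (F x))\<^sup>2 = C (fst x)} \<in> sets torus"
    by measurable
  have CT: "AE x in torus. 0 < C (fst x) \<and> w x * (cmod (F x))\<^sup>2 = C (fst x)"
    by (rule torus_AE_sectionI[OF meas_eq]) (use C in \<open>auto elim!: eventually_mono\<close>)
  \<comment> \<open>for the exceptional l with nonpositive C l the value is immaterial\<close>
  define r where "r l = complex_of_real (1 / sqrt (C l))" for l
  have r [measurable]: "r \<in> borel_measurable circle" unfolding r_def by measurable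
  define h where "h x = r (fst x) * W x" for x
  define h' where "h' x = r (fst x) * F x" for x
  have hm: "h \<in> borel_measurable torus" "h' \<in> borel_measurable torus"
    unfolding h_def h'_def by measurable
  have AE_h: "AE x in torus. (cmod (h x))\<^sup>2 = w x \<and> h x * h' x = 1 \<and> (cmod (h' x))\<^sup>2 \<le> 1 / c"
    using CT
  proof eventually_elim
    case (elim x)
    have w0: "0 < w x" using w[of x] c by linarith
    have r2: "(cmod (r (fst x)))\<^sup>2 = 1 / C (fst x)" "r (fst x) * r (fst x) = of_real (1 / C (fst x))"
      using elim by (simp add: r_def norm_divide power_divide)
        (use elim in \<open>simp add: r_def del: of_real_divide flip: of_real_mult\<close>)
    have "(cmod (W x))\<^sup>2 = w x * C (fst x)"
      using elim w0 by (simp add: W_def norm_mult power_mult_distrib power2_eq_square mult_ac)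
    then have "(cmod (h x))\<^sup>2 = w x"
      using elim r2 by (simp add: h_def norm_mult power_mult_distrib)
    moreover have "h x * h' x = 1"
    proof -
      have "h x * h' x = (r (fst x) * r (fst x)) * (W x * F x)" by (simp add: h_def h'_def mult_ac)
      also have "\<dots> = of_real (1 / C (fst x) * C (fst x))" unfolding r2 WF using elim by simp
      finally show ?thesis using elim by simp
    qed
    moreover have "w x * (cmod (h' x))\<^sup>2 = (cmod (r (fst x)))\<^sup>2 * (w x * (cmod (F x))\<^sup>2)"
      by (simp add: h'_def norm_mult power_mult_distrib)
    then have "(cmod (h' x))\<^sup>2 = 1 / w x"
      using elim w0 r2(1) by (simp add: field_simps)
    then have "(cmod (h' x))\<^sup>2 \<le> 1 / c" using w[of x] c by (simp add: frac_le)
    ultimately show ?case by blast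
  qed
  have sec: "(\<lambda>x. r (fst x) * q x) \<in> hardy (Suc 0)"
    if q: "q \<in> hardy (Suc 0)" and sq: "square_integrable torus (\<lambda>x. r (fst x) * q x)" for q
  proof -
    have "AE l in circle. \<forall>k\<ge>Suc 0. (\<integral>z. r l * q (l, z) * z ^ k \<partial>circle) = 0"
      using hardy_sectionD[OF q] by eventually_elim (simp add: mult.assoc)
    with sq show ?thesis by (simp add: hardy_def)
  qed
  show ?thesis
  proof (rule that)
    show "h \<in> hardy (Suc 0)" unfolding h_def
    proof (rule sec[OF W_hardy], fold h_def)
      show "square_integrable torus h"
        by (rule square_integrable_bound[OF hm(1), where g = "\<lambda>_. b"])
          (use AE_h w in \<open>auto elim!: eventually_mono\<close>)
    qed
    show "h' \<in> hardy (Suc 0)" unfolding h'_def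
    proof (rule sec[OF F], fold h'_def)
      show "square_integrable torus h'"
        by (rule square_integrable_bound[OF hm(2), where g = "\<lambda>_. 1 / c"])
          (use AE_h in \<open>auto elim!: eventually_mono\<close>)
    qed
  qed (use AE_h in auto)
qed

section \<open>The coordinates in which the Hankel operator acts fibrewise\<close>

text \<open>In the variables \<open>z1 = z\<close>, \<open>z2 = l z\<close> the monomial with exponents \<open>m\<close>, \<open>n\<close> becomes \<open>l ^ n * z ^ (m + n)\<close>.
  The half plane \<open>m + n \<ge> 0\<close> thus turns into nonnegative frequencies in \<open>z\<close> for each fixed \<open>l\<close>.\<close>

definition shear :: "complex \<times> complex \<Rightarrow> complex \<times> complex" where
  "shear x = (snd x, fst x * snd x)"

definition unshear :: "complex \<times> complex \<Rightarrow> complex \<times> complex" where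
  "unshear x = (snd x * cnj (fst x), fst x)"

lemma shear_measurable [measurable]: "shear \<in> torus \<rightarrow>\<^sub>M torus"
  and unshear_measurable [measurable]: "unshear \<in> torus \<rightarrow>\<^sub>M torus"
proof -
  have "(\<lambda>x. (snd x, fst x * snd x)) \<in> torus \<rightarrow>\<^sub>M circle \<Otimes>\<^sub>M circle"
    by (intro measurable_Pair torus_measurable_snd measurable_circleI) (auto simp: norm_mult)
  then show "shear \<in> torus \<rightarrow>\<^sub>M torus" by (simp add: torus_def[symmetric] shear_def[abs_def])
  have "(\<lambda>x. (snd x * cnj (fst x), fst x)) \<in> torus \<rightarrow>\<^sub>M circle \<Otimes>\<^sub>M circle"
    by (intro measurable_Pair torus_measurable_fst measurable_circleI) (auto simp: norm_mult)
  then show "unshear \<in> torus \<rightarrow>\<^sub>M torus" by (simp add: torus_def[symmetric] unshear_def[abs_def])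
qed

lemma shear_unshear: "x \<in> space torus \<Longrightarrow> shear (unshear x) = x"
  and unshear_shear: "x \<in> space torus \<Longrightarrow> unshear (shear x) = x"
  using circle_mult_cnj[of "fst x"] circle_mult_cnj[of "snd x"]
  by (cases x; auto simp: shear_def unshear_def mult.assoc mult.commute[of "cnj _"])+

text \<open>By Fubini's theorem it suffices to integrate over \<open>l\<close> first, and for fixed \<open>z\<close> the map from \<open>l\<close> to
  \<open>l z\<close> is a rotation.\<close>

lemma distr_shear: "distr torus torus shear = torus"
proof (rule measure_eqI)
  fix A assume "A \<in> sets (distr torus torus shear)"
  then have A [measurable]: "A \<in> sets torus" by simp
  define f :: "complex \<times> complex \<Rightarrow> ennreal" where "f = indicator A"
  have fm [measurable]: "f \<in> borel_measurable (circle \<Otimes>\<^sub>M circle)"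
    using A by (simp add: f_def torus_def)
  have fs: "(\<lambda>x. f (shear x)) \<in> borel_measurable (circle \<Otimes>\<^sub>M circle)"
    using measurable_compose[OF shear_measurable, of f borel] fm by (simp add: torus_def)
  have "emeasure (distr torus torus shear) A = (\<integral>\<^sup>+x. f x \<partial>distr torus torus shear)"
    by (simp add: f_def)
  also have "\<dots> = (\<integral>\<^sup>+x. f (shear x) \<partial>(circle \<Otimes>\<^sub>M circle))"
    using fm by (subst nn_integral_distr) (auto simp: torus_def[symmetric])
  also have "\<dots> = (\<integral>\<^sup>+z. \<integral>\<^sup>+l. f (shear (l, z)) \<partial>circle \<partial>circle)"
    using circle2.nn_integral_snd[of "\<lambda>x. f (shear x)"] fs by simp
  also have "\<dots> = (\<integral>\<^sup>+z. \<integral>\<^sup>+l. f (z, l) \<partial>circle \<partial>circle)"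
  proof (rule nn_integral_cong)
    fix z assume z: "z \<in> space circle"
    have "(\<lambda>l. f (z, l)) \<in> borel_measurable circle"
      using measurable_compose[OF measurable_Pair1'[OF z] fm] .
    from nn_integral_rotate[OF this, of z] z
    show "(\<integral>\<^sup>+l. f (shear (l, z)) \<partial>circle) = (\<integral>\<^sup>+l. f (z, l) \<partial>circle)"
      by (simp add: shear_def mult.commute)
  qed
  also have "\<dots> = (\<integral>\<^sup>+x. f x \<partial>(circle \<Otimes>\<^sub>M circle))"
    by (rule circle.nn_integral_fst) (rule fm)
  also have "\<dots> = emeasure torus A" by (simp add: f_def torus_def[symmetric])
  finally show "emeasure (distr torus torus shear) A = emeasure torus A" .
qed simp

lemma distr_unshear: "distr torus torus unshear = torus"
proof -
  have "distr torus torus unshear = distr (distr torus torus shear) torus unshear"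
    by (simp add: distr_shear)
  also have "\<dots> = distr torus torus (unshear \<circ> shear)"
    by (rule distr_distr) measurable
  also have "\<dots> = distr torus torus (\<lambda>x. x)"
    by (rule distr_cong) (auto simp: unshear_shear simp del: space_torus)
  finally show ?thesis by (simp add: distr_id2)
qed

lemma AE_shear: "AE x in torus. P x \<Longrightarrow> AE x in torus. P (shear x)"
  using AE_distrD[OF shear_measurable, of P] unfolding distr_shear .

lemma AE_unshear: "AE x in torus. P x \<Longrightarrow> AE x in torus. P (unshear x)"
  using AE_distrD[OF unshear_measurable, of P] unfolding distr_unshear .

lemma integral_shear:
  fixes f :: "complex \<times> complex \<Rightarrow> complex"
  shows "f \<in> borel_measurable torus \<Longrightarrow> (\<integral>x. f (shear x) \<partial>torus) = (\<integral>x. f x \<partial>torus)"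
  using integral_distr[OF shear_measurable, of f] by (simp add: distr_shear)

section \<open>Norms\<close>

lemma ennreal_sqrt_ennreal: "0 \<le> x \<Longrightarrow> ennreal_sqrt (ennreal x) = ennreal (sqrt x)"
  by (simp add: ennreal_sqrt_def)

lemma ennreal_sqrt_power2: "(ennreal_sqrt x)\<^sup>2 = x"
  by (cases x) (auto simp: ennreal_sqrt_def ennreal_power)

lemma ennreal_sqrt_mono: "x \<le> y \<Longrightarrow> ennreal_sqrt x \<le> ennreal_sqrt y"
  by (cases x; cases y) (auto simp: ennreal_sqrt_def top_unique intro!: ennreal_leI)

lemma ennreal_sqrt_eq_top: "ennreal_sqrt x = top \<longleftrightarrow> x = top"
  by (simp add: ennreal_sqrt_def)

lemma nn_integral_norm_power2:
  "square_integrable M f \<Longrightarrow> (\<integral>\<^sup>+x. (ennreal (cmod (f x)))\<^sup>2 \<partial>M) = ennreal (L2sq M f)"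
  using nn_integral_eq_integral[OF square_integrable_integrable, of M f] by (simp add: ennreal_power)

lemma L2_norm_eq:
  "square_integrable M f \<Longrightarrow> L2_norm M f = ennreal (sqrt (L2sq M f))"
  by (simp add: L2_norm_def nn_integral_norm_power2 ennreal_sqrt_ennreal)

lemma L2_iff: "f \<in> L2 M \<longleftrightarrow> square_integrable M f"
proof
  assume f: "f \<in> L2 M"
  then have [measurable]: "f \<in> borel_measurable M" by (simp add: L2_def)
  have "(\<integral>\<^sup>+x. (ennreal (cmod (f x)))\<^sup>2 \<partial>M) < top"
    using f by (simp add: L2_def L2_norm_def less_top[symmetric] ennreal_sqrt_eq_top)
  then show "square_integrable M f"
    unfolding square_integrable_def by (auto intro!: integrableI_bounded simp: ennreal_power)
qed (auto simp: L2_def L2_norm_eq square_integrable_measurable)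

lemma L2l2_iff:
  "h \<in> L2l2 \<longleftrightarrow> (\<forall>j. square_integrable circle (h j)) \<and> summable (\<lambda>j. L2sq circle (h j))"
  and L2l2_norm_eq:
  "h \<in> L2l2 \<Longrightarrow> L2l2_norm h = ennreal (sqrt (\<Sum>j. L2sq circle (h j)))"
proof -
  have *: "(\<Sum>j. (L2_norm circle (h j))\<^sup>2) = (\<Sum>j. ennreal (L2sq circle (h j)))"
    if "\<forall>j. square_integrable circle (h j)"
    using that by (simp add: L2_norm_def ennreal_sqrt_power2 nn_integral_norm_power2)
  show iff: "h \<in> L2l2 \<longleftrightarrow> (\<forall>j. square_integrable circle (h j)) \<and> summable (\<lambda>j. L2sq circle (h j))"
  proof -
    have "h \<in> L2l2 \<longleftrightarrow> (\<forall>j. square_integrable circle (h j)) \<and>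
        (\<Sum>j. ennreal (L2sq circle (h j))) \<noteq> top"
      unfolding L2l2_def L2l2_norm_def mem_Collect_eq less_top[symmetric] ennreal_sqrt_eq_top L2_iff
      by (intro conj_cong refl) (subst *, simp_all)
    also have "(\<Sum>j. ennreal (L2sq circle (h j))) \<noteq> top
        \<longleftrightarrow> summable (\<lambda>j. L2sq circle (h j))"
      by (rule iffI, erule summable_suminf_not_top[rotated], simp,
          erule ennreal_suminf_neq_top, simp)
    finally show ?thesis .
  qed
  show "L2l2_norm h = ennreal (sqrt (\<Sum>j. L2sq circle (h j)))" if "h \<in> L2l2"
  proof -
    have "(\<Sum>j. (L2_norm circle (h j))\<^sup>2) = ennreal (\<Sum>j. L2sq circle (h j))"
      using * that unfolding iff by (simp add: suminf_ennreal2)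
    then show ?thesis
      using that unfolding iff by (simp add: L2l2_norm_def ennreal_sqrt_ennreal suminf_nonneg)
  qed
qed

lemma L2l2_pointwise:
  assumes h: "\<And>j. square_integrable circle (h j)" and sm: "summable (\<lambda>j. L2sq circle (h j))"
  shows L2l2_nn_integral: "(\<integral>\<^sup>+l. (\<Sum>j. ennreal ((cmod (h j l))\<^sup>2)) \<partial>circle) = ennreal (\<Sum>j. L2sq circle (h j))"
    and L2l2_AE_summable: "AE l in circle. summable (\<lambda>j. (cmod (h j l))\<^sup>2)"
proof -
  have [measurable]: "\<And>j. h j \<in> borel_measurable circle" using h by (rule square_integrable_measurable)
  show eq: "(\<integral>\<^sup>+l. (\<Sum>j. ennreal ((cmod (h j l))\<^sup>2)) \<partial>circle) = ennreal (\<Sum>j. L2sq circle (h j))"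
    using sm by (subst nn_integral_suminf)
      (auto simp: nn_integral_eq_integral[OF square_integrable_integrable[OF h]] suminf_ennreal2)
  have "AE l in circle. (\<Sum>j. ennreal ((cmod (h j l))\<^sup>2)) \<noteq> \<infinity>"
    by (rule nn_integral_PInf_AE) (auto simp: eq)
  then show "AE l in circle. summable (\<lambda>j. (cmod (h j l))\<^sup>2)"
    by eventually_elim (auto intro: summable_suminf_not_top)
qed

lemma Linf_bound:
  assumes "f \<in> Linf M"
  obtains B where "0 \<le> B" "Linf_norm M f = ennreal B" "AE x in M. cmod (f x) \<le> B" "f \<in> borel_measurable M"
proof -
  have "Linf_norm M f < top" and m: "f \<in> borel_measurable M" using assms by (auto simp: Linf_def)
  then obtain B where B: "0 \<le> B" "Linf_norm M f = ennreal B" by (auto simp: less_top_ennreal)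
  have "AE x in M. ennreal (cmod (f x)) \<le> ennreal B"
    using esssup_AE[of "\<lambda>x. ennreal (cmod (f x))" M] B(2) by (simp add: Linf_norm_def)
  then have "AE x in M. cmod (f x) \<le> B" using B(1) by simp
  with B m that show ?thesis by blast
qed

lemma Linf_norm_le:
  assumes "f \<in> borel_measurable M" "AE x in M. cmod (f x) \<le> B"
  shows "Linf_norm M f \<le> ennreal B"
  unfolding Linf_norm_def using assms by (intro esssup_I) (auto elim!: eventually_mono intro: ennreal_leI)

lemma LinfI:
  assumes "f \<in> borel_measurable M" "AE x in M. cmod (f x) \<le> B"
  shows "f \<in> Linf M"
  using assms Linf_norm_le[OF assms] by (auto simp: Linf_def intro: le_less_trans)

lemma Linf_diff: "f \<in> Linf M \<Longrightarrow> g \<in> Linf M \<Longrightarrow> (\<lambda>x. f x - g x) \<in> Linf M"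
proof -
  assume "f \<in> Linf M" "g \<in> Linf M"
  then obtain A B where fg: "f \<in> borel_measurable M" "g \<in> borel_measurable M"
    "AE x in M. cmod (f x) \<le> A" "AE x in M. cmod (g x) \<le> B" by (elim Linf_bound) blast
  have "AE x in M. cmod (f x - g x) \<le> A + B"
    using fg(3,4) by eventually_elim (meson add_mono norm_triangle_ineq4 order_trans)
  with fg(1,2) show ?thesis by (intro LinfI[where B = "A + B"]) auto
qed

section \<open>Slices as fibrewise Fourier coefficients\<close>

lemma powi_measurable [measurable]:
  assumes "f \<in> borel_measurable M"
  shows "(\<lambda>x. f x powi n :: complex) \<in> borel_measurable M"
  unfolding power_int_def using assms by (cases "0 \<le> n") auto

lemma circle_powi: "cmod z = 1 \<Longrightarrow> z powi (int n) = z ^ n" "cmod z = 1 \<Longrightarrow> z powi (- int n) = cnj z ^ n"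
proof -
  assume z: "cmod z = 1"
  then have "inverse z = cnj z" using circle_mult_cnj[of z] by (intro inverse_unique) simp
  then show "z powi (- int n) = cnj z ^ n" by (simp add: power_int_minus power_inverse[symmetric])
qed simp

text \<open>The Fourier coefficient of index \<open>-k\<close> in the variable \<open>z\<close> of the sheared function.\<close>

definition fibre_coeff :: "(complex \<times> complex \<Rightarrow> complex) \<Rightarrow> nat \<Rightarrow> complex \<Rightarrow> complex" where
  "fibre_coeff \<phi> k l = (\<integral>z. \<phi> (shear (l, z)) * z ^ k \<partial>circle)"

lemma fourier_circle_unique:
  assumes f: "f \<in> Linf circle" and g: "g \<in> Linf circle" and eq: "\<And>n. fourier_circle f n = fourier_circle g n"
  shows "AE l in circle. f l = g l"
proof -
  have i: "integrable circle f" if "f \<in> Linf circle" for f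
    using that by (elim Linf_bound) (auto intro!: circle.integrable_of_square_integrable circle.square_integrable_bounded)
  have pos: "(\<integral>z. f z * z ^ n \<partial>circle) = fourier_circle f (- int n)" for f n
    unfolding fourier_circle_def by simp
  have neg: "(\<integral>z. f z * cnj z ^ n \<partial>circle) = fourier_circle f (int n)" for f n
    unfolding fourier_circle_def by (rule Lebesgue_cong) (auto simp: circle_powi)
  have "fourier_vanishes (\<lambda>z. f z - g z)"
    unfolding fourier_vanishes_def left_diff_distrib
    using i[OF f] i[OF g] by (simp add: circle_integrable_mult pos neg eq)
  from fourier_vanishes_AE_zero[OF this] show ?thesis by simp
qed

lemma
  assumes \<phi>: "\<phi> \<in> borel_measurable torus" and B: "AE x in torus. cmod (\<phi> x) \<le> B"
  shows fibre_coeff_measurable: "fibre_coeff \<phi> k \<in> borel_measurable circle"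
    and fibre_coeff_bound: "AE l in circle. cmod (fibre_coeff \<phi> k l) \<le> B"
    and fibre_coeff_fourier: "fourier_circle (fibre_coeff \<phi> k) n = fourier_torus \<phi> (- int k - n) n"
proof -
  note [measurable] = \<phi>
  have \<phi>s [measurable]: "(\<lambda>x. \<phi> (shear x)) \<in> borel_measurable torus" by measurable
  have m: "(\<lambda>x. \<phi> (shear x) * snd x ^ k) \<in> borel_measurable torus" by measurable
  show fm: "fibre_coeff \<phi> k \<in> borel_measurable circle"
    unfolding fibre_coeff_def using measurable_section_integral[OF m] by simp
  show "AE l in circle. cmod (fibre_coeff \<phi> k l) \<le> B"
    using torus_AE_section[OF AE_shear[OF B]] AE_space
  proof eventually_elim
    case (elim l)
    have "cmod (fibre_coeff \<phi> k l) \<le> (\<integral>z. cmod (\<phi> (shear (l, z)) * z ^ k) \<partial>circle)"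
      unfolding fibre_coeff_def by (rule integral_norm_bound)
    also have "\<dots> \<le> (\<integral>z. B \<partial>circle)"
    proof (rule integral_mono_AE)
      show le: "AE z in circle. cmod (\<phi> (shear (l, z)) * z ^ k) \<le> B"
        using elim(1) AE_circle_norm by eventually_elim (simp add: norm_mult norm_power)
      have ms: "(\<lambda>z. \<phi> (shear (l, z)) * z ^ k) \<in> borel_measurable circle"
        using measurable_section[OF m elim(2)] by simp
      show "integrable circle (\<lambda>z. cmod (\<phi> (shear (l, z)) * z ^ k))"
        by (intro integrable_norm circle.integrable_of_square_integrable circle.square_integrable_bounded[OF ms le])
    qed simp
    finally show ?case by simp
  qed
  define G where "G x = \<phi> x * fst x powi (int k + n) * snd x powi (- n)" for x
  have Gm [measurable]: "G \<in> borel_measurable torus" unfolding G_def by measurable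
  have int: "integrable torus (\<lambda>x. \<phi> (shear x) * snd x ^ k * fst x powi (- n))"
  proof (rule torus.integrable_of_square_integrable, rule torus.square_integrable_bounded)
    show "AE x in torus. cmod (\<phi> (shear x) * snd x ^ k * fst x powi (- n)) \<le> B"
      using AE_shear[OF B] torus_AE_norm
      by eventually_elim (simp add: norm_mult norm_power norm_power_int)
  qed measurable
  have "fourier_circle (fibre_coeff \<phi> k) n
      = (\<integral>l. (\<integral>z. \<phi> (shear (l, z)) * z ^ k * l powi (- n) \<partial>circle) \<partial>circle)"
    unfolding fourier_circle_def fibre_coeff_def by simp
  also have "\<dots> = (\<integral>x. \<phi> (shear x) * snd x ^ k * fst x powi (- n) \<partial>torus)"
    using torus_Fubini[OF int] by simp
  also have "\<dots> = (\<integral>x. G (shear x) \<partial>torus)"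
  proof (rule Lebesgue_cong)
    fix x assume "x \<in> space torus"
    then have "snd x \<noteq> 0" by auto
    moreover have "snd x powi (int k + n) = snd x ^ k * snd x powi n"
      using \<open>snd x \<noteq> 0\<close> by (simp add: power_int_add)
    moreover have "snd x powi n * snd x powi (- n) = 1"
      using \<open>snd x \<noteq> 0\<close> by (simp flip: power_int_add)
    ultimately show "\<phi> (shear x) * snd x ^ k * fst x powi (- n) = G (shear x)"
      by (simp add: G_def shear_def power_int_mult_distrib)
  qed simp
  also have "\<dots> = (\<integral>x. G x \<partial>torus)" by (rule integral_shear) measurable
  also have "\<dots> = fourier_torus \<phi> (- int k - n) n"
    unfolding fourier_torus_def G_def case_prod_unfold prod.collapse by (simp add: add.commute)
  finally show "fourier_circle (fibre_coeff \<phi> k) n = fourier_torus \<phi> (- int k - n) n" .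
qed

text \<open>The coefficients on the fibres satisfy the condition by which the slices are chosen, and by
  uniqueness of Fourier coefficients every choice agrees with them almost everywhere.\<close>

lemma slice_AE_eq_fibre_coeff:
  assumes \<phi>: "\<phi> \<in> Linf torus"
  shows "slice \<phi> (- int k) \<in> Linf circle" "AE l in circle. slice \<phi> (- int k) l = fibre_coeff \<phi> k l"
proof -
  obtain B where B: "AE x in torus. cmod (\<phi> x) \<le> B" "\<phi> \<in> borel_measurable torus"
    using \<phi> by (elim Linf_bound)
  have fc: "fibre_coeff \<phi> k \<in> Linf circle"
    by (rule LinfI[OF fibre_coeff_measurable[OF B(2,1)] fibre_coeff_bound[OF B(2,1)]])
  let ?P = "\<lambda>f. f \<in> Linf circle \<and> (\<forall>n. fourier_circle f n = fourier_torus \<phi> (- int k - n) n)"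
  have "?P (fibre_coeff \<phi> k)" using fc fibre_coeff_fourier[OF B(2,1)] by blast
  then have s: "?P (slice \<phi> (- int k))" unfolding slice_def by (rule someI[of ?P])
  then show "slice \<phi> (- int k) \<in> Linf circle" by blast
  show "AE l in circle. slice \<phi> (- int k) l = fibre_coeff \<phi> k l"
    by (rule fourier_circle_unique) (use s fc fibre_coeff_fourier[OF B(2,1)] in auto)
qed

section \<open>The Hankel operator acts fibrewise\<close>

text \<open>The operator picks a sum of each row; this makes the choice irrelevant.\<close>

lemma L2_sums_unique:
  assumes u: "\<And>j. square_integrable circle (u j)" and s: "L2_sums u s" and t: "L2_sums u t"
  shows "AE l in circle. s l = t l"
proof -
  define S where "S N l = (\<Sum>j<N. u j l)" for N l
  have S: "square_integrable circle (S N)" for N unfolding S_def by (rule square_integrable_sum) (rule u)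
  have sq: "square_integrable circle s" "square_integrable circle t" using s t by (auto simp: L2_sums_def L2_iff)
  have lim: "(\<lambda>N. L2sq circle (\<lambda>l. s l - S N l)) \<longlonglongrightarrow> 0" if "L2_sums u s" for s
  proof -
    have "square_integrable circle (\<lambda>l. s l - S N l)" for N
      using that S by (auto simp: L2_sums_def L2_iff intro: square_integrable_diff)
    then have "(\<lambda>N. ennreal (sqrt (L2sq circle (\<lambda>l. s l - S N l)))) \<longlonglongrightarrow> ennreal 0"
      using that by (simp add: L2_sums_def L2_norm_eq S_def)
    then have "(\<lambda>N. sqrt (L2sq circle (\<lambda>l. s l - S N l))) \<longlonglongrightarrow> 0"
      by (subst (asm) tendsto_ennreal_iff) auto
    from tendsto_power[OF this, of 2] show ?thesis by simp
  qed
  have le: "L2sq circle (\<lambda>l. s l - t l)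
      \<le> 2 * L2sq circle (\<lambda>l. s l - S N l) + 2 * L2sq circle (\<lambda>l. t l - S N l)" for N
  proof -
    note I = square_integrable_integrable[OF square_integrable_diff[OF sq(1) S[of N]]]
      square_integrable_integrable[OF square_integrable_diff[OF sq(2) S[of N]]]
    have "L2sq circle (\<lambda>l. s l - t l)
        \<le> (\<integral>l. 2 * (cmod (s l - S N l))\<^sup>2 + 2 * (cmod (t l - S N l))\<^sup>2 \<partial>circle)"
    proof (rule integral_mono)
      show "(cmod (s l - t l))\<^sup>2 \<le> 2 * (cmod (s l - S N l))\<^sup>2 + 2 * (cmod (t l - S N l))\<^sup>2" for l
        using cmod_add_power2_le[of "s l - S N l" "S N l - t l"] by (simp add: norm_minus_commute)
    qed (use I square_integrable_integrable[OF square_integrable_diff[OF sq]] in auto)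
    also have "\<dots> = 2 * L2sq circle (\<lambda>l. s l - S N l) + 2 * L2sq circle (\<lambda>l. t l - S N l)"
      using I by simp
    finally show ?thesis .
  qed
  have "(\<lambda>N. 2 * L2sq circle (\<lambda>l. s l - S N l) + 2 * L2sq circle (\<lambda>l. t l - S N l)) \<longlonglongrightarrow> 2 * 0 + 2 * 0"
    by (intro tendsto_intros lim s t)
  then have "L2sq circle (\<lambda>l. s l - t l) \<le> 2 * 0 + 2 * 0"
    by (rule LIMSEQ_le_const) (use le in auto)
  then have "L2sq circle (\<lambda>l. s l - t l) = 0"
    by (simp add: antisym)
  then show ?thesis
    using integral_nonneg_eq_0_iff_AE[OF square_integrable_integrable[OF square_integrable_diff[OF sq]]] by simp
qed

text \<open>For almost every \<open>l\<close> the operator applies the scalar Hankel matrix of the section to the vector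
  of the \<open>h j l\<close>.  Each row converges pointwise, and the squared tails are dominated by the tails of
  the squared norm of \<open>h\<close>, so it also converges in \<open>L\<^sup>2\<close>.\<close>

lemma
  assumes \<phi>: "\<phi> \<in> Linf torus" and h: "h \<in> L2l2"
  shows hankel_square_integrable: "square_integrable circle (hankel \<phi> h i)"
    and hankel_fibre: "AE l in circle. (\<lambda>j. fibre_coeff \<phi> (i + j + 1) l * h j l) sums hankel \<phi> h i l"
proof -
  obtain B where B0: "0 \<le> B" and B: "AE x in torus. cmod (\<phi> x) \<le> B" and \<phi>m [measurable]: "\<phi> \<in> borel_measurable torus"
    using \<phi> by (elim Linf_bound)
  have hs: "square_integrable circle (h j)" for j using h by (simp add: L2l2_iff)
  have sm: "summable (\<lambda>j. L2sq circle (h j))" using h by (simp add: L2l2_iff)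
  have hm [measurable]: "h j \<in> borel_measurable circle" for j using hs by (rule square_integrable_measurable)
  note fcm [measurable] = fibre_coeff_measurable[OF \<phi>m B]
  have idx: "- (int i + int j + 1) = - int (i + j + 1)" for j by simp
  define u where "u j l = slice \<phi> (- (int i + int j + 1)) l * h j l" for j l
  have u: "square_integrable circle (u j)" for j
  proof -
    have "slice \<phi> (- (int i + int j + 1)) \<in> Linf circle" unfolding idx by (rule slice_AE_eq_fibre_coeff(1)[OF \<phi>])
    then show ?thesis unfolding u_def by (elim Linf_bound) (rule square_integrable_bounded_mult[OF hs])
  qed
  have u_eq: "AE l in circle. \<forall>j. u j l = fibre_coeff \<phi> (i + j + 1) l * h j l"
    unfolding AE_all_countable
  proof
    fix j
    show "AE l in circle. u j l = fibre_coeff \<phi> (i + j + 1) l * h j l"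
      using slice_AE_eq_fibre_coeff(2)[OF \<phi>, of "i + j + 1"]
      by eventually_elim (simp only: u_def idx)
  qed
  define t where "t l = (\<Sum>j. fibre_coeff \<phi> (i + j + 1) l * h j l)" for l
  have tm [measurable]: "t \<in> borel_measurable circle" unfolding t_def by measurable
  have \<phi>s: "(\<lambda>x. \<phi> (shear x)) \<in> borel_measurable torus" by measurable
  have point: "AE l in circle. summable (\<lambda>j. fibre_coeff \<phi> (i + j + 1) l * h j l) \<and>
      (\<forall>N. (cmod (t l - (\<Sum>j<N. u j l)))\<^sup>2 \<le> B\<^sup>2 * (\<Sum>j. (cmod (h (j + N) l))\<^sup>2)) \<and> summable (\<lambda>j. (cmod (h j l))\<^sup>2)"
    using torus_AE_section[OF AE_shear[OF B]] L2l2_AE_summable[OF hs sm] u_eq AE_space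
  proof eventually_elim
    case (elim l)
    have ms: "(\<lambda>z. \<phi> (shear (l, z))) \<in> borel_measurable circle" by (rule measurable_section[OF \<phi>s elim(4)])
    show ?case
      using hankel_scalar_summable[OF ms elim(1,2), of i] hankel_scalar_tail[OF ms elim(1,2), of i] elim(2,3)
      by (simp add: t_def fibre_coeff_def)
  qed
  have tail_bound: "square_integrable circle (\<lambda>l. t l - (\<Sum>j<N. u j l)) \<and>
      L2sq circle (\<lambda>l. t l - (\<Sum>j<N. u j l)) \<le> B\<^sup>2 * (\<Sum>j. L2sq circle (\<lambda>l. h (j + N) l))" for N
  proof -
    have umeas [measurable]: "u j \<in> borel_measurable circle" for j using u by (rule square_integrable_measurable)
    have smN: "summable (\<lambda>j. L2sq circle (\<lambda>l. h (j + N) l))" by (rule summable_ignore_initial_segment[OF sm])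
    have "(\<integral>\<^sup>+l. ennreal ((cmod (t l - (\<Sum>j<N. u j l)))\<^sup>2) \<partial>circle)
        \<le> (\<integral>\<^sup>+l. ennreal (B\<^sup>2) * (\<Sum>j. ennreal ((cmod (h (j + N) l))\<^sup>2)) \<partial>circle)"
    proof (rule nn_integral_mono_AE)
      show "AE l in circle. ennreal ((cmod (t l - (\<Sum>j<N. u j l)))\<^sup>2) \<le> ennreal (B\<^sup>2) * (\<Sum>j. ennreal ((cmod (h (j + N) l))\<^sup>2))"
        using point
      proof eventually_elim
        case (elim l)
        then have "summable (\<lambda>j. (cmod (h (j + N) l))\<^sup>2)" by (intro summable_ignore_initial_segment) simp
        with elim show ?case
          by (simp add: suminf_ennreal2 suminf_nonneg ennreal_leI flip: ennreal_mult)
      qed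
    qed
    also have "\<dots> = ennreal (B\<^sup>2 * (\<Sum>j. L2sq circle (\<lambda>l. h (j + N) l)))"
      using L2l2_nn_integral[of "\<lambda>j. h (j + N)", OF hs smN] smN
      by (simp add: nn_integral_cmult ennreal_mult suminf_nonneg)
    finally have le: "(\<integral>\<^sup>+l. ennreal ((cmod (t l - (\<Sum>j<N. u j l)))\<^sup>2) \<partial>circle)
        \<le> ennreal (B\<^sup>2 * (\<Sum>j. L2sq circle (\<lambda>l. h (j + N) l)))" .
    then have sq: "square_integrable circle (\<lambda>l. t l - (\<Sum>j<N. u j l))"
      unfolding square_integrable_def
      by (auto intro!: integrableI_bounded intro: le_less_trans)
    moreover have "0 \<le> B\<^sup>2 * (\<Sum>j. L2sq circle (\<lambda>l. h (j + N) l))"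
      using smN by (simp add: suminf_nonneg)
    ultimately show ?thesis
      using le nn_integral_eq_integral[OF square_integrable_integrable[OF sq]] by simp
  qed
  have t: "L2_sums u t"
    unfolding L2_sums_def
  proof (intro conjI)
    show "t \<in> L2 circle" using tail_bound[of 0] by (simp add: L2_iff)
    have "(\<lambda>N. L2sq circle (\<lambda>l. t l - (\<Sum>j<N. u j l))) \<longlonglongrightarrow> 0"
    proof (rule tendsto_sandwich[OF _ _ tendsto_const])
      have "(\<lambda>N. B\<^sup>2 * (\<Sum>j. L2sq circle (\<lambda>l. h (j + N) l))) \<longlonglongrightarrow> B\<^sup>2 * 0"
        by (intro tendsto_intros suminf_exist_split2 sm)
      then show "(\<lambda>N. B\<^sup>2 * (\<Sum>j. L2sq circle (\<lambda>l. h (j + N) l))) \<longlonglongrightarrow> 0" by simp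
    qed (use tail_bound in auto)
    from tendsto_ennrealI[OF tendsto_real_sqrt[OF this]]
    show "(\<lambda>N. L2_norm circle (\<lambda>l. t l - (\<Sum>j<N. u j l))) \<longlonglongrightarrow> 0"
      using tail_bound by (simp add: L2_norm_eq)
  qed
  then have s: "L2_sums u (hankel \<phi> h i)"
    unfolding hankel_def u_def by (rule someI[of "L2_sums _"])
  then show "square_integrable circle (hankel \<phi> h i)" by (simp add: L2_sums_def L2_iff)
  show "AE l in circle. (\<lambda>j. fibre_coeff \<phi> (i + j + 1) l * h j l) sums hankel \<phi> h i l"
    using L2_sums_unique[OF u s t] point by eventually_elim (simp add: t_def summable_sums)
qed

section \<open>The norm of the Hankel operator is at most the distance\<close>

lemma L2l2_norm_power2:
  assumes "\<And>i. square_integrable circle (s i)"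
  shows "(\<Sum>i. (L2_norm circle (s i))\<^sup>2) = (\<integral>\<^sup>+l. (\<Sum>i. ennreal ((cmod (s i l))\<^sup>2)) \<partial>circle)"
proof -
  have [measurable]: "s i \<in> borel_measurable circle" for i using assms by (rule square_integrable_measurable)
  show ?thesis
    by (subst nn_integral_suminf) (auto simp: L2_norm_def ennreal_sqrt_power2 ennreal_power)
qed

lemma op_norm_hankel_le:
  assumes \<phi>: "\<phi> \<in> Linf torus"
  shows "op_norm (hankel \<phi>) \<le> Linf_norm torus \<phi>"
  unfolding op_norm_def
proof (rule SUP_least, clarify)
  fix h assume h: "h \<in> L2l2" and h1: "L2l2_norm h \<le> 1"
  obtain B where B0: "0 \<le> B" and LB: "Linf_norm torus \<phi> = ennreal B" and B: "AE x in torus. cmod (\<phi> x) \<le> B"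
    and \<phi>m [measurable]: "\<phi> \<in> borel_measurable torus"
    using \<phi> by (elim Linf_bound)
  have hs: "square_integrable circle (h j)" for j using h by (simp add: L2l2_iff)
  have sm: "summable (\<lambda>j. L2sq circle (h j))" using h by (simp add: L2l2_iff)
  have hm [measurable]: "h j \<in> borel_measurable circle" for j using hs by (rule square_integrable_measurable)
  have sum1: "(\<Sum>j. L2sq circle (h j)) \<le> 1"
    using h1 L2l2_norm_eq[OF h] suminf_nonneg[OF sm] by simp
  have \<phi>s: "(\<lambda>x. \<phi> (shear x)) \<in> borel_measurable torus" by measurable
  have sums: "AE l in circle. \<forall>i. (\<lambda>j. fibre_coeff \<phi> (i + j + 1) l * h j l) sums hankel \<phi> h i l"
    unfolding AE_all_countable using hankel_fibre[OF \<phi> h] by blast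
  have "(\<integral>\<^sup>+l. (\<Sum>i. ennreal ((cmod (hankel \<phi> h i l))\<^sup>2)) \<partial>circle)
      \<le> (\<integral>\<^sup>+l. ennreal (B\<^sup>2) * (\<Sum>j. ennreal ((cmod (h j l))\<^sup>2)) \<partial>circle)"
  proof (rule nn_integral_mono_AE)
    show "AE l in circle. (\<Sum>i. ennreal ((cmod (hankel \<phi> h i l))\<^sup>2)) \<le> ennreal (B\<^sup>2) * (\<Sum>j. ennreal ((cmod (h j l))\<^sup>2))"
      using torus_AE_section[OF AE_shear[OF B]] L2l2_AE_summable[OF hs sm] sums AE_space
    proof eventually_elim
      case (elim l)
      have ms: "(\<lambda>z. \<phi> (shear (l, z))) \<in> borel_measurable circle" by (rule measurable_section[OF \<phi>s elim(4)])
      have hk: "hankel \<phi> h i l = (\<Sum>j. (\<integral>z. \<phi> (shear (l, z)) * z ^ (i + j + 1) \<partial>circle) * h j l)" for i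
        using elim(3) by (simp add: fibre_coeff_def sums_iff)
      have le: "(\<Sum>i<n. (cmod (hankel \<phi> h i l))\<^sup>2) \<le> B\<^sup>2 * (\<Sum>j. (cmod (h j l))\<^sup>2)" for n
        unfolding hk by (rule hankel_scalar_bound[OF ms elim(1,2)])
      have "(\<Sum>i. ennreal ((cmod (hankel \<phi> h i l))\<^sup>2)) \<le> ennreal (B\<^sup>2 * (\<Sum>j. (cmod (h j l))\<^sup>2))"
        by (rule suminf_le_const) (use le in \<open>auto intro: ennreal_leI\<close>)
      then show ?case
        using elim(2) by (simp add: suminf_ennreal2 suminf_nonneg ennreal_mult)
    qed
  qed
  also have "\<dots> = ennreal (B\<^sup>2 * (\<Sum>j. L2sq circle (h j)))"
    using L2l2_nn_integral[OF hs sm] sm by (simp add: nn_integral_cmult ennreal_mult suminf_nonneg)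
  also have "\<dots> \<le> ennreal (B\<^sup>2)"
    using sum1 by (intro ennreal_leI) (simp add: mult_left_le)
  finally have "(\<Sum>i. (L2_norm circle (hankel \<phi> h i))\<^sup>2) \<le> ennreal (B\<^sup>2)"
    using L2l2_norm_power2[OF hankel_square_integrable[OF \<phi> h]] by simp
  from ennreal_sqrt_mono[OF this] show "L2l2_norm (hankel \<phi> h) \<le> Linf_norm torus \<phi>"
    using B0 by (simp add: L2l2_norm_def ennreal_sqrt_ennreal LB)
qed

text \<open>Only slices of negative index enter the operator, and those are chosen by conditions on Fourier
  coefficients to which elements of \<open>H1\<close> contribute nothing.\<close>

lemma hankel_diff_H1:
  assumes \<phi>: "\<phi> \<in> Linf torus" and g: "g \<in> H1"
  shows "hankel (\<lambda>x. \<phi> x - g x) = hankel \<phi>"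
proof -
  have gL: "g \<in> Linf torus" using g by (simp add: H1_def)
  have int: "integrable torus (\<lambda>x. f x * fst x powi m * snd x powi n)" if f: "f \<in> Linf torus" for f m n
  proof -
    obtain B where B: "AE x in torus. cmod (f x) \<le> B" and fm [measurable]: "f \<in> borel_measurable torus"
      using f by (elim Linf_bound)
    show ?thesis
    proof (rule torus.integrable_of_square_integrable, rule torus.square_integrable_bounded)
      show "AE x in torus. cmod (f x * fst x powi m * snd x powi n) \<le> B"
        using B torus_AE_norm by eventually_elim (simp add: norm_mult norm_power_int)
    qed measurable
  qed
  have "fourier_torus (\<lambda>x. \<phi> x - g x) m n = fourier_torus \<phi> m n" if "m + n < 0" for m n
  proof -
    have "fourier_torus (\<lambda>x. \<phi> x - g x) m n = fourier_torus \<phi> m n - fourier_torus g m n"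
      unfolding fourier_torus_def case_prod_unfold prod.collapse
      using int[OF \<phi>, of "- m" "- n"] int[OF gL, of "- m" "- n"] by (simp add: left_diff_distrib)
    with g that show ?thesis by (simp add: H1_def)
  qed
  then have "slice (\<lambda>x. \<phi> x - g x) (- (int i + int j + 1)) = slice \<phi> (- (int i + int j + 1))" for i j
    unfolding slice_def by simp
  then show ?thesis unfolding hankel_def by (intro ext) (simp only:)
qed

lemma op_norm_hankel_le_dist:
  assumes "\<phi> \<in> Linf torus"
  shows "op_norm (hankel \<phi>) \<le> dist_inf \<phi> H1"
  unfolding dist_inf_def
proof (rule INF_greatest)
  fix g assume g: "g \<in> H1"
  then have "(\<lambda>x. \<phi> x - g x) \<in> Linf torus" using assms by (intro Linf_diff) (auto simp: H1_def)
  from op_norm_hankel_le[OF this] show "op_norm (hankel \<phi>) \<le> Linf_norm torus (\<lambda>x. \<phi> x - g x)"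
    by (simp add: hankel_diff_H1[OF assms g])
qed

section \<open>The distance is at most the norm of the Hankel operator\<close>

text \<open>Multiplication by \<open>cnj z\<close> turns the positive frequencies of \<open>W\<close> into nonnegative ones, so the mean
  value of \<open>W g\<close> is a coefficient of negative index of a product of two analytic functions.\<close>

lemma hardy_orthogonal:
  assumes W: "W \<in> hardy 0" and g: "g \<in> hardy (Suc 0)"
  shows "(\<integral>x. W x * g x \<partial>torus) = 0"
proof -
  have int: "integrable torus (\<lambda>x. W x * g x)"
    using W g by (intro integrable_mult_square_integrable hardy_square_integrable)
  have "AE l in circle. (\<integral>z. W (l, z) * g (l, z) \<partial>circle) = 0"
    using hardy_sectionD[OF W] hardy_sectionD[OF g]
  proof eventually_elim
    case (elim l)
    have shift: "(\<integral>z. cnj z * W (l, z) * q z * z \<partial>circle) = (\<integral>z. W (l, z) * q z \<partial>circle)" for q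
      by (rule Lebesgue_cong) (use circle_mult_cnj in \<open>auto simp: mult_ac\<close>)
    have sW: "square_integrable circle (\<lambda>z. cnj z * W (l, z))"
      by (rule square_integrable_bounded_mult[where B = 1])
        (use elim AE_circle_norm in \<open>auto elim!: eventually_mono\<close>)
    have "(\<integral>z. cnj z * W (l, z) * z ^ k \<partial>circle) = 0" if "0 < k" for k
    proof -
      obtain m where k: "k = Suc m" using \<open>0 < k\<close> by (cases k) auto
      show ?thesis using shift[of "\<lambda>z. z ^ m"] elim by (simp add: k mult_ac)
    qed
    from analytic_product_vanishes[OF sW _ this, of "\<lambda>z. g (l, z)" 1] elim shift[of "\<lambda>z. g (l, z)"]
    show ?case by simp
  qed
  then have "(\<integral>l. (\<integral>z. W (l, z) * g (l, z) \<partial>circle) \<partial>circle) = 0"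
    by (rule integral_eq_zero_AE)
  with torus_Fubini[OF int] show ?thesis by simp
qed

text \<open>The norm of the operator bounds the bilinear form with symbol \<open>\<phi>\<close>.  The sections of \<open>H\<close> are expanded
  into the vector \<open>h\<close>; the operator maps it to the coefficients of negative index of \<open>\<phi> H\<close>, and a
  second expansion pairs these with the coefficients \<open>c\<close> of \<open>v\<close>.  The arithmetic-geometric mean
  inequality replaces the Cauchy--Schwarz inequality here; nothing is lost, since \<open>v\<close> can be rescaled
  in the application.\<close>

lemma hankel_form_bound:
  assumes \<phi>: "\<phi> \<in> Linf torus" and C: "0 \<le> C" "op_norm (hankel \<phi>) \<le> ennreal C"
    and H: "H \<in> hardy (Suc 0)" and H1: "L2sq torus H \<le> 1" and v: "v \<in> hardy 0"
  shows "2 * cmod (\<integral>x. v x * (\<phi> (shear x) * H x) \<partial>torus) \<le> L2sq torus v + C\<^sup>2"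
proof -
  obtain B where B: "AE x in torus. cmod (\<phi> x) \<le> B" and \<phi>m [measurable]: "\<phi> \<in> borel_measurable torus"
    using \<phi> by (elim Linf_bound)
  have \<phi>s: "(\<lambda>x. \<phi> (shear x)) \<in> borel_measurable torus" by measurable
  have Hs: "square_integrable torus H" and vs: "square_integrable torus v"
    using H v by (auto intro: hardy_square_integrable)
  have Hm [measurable]: "H \<in> borel_measurable torus" using Hs by (rule square_integrable_measurable)
  have \<phi>H: "square_integrable torus (\<lambda>x. \<phi> (shear x) * H x)"
    by (rule square_integrable_bounded_mult[OF Hs \<phi>s AE_shear[OF B]])
  define h where "h j l = (\<integral>z. H (l, z) * cnj z ^ j \<partial>circle)" for j l
  have hm [measurable]: "h j \<in> borel_measurable circle" for j
    unfolding h_def using measurable_section_integral[of "\<lambda>x. H x * cnj (snd x) ^ j"] by simp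
  have Bessel: "AE l in circle. \<forall>n. (\<Sum>j<n. (cmod (h j l))\<^sup>2) \<le> L2sq circle (\<lambda>z. H (l, z))"
    using torus_square_integrable_section[OF Hs]
    by eventually_elim (auto simp: h_def intro: Bessel_inequality)
  note Hi = square_integrable_integrable[OF Hs]
  have hs: "square_integrable circle (h j)" for j
  proof (rule square_integrable_bound[OF hm torus_integrable_section[OF Hi]])
    show "AE l in circle. (cmod (h j l))\<^sup>2 \<le> L2sq circle (\<lambda>z. H (l, z))"
      using Bessel
    proof eventually_elim
      case (elim l)
      have "(cmod (h j l))\<^sup>2 \<le> (\<Sum>j<Suc j. (cmod (h j l))\<^sup>2)" by (simp add: sum_nonneg)
      also have "\<dots> \<le> L2sq circle (\<lambda>z. H (l, z))" using elim by blast
      finally show ?case .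
    qed
  qed
  have partial: "(\<Sum>j<n. L2sq circle (h j)) \<le> 1" for n
  proof -
    have "(\<Sum>j<n. L2sq circle (h j)) = (\<integral>l. (\<Sum>j<n. (cmod (h j l))\<^sup>2) \<partial>circle)"
      using square_integrable_integrable[OF hs] by (subst Bochner_Integration.integral_sum) auto
    also have "\<dots> \<le> (\<integral>l. (L2sq circle (\<lambda>z. H (l, z))) \<partial>circle)"
      using square_integrable_integrable[OF hs] torus_integrable_section[OF Hi] Bessel
      by (intro integral_mono_AE) (auto elim!: eventually_mono)
    also have "\<dots> \<le> 1" using torus_Fubini[OF Hi] H1 by simp
    finally show ?thesis .
  qed
  have sm: "summable (\<lambda>j. L2sq circle (h j))"
    by (rule summableI_nonneg_bounded[OF _ partial]) simp
  have h: "h \<in> L2l2" using hs sm by (simp add: L2l2_iff)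
  have "(\<Sum>j. L2sq circle (h j)) \<le> 1" using sm partial by (rule suminf_le_const)
  then have "L2l2_norm h \<le> 1" by (simp add: L2l2_norm_eq[OF h])
  with h have "L2l2_norm (hankel \<phi> h) \<le> op_norm (hankel \<phi>)"
    unfolding op_norm_def by (intro SUP_upper) simp
  also note C(2)
  finally have "(L2l2_norm (hankel \<phi> h))\<^sup>2 \<le> (ennreal C)\<^sup>2"
    unfolding power2_eq_square by (intro mult_mono) auto
  then have sC: "(\<integral>\<^sup>+l. (\<Sum>i. ennreal ((cmod (hankel \<phi> h i l))\<^sup>2)) \<partial>circle) \<le> ennreal (C\<^sup>2)"
    using C(1) by (simp add: L2l2_norm_def ennreal_sqrt_power2 ennreal_power
        L2l2_norm_power2[OF hankel_square_integrable[OF \<phi> h]])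
  define X where "X l = (\<integral>z. v (l, z) * (\<phi> (shear (l, z)) * H (l, z)) \<partial>circle)" for l
  have sums: "AE l in circle. \<forall>i. (\<lambda>j. fibre_coeff \<phi> (i + j + 1) l * h j l) sums hankel \<phi> h i l"
    unfolding AE_all_countable using hankel_fibre[OF \<phi> h] by blast
  have point: "AE l in circle. ennreal (2 * cmod (X l))
      \<le> ennreal (L2sq circle (\<lambda>z. v (l, z))) + (\<Sum>i. ennreal ((cmod (hankel \<phi> h i l))\<^sup>2))"
    using sums hardy_sectionD[OF H] hardy_sectionD[OF v] torus_AE_section[OF AE_shear[OF B]]
      torus_square_integrable_section[OF \<phi>H] AE_space
  proof eventually_elim
    case (elim l)
    let ?\<phi> = "\<lambda>z. \<phi> (shear (l, z))" and ?H = "\<lambda>z. H (l, z)" and ?v = "\<lambda>z. v (l, z)"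
    have sH: "square_integrable circle ?H" and sv: "square_integrable circle ?v" using elim by auto
    have s\<phi>: "square_integrable circle ?\<phi>"
      by (rule circle.square_integrable_bounded[OF measurable_section[OF \<phi>s elim(6)] elim(4)])
    have power_mult: "square_integrable circle (\<lambda>z. z ^ k * f z)" if "square_integrable circle f" for f k
      by (rule square_integrable_bounded_mult[OF that, where B = 1])
        (use AE_circle_norm in \<open>auto simp: norm_power elim!: eventually_mono\<close>)
    have s: "hankel \<phi> h i l = (\<integral>z. z * (?\<phi> z * ?H z) * z ^ i \<partial>circle)" for i
    proof (rule sums_unique2)
      show "(\<lambda>j. fibre_coeff \<phi> (i + j + 1) l * h j l) sums hankel \<phi> h i l" using elim(1) by blast
      have "(\<lambda>j. (\<integral>z. ?H z * cnj z ^ j \<partial>circle) * (\<integral>z. z ^ (i + 1) * ?\<phi> z * z ^ j \<partial>circle))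
          sums (\<integral>z. z ^ (i + 1) * ?\<phi> z * ?H z \<partial>circle)"
        by (rule analytic_Parseval[OF sH _ power_mult[OF s\<phi>]]) (use elim in auto)
      then show "(\<lambda>j. fibre_coeff \<phi> (i + j + 1) l * h j l) sums (\<integral>z. z * (?\<phi> z * ?H z) * z ^ i \<partial>circle)"
        by (simp add: fibre_coeff_def h_def power_add mult_ac)
    qed
    define c where "c i = (\<integral>z. cnj z * ?v z * cnj z ^ i \<partial>circle)" for i
    have sq: "square_integrable circle (\<lambda>z. cnj z * ?v z)"
      by (rule square_integrable_bounded_mult[OF sv, where B = 1])
        (use AE_circle_norm in \<open>auto elim!: eventually_mono\<close>)
    have an: "(\<integral>z. cnj z * ?v z * z ^ k \<partial>circle) = 0" if "0 < k" for k
    proof -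
      obtain m where k: "k = Suc m" using \<open>0 < k\<close> by (cases k) auto
      have "(\<integral>z. cnj z * ?v z * z ^ k \<partial>circle) = (\<integral>z. ?v z * z ^ m \<partial>circle)"
        by (rule Lebesgue_cong) (use circle_mult_cnj in \<open>auto simp: k mult_ac\<close>)
      with elim show ?thesis by simp
    qed
    have s\<phi>H: "square_integrable circle (\<lambda>z. z * (?\<phi> z * ?H z))" using power_mult[OF elim(5), of 1] by simp
    have "(\<lambda>i. c i * hankel \<phi> h i l) sums (\<integral>z. z * (?\<phi> z * ?H z) * (cnj z * ?v z) \<partial>circle)"
      unfolding s c_def by (rule analytic_Parseval[OF sq an s\<phi>H])
    also have "(\<integral>z. z * (?\<phi> z * ?H z) * (cnj z * ?v z) \<partial>circle) = X l"
      unfolding X_def by (rule Lebesgue_cong) (use circle_mult_cnj in \<open>auto simp: mult_ac\<close>)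
    finally have lim: "(\<lambda>n. ennreal (2 * cmod (\<Sum>i<n. c i * hankel \<phi> h i l))) \<longlonglongrightarrow> ennreal (2 * cmod (X l))"
      unfolding sums_def by (intro tendsto_intros tendsto_ennrealI)
    show ?case
    proof (rule LIMSEQ_le_const2[OF lim], intro exI allI impI)
      fix n
      have "2 * cmod (\<Sum>i<n. c i * hankel \<phi> h i l) \<le> (\<Sum>i<n. 2 * (cmod (c i) * cmod (hankel \<phi> h i l)))"
        by (subst sum_distrib_left[symmetric]) (intro mult_left_mono order_trans[OF norm_sum], simp_all add: norm_mult)
      also have "\<dots> \<le> (\<Sum>i<n. (cmod (c i))\<^sup>2 + (cmod (hankel \<phi> h i l))\<^sup>2)"
        by (intro sum_mono) (use sum_squares_bound in \<open>simp add: mult.assoc\<close>)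
      also have "\<dots> = (\<Sum>i<n. (cmod (c i))\<^sup>2) + (\<Sum>i<n. (cmod (hankel \<phi> h i l))\<^sup>2)"
        by (rule sum.distrib)
      also have "(\<Sum>i<n. (cmod (c i))\<^sup>2) \<le> L2sq circle (\<lambda>z. cnj z * ?v z)"
        unfolding c_def by (rule Bessel_inequality[OF sq]) simp
      also have "L2sq circle (\<lambda>z. cnj z * ?v z) = L2sq circle ?v"
        by (rule Lebesgue_cong) (auto simp: norm_mult)
      finally have "ennreal (2 * cmod (\<Sum>i<n. c i * hankel \<phi> h i l))
          \<le> ennreal (L2sq circle ?v) + (\<Sum>i<n. ennreal ((cmod (hankel \<phi> h i l))\<^sup>2))"
        by (simp add: sum_nonneg ennreal_leI flip: ennreal_plus)
      also have "\<dots> \<le> ennreal (L2sq circle ?v) + (\<Sum>i. ennreal ((cmod (hankel \<phi> h i l))\<^sup>2))"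
        by (intro add_left_mono sum_le_suminf) auto
      finally show "ennreal (2 * cmod (\<Sum>i<n. c i * hankel \<phi> h i l))
          \<le> ennreal (L2sq circle ?v) + (\<Sum>i. ennreal ((cmod (hankel \<phi> h i l))\<^sup>2))" .
    qed
  qed
  have tot: "integrable torus (\<lambda>x. v x * (\<phi> (shear x) * H x))"
    by (rule integrable_mult_square_integrable[OF vs \<phi>H])
  have Xi: "integrable circle X" unfolding X_def using torus_integrable_section[OF tot] by simp
  note vi = square_integrable_integrable[OF vs]
  have [measurable]: "hankel \<phi> h i \<in> borel_measurable circle" for i
    using hankel_square_integrable[OF \<phi> h] by (rule square_integrable_measurable)
  have "ennreal (2 * cmod (\<integral>x. v x * (\<phi> (shear x) * H x) \<partial>torus)) = ennreal (2 * cmod (\<integral>l. X l \<partial>circle))"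
    using torus_Fubini[OF tot] by (simp add: X_def)
  also have "\<dots> \<le> ennreal (\<integral>l. 2 * cmod (X l) \<partial>circle)"
    using integral_norm_bound[of circle X] by (intro ennreal_leI) simp
  also have "\<dots> = (\<integral>\<^sup>+l. ennreal (2 * cmod (X l)) \<partial>circle)"
    by (rule nn_integral_eq_integral[symmetric]) (use Xi in auto)
  also have "\<dots> \<le> (\<integral>\<^sup>+l. ennreal (L2sq circle (\<lambda>z. v (l, z))) + (\<Sum>i. ennreal ((cmod (hankel \<phi> h i l))\<^sup>2)) \<partial>circle)"
    by (rule nn_integral_mono_AE[OF point])
  also have "\<dots> = (\<integral>\<^sup>+l. ennreal (L2sq circle (\<lambda>z. v (l, z))) \<partial>circle)
      + (\<integral>\<^sup>+l. (\<Sum>i. ennreal ((cmod (hankel \<phi> h i l))\<^sup>2)) \<partial>circle)"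
    by (rule nn_integral_add) (use borel_measurable_integrable[OF torus_integrable_section[OF vi]] in measurable)
  also have "(\<integral>\<^sup>+l. ennreal (L2sq circle (\<lambda>z. v (l, z))) \<partial>circle) = ennreal (L2sq torus v)"
    using nn_integral_eq_integral[OF torus_integrable_section[OF vi]] torus_Fubini[OF vi] by simp
  also have "ennreal (L2sq torus v) + (\<integral>\<^sup>+l. (\<Sum>i. ennreal ((cmod (hankel \<phi> h i l))\<^sup>2)) \<partial>circle)
      \<le> ennreal ((L2sq torus v) + C\<^sup>2)"
    using sC by (simp add: add_left_mono)
  finally show ?thesis by (subst (asm) ennreal_le_iff) auto
qed

definition unit_clamp :: "real \<Rightarrow> real" where
  "unit_clamp y = max 0 (min 1 y)"

text \<open>The primitive of \<open>unit_clamp\<close> that vanishes on the negative half line: quadratic near zero, then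
  linear.  It measures by how much \<open>\<bar>\<Phi> - g\<bar>\<^sup>2\<close> exceeds a threshold, and its bounded Lipschitz derivative is
  what the variational principle asks for.\<close>

definition huber :: "real \<Rightarrow> real" where
  "huber y = unit_clamp y * y - (unit_clamp y)\<^sup>2 / 2"

lemma unit_clamp_bounds: "0 \<le> unit_clamp y" "unit_clamp y \<le> 1" by (auto simp: unit_clamp_def)

text \<open>The defining expression is the maximum of \<open>a y - a\<^sup>2 / 2\<close> over \<open>a\<close> in the unit interval, attained at
  \<open>unit_clamp y\<close>; this yields the subgradient inequality.\<close>

lemma huber_max:
  assumes "0 \<le> a" "a \<le> 1"
  shows "a * y - a\<^sup>2 / 2 \<le> huber y"
proof -
  have "0 \<le> (unit_clamp y - a) * (y - (unit_clamp y + a) / 2)"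
  proof -
    consider "y \<le> 0" | "0 < y" "y < 1" | "1 \<le> y" by linarith
    then show ?thesis
    proof cases
      case 1
      then show ?thesis using assms by (auto simp: unit_clamp_def intro!: mult_nonneg_nonpos)
    next
      case 2
      then have "(unit_clamp y - a) * (y - (unit_clamp y + a) / 2) = (y - a)\<^sup>2 / 2"
        by (simp add: unit_clamp_def power2_eq_square field_simps)
      then show ?thesis by (simp only:) simp
    qed (use assms in \<open>auto simp: unit_clamp_def intro!: mult_nonneg_nonneg mult_nonpos_nonpos\<close>)
  qed
  then show ?thesis by (simp add: huber_def power2_eq_square field_simps)
qed

lemma huber_lower: "huber y + unit_clamp y * (y' - y) \<le> huber y'"
  using huber_max[OF unit_clamp_bounds, of y y'] by (simp add: huber_def algebra_simps)

lemma huber_upper: "huber y' \<le> huber y + unit_clamp y * (y' - y) + (y' - y)\<^sup>2"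
proof -
  have "huber y' \<le> huber y + unit_clamp y' * (y' - y)"
    using huber_lower[of y' y] by (simp add: algebra_simps)
  moreover have "(unit_clamp y' - unit_clamp y) * (y' - y) \<le> \<bar>y' - y\<bar> * \<bar>y' - y\<bar>"
    by (rule order_trans[OF abs_ge_self], subst abs_mult, rule mult_right_mono) (auto simp: unit_clamp_def)
  ultimately show ?thesis by (simp add: power2_eq_square algebra_simps)
qed

lemma huber_nonneg: "0 \<le> huber y" using huber_max[of 0 y] by simp

lemma huber_nonpos: "y \<le> 0 \<Longrightarrow> huber y = 0" by (simp add: huber_def unit_clamp_def)

lemma huber_le: "huber y \<le> unit_clamp y * y" by (simp add: huber_def)

lemma huber_eq_0: "huber y = 0 \<Longrightarrow> y \<le> 0"
proof (rule ccontr)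
  assume *: "huber y = 0" "\<not> y \<le> 0"
  define a where "a = min 1 y"
  have a: "0 < a" "a \<le> 1" "a \<le> y" using * by (auto simp: a_def)
  have "a * a \<le> a * y" using a by (intro mult_left_mono) auto
  moreover have "a * y - a\<^sup>2 / 2 \<le> 0" using huber_max[of a y] a * by simp
  moreover have "0 < a * a" using a by simp
  ultimately show False by (simp add: power2_eq_square)
qed

lemma continuous_huber: "continuous_on UNIV huber"
  unfolding huber_def unit_clamp_def by (auto intro!: continuous_intros)

lemma huber_measurable [measurable]: "huber \<in> borel_measurable borel"
  and unit_clamp_measurable [measurable]: "unit_clamp \<in> borel_measurable borel"
  by (auto intro!: borel_measurable_continuous_onI continuous_huber continuous_intros simp: unit_clamp_def[abs_def])

text \<open>Let \<open>g\<close> minimize the integral of \<open>\<epsilon> s + huber (s - D)\<close> at \<open>s = \<bar>e\<bar>\<^sup>2\<close>, where \<open>e = \<Phi> - g\<close> and \<open>D = C\<^sup>2\<close>.  Then \<open>g\<close> is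
  the best approximation of \<open>\<Phi>\<close> for the weight \<open>w = \<epsilon> + unit_clamp (s - D)\<close>.  Factor \<open>w = \<bar>h\<bar>\<^sup>2\<close>.  The
  function \<open>v = cnj (h e)\<close> has positive frequencies only, so it sees just the part of \<open>h \<Phi>\<close> that the Hankel
  operator produces from \<open>h\<close>.  This gives \<open>\<parallel>h e\<parallel>\<^sup>2 \<le> C \<parallel>h\<parallel> \<parallel>h e\<parallel>\<close>, that is, the integral of
  \<open>w (\<bar>e\<bar>\<^sup>2 - D)\<close> is at most zero.  Where \<open>\<bar>e\<bar>\<^sup>2 < D\<close> the weight is just \<open>\<epsilon>\<close>, so the excess of \<open>\<bar>e\<bar>\<^sup>2\<close> over
  \<open>D\<close> is small.\<close>

lemma nearly_optimal_approximant:
  assumes \<phi>: "\<phi> \<in> Linf torus" and C: "0 \<le> C" "op_norm (hankel \<phi>) \<le> ennreal C"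
    and \<epsilon>: "0 < \<epsilon>" "\<epsilon> \<le> 1"
  obtains g where "g \<in> hardy (Suc 0)"
    "(\<integral>x. huber ((cmod (\<phi> (shear x) - g x))\<^sup>2 - C\<^sup>2) \<partial>torus) \<le> \<epsilon> * C\<^sup>2"
    "L2sq torus (\<lambda>x. \<phi> (shear x) - g x) \<le> 2 * C\<^sup>2 + 1"
proof -
  obtain B where B: "AE x in torus. cmod (\<phi> x) \<le> B" and \<phi>m [measurable]: "\<phi> \<in> borel_measurable torus"
    using \<phi> by (elim Linf_bound)
  define \<Phi> where "\<Phi> x = \<phi> (shear x)" for x
  have \<Phi>m [measurable]: "\<Phi> \<in> borel_measurable torus" unfolding \<Phi>_def by measurable
  have \<Phi>B: "AE x in torus. cmod (\<Phi> x) \<le> B" unfolding \<Phi>_def by (rule AE_shear[OF B])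
  have \<Phi>s: "square_integrable torus \<Phi>" by (rule torus.square_integrable_bounded[OF \<Phi>m \<Phi>B])
  define D where "D = C\<^sup>2"
  have D: "0 \<le> D" by (simp add: D_def)
  obtain g where g: "g \<in> hardy (Suc 0)"
    and opt: "\<And>f B. f \<in> hardy (Suc 0) \<Longrightarrow> AE x in torus. cmod (f x) \<le> B \<Longrightarrow>
       (\<integral>x. of_real (\<epsilon> + unit_clamp ((cmod (\<Phi> x - g x))\<^sup>2 - D)) * cnj (\<Phi> x - g x) * f x \<partial>torus) = 0"
  proof (rule torus.variational_principle[where K = "hardy (Suc 0)" and \<Phi> = \<Phi> and c = \<epsilon> and b = "\<epsilon> + 1"
        and \<theta> = "\<lambda>x s. \<epsilon> * s + huber (s - D)" and \<theta>' = "\<lambda>x s. \<epsilon> + unit_clamp (s - D)"])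
    show "g \<in> hardy (Suc 0)" if "\<And>n. s n \<in> hardy (Suc 0)" "square_integrable torus g"
      "(\<lambda>n. L2sq torus (\<lambda>x. s n x - g x)) \<longlonglongrightarrow> 0" for s g
      using that by (rule hardy_closed)
    show "\<epsilon> * s + huber (s - D) + (\<epsilon> + unit_clamp (s - D)) * (t - s) \<le> \<epsilon> * t + huber (t - D)" for s t
      using huber_lower[of "s - D" "t - D"] by (simp add: algebra_simps)
    show "\<epsilon> * t + huber (t - D) \<le> \<epsilon> * s + huber (s - D) + (\<epsilon> + unit_clamp (s - D)) * (t - s) + (t - s)\<^sup>2" for s t
      using huber_upper[of "t - D" "s - D"] by (simp add: algebra_simps)
  qed (use \<epsilon> D \<Phi>s unit_clamp_bounds in \<open>auto simp: hardy_zero hardy_add hardy_cmult hardy_square_integrable huber_nonpos\<close>)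
  define e where "e x = \<Phi> x - g x" for x
  have gs: "square_integrable torus g" using g by (rule hardy_square_integrable)
  have es: "square_integrable torus e" unfolding e_def by (rule square_integrable_diff[OF \<Phi>s gs])
  have em [measurable]: "e \<in> borel_measurable torus" using es by (rule square_integrable_measurable)
  define w where "w x = \<epsilon> + unit_clamp ((cmod (e x))\<^sup>2 - D)" for x
  have w: "\<epsilon> \<le> w x" "w x \<le> \<epsilon> + 1" "0 < w x" for x
    using unit_clamp_bounds[of "(cmod (e x))\<^sup>2 - D"] \<epsilon> by (auto simp: w_def)
  have wm [measurable]: "w \<in> borel_measurable torus" unfolding w_def by measurable
  define W where "W x = of_real (w x) * cnj (e x)" for x
  have Ws: "square_integrable torus W"
    unfolding W_def by (rule square_integrable_bounded_mult[OF square_integrable_cnj[OF es], where B = "\<epsilon> + 1"])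
      (use w in \<open>auto simp: abs_of_pos\<close>)
  have Wm [measurable]: "W \<in> borel_measurable torus" using Ws by (rule square_integrable_measurable)
  obtain h h' where h: "h \<in> hardy (Suc 0)" and h': "h' \<in> hardy (Suc 0)"
    and hw: "AE x in torus. (cmod (h x))\<^sup>2 = w x" and hh': "AE x in torus. h x * h' x = 1"
    by (rule outer_factorization[OF wm \<epsilon>(1)]) (use w in auto)
  have hm [measurable]: "h \<in> borel_measurable torus" "h' \<in> borel_measurable torus"
    using h h' by (auto intro: hardy_square_integrable square_integrable_measurable)
  have h'_eq: "AE x in torus. of_real (w x) * h' x = cnj (h x) \<and> (cmod (h' x))\<^sup>2 \<le> 1 / \<epsilon>"
    using hw hh'
  proof eventually_elim
    case (elim x)
    have "of_real (w x) * h' x = cnj (h x) * (h x * h' x)"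
      using elim(1) complex_norm_square[of "h x"] by (simp add: mult_ac)
    moreover have "w x * (cmod (h' x))\<^sup>2 = (cmod (h x * h' x))\<^sup>2"
      using elim(1) by (simp add: norm_mult power_mult_distrib)
    then have "(cmod (h' x))\<^sup>2 = 1 / w x" using elim(2) w(3)[of x] by (simp add: field_simps)
    then have "(cmod (h' x))\<^sup>2 \<le> 1 / \<epsilon>" using w(1)[of x] \<epsilon> by (simp add: frac_le)
    ultimately show ?case using elim(2) by simp
  qed
  have test: "(\<lambda>x. W x * q x) \<in> hardy 0"
    if q: "q \<in> hardy (Suc 0)" and qB: "AE x in torus. cmod (q x) \<le> b"
      for q b
    unfolding hardy_iff_test
  proof (intro conjI allI impI ballI)
    have qm: "q \<in> borel_measurable torus" using q by (auto intro: hardy_square_integrable square_integrable_measurable)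
    show "square_integrable torus (\<lambda>x. W x * q x)"
      using square_integrable_bounded_mult[OF Ws qm qB] by (simp add: mult.commute)
    fix k a assume a: "a \<in> borel_measurable circle" "\<forall>l. cmod (a l) \<le> 1"
    have f: "(\<lambda>x. a (fst x) * snd x ^ k * q x) \<in> hardy (Suc 0)"
      by (rule hardy_monomial_mult[OF q a(1), where B = 1]) (use a in auto)
    have "AE x in torus. cmod (a (fst x) * snd x ^ k * q x) \<le> b"
      using qB torus_AE_norm
    proof eventually_elim
      case (elim x)
      have "cmod (a (fst x) * snd x ^ k * q x) = cmod (a (fst x)) * cmod (q x)"
        using elim by (simp add: norm_mult norm_power)
      also have "\<dots> \<le> 1 * b" using elim a by (intro mult_mono) auto
      finally show ?case by simp
    qed
    from opt[OF f this] show "(\<integral>x. a (fst x) * snd x ^ k * (W x * q x) \<partial>torus) = 0"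
      by (simp add: W_def w_def e_def mult_ac)
  qed
  have W0: "W \<in> hardy 0" using test[OF hardy_const[of 1], of 1] by simp
  define v where "v x = W x * h' x" for x
  have v: "v \<in> hardy 0"
    unfolding v_def
  proof (rule test[OF h'])
    show "AE x in torus. cmod (h' x) \<le> sqrt (1 / \<epsilon>)"
      using h'_eq by eventually_elim (auto intro: real_le_rsqrt)
  qed
  have v_eq: "AE x in torus. v x = cnj (e x) * cnj (h x)"
    using h'_eq by eventually_elim (auto simp: v_def W_def mult_ac)
  define E where "E = (\<integral>x. w x * (cmod (e x))\<^sup>2 \<partial>torus)"
  define m where "m = (\<integral>x. w x \<partial>torus)"
  have wi: "integrable torus w"
    by (rule torus.integrable_const_bound[where B = "\<epsilon> + 1"]) (use w in \<open>auto simp: abs_of_pos\<close>)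
  have wei: "integrable torus (\<lambda>x. w x * (cmod (e x))\<^sup>2)"
  proof (rule Bochner_Integration.integrable_bound)
    show "integrable torus (\<lambda>x. (\<epsilon> + 1) * (cmod (e x))\<^sup>2)"
      by (intro integrable_mult_right square_integrable_integrable es)
  qed (use w \<epsilon> in \<open>auto simp: abs_mult abs_of_pos intro!: mult_right_mono\<close>)
  have m: "0 < m"
  proof -
    have "\<epsilon> = (\<integral>x. \<epsilon> \<partial>torus)" using torus.prob_space by simp
    also have "\<dots> \<le> m" unfolding m_def using wi w by (intro integral_mono) auto
    finally show ?thesis using \<epsilon> by linarith
  qed
  \<comment> \<open>H has norm one; with v scaled by the same factor the bilinear bound compares E / m with itself\<close>
  define H where "H x = of_real (1 / sqrt m) * h x" for x
  define v' where "v' x = of_real (1 / sqrt m) * v x" for x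
  have scale: "(cmod (of_real (1 / sqrt m) * z))\<^sup>2 = (cmod z)\<^sup>2 / m" for z
    using m by (simp add: norm_mult norm_divide power_mult_distrib power_divide)
  have norm_H: "L2sq torus H \<le> 1"
  proof -
    have "L2sq torus h = m"
      unfolding m_def by (rule integral_cong_AE) (use hw in measurable)
    then show ?thesis using m unfolding H_def scale by simp
  qed
  have norm_v: "L2sq torus v' = E / m"
  proof -
    have "L2sq torus v = E"
      unfolding E_def
    proof (rule integral_cong_AE)
      show "AE x in torus. (cmod (v x))\<^sup>2 = w x * (cmod (e x))\<^sup>2"
        using v_eq hw by eventually_elim (simp add: norm_mult power_mult_distrib mult_ac)
    qed (auto simp: v_def)
    then show ?thesis unfolding v'_def scale by simp
  qed
  have "(\<integral>x. v' x * (\<phi> (shear x) * H x) \<partial>torus) = of_real (E / m)"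
  proof -
    have "(\<integral>x. v' x * (\<phi> (shear x) * H x) \<partial>torus)
        = (\<integral>x. (W x * e x + W x * g x) * of_real (1 / m) \<partial>torus)"
    proof (rule integral_cong_AE)
      show "AE x in torus. v' x * (\<phi> (shear x) * H x) = (W x * e x + W x * g x) * of_real (1 / m)"
        using hh'
      proof eventually_elim
        case (elim x)
        have "of_real (1 / sqrt m) * of_real (1 / sqrt m) = complex_of_real (1 / m)"
          using m by (simp del: of_real_divide flip: of_real_mult)
        moreover have "v x * h x = W x" using elim by (simp add: v_def mult_ac)
        moreover have "v' x * (\<phi> (shear x) * H x)
            = (v x * h x) * \<Phi> x * (of_real (1 / sqrt m) * of_real (1 / sqrt m))"
          unfolding v'_def H_def \<Phi>_def by (simp only: mult_ac)
        moreover have "\<Phi> x = e x + g x" by (simp add: e_def)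
        ultimately show ?case by (simp add: distrib_left)
      qed
      show "(\<lambda>x. v' x * (\<phi> (shear x) * H x)) \<in> borel_measurable torus"
        unfolding v'_def H_def v_def by measurable
      show "(\<lambda>x. (W x * e x + W x * g x) * complex_of_real (1 / m)) \<in> borel_measurable torus"
        using square_integrable_measurable[OF gs] by measurable
    qed
    also have "\<dots> = ((\<integral>x. W x * e x \<partial>torus) + (\<integral>x. W x * g x \<partial>torus)) * of_real (1 / m)"
      using integrable_mult_square_integrable[OF Ws es] integrable_mult_square_integrable[OF Ws gs]
      by simp
    also have "(\<integral>x. W x * g x \<partial>torus) = 0" by (rule hardy_orthogonal[OF W0 g])
    also have "(\<integral>x. W x * e x \<partial>torus) = of_real E"
    proof -
      have "W x * e x = of_real (w x * (cmod (e x))\<^sup>2)" for x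
        by (simp only: W_def complex_norm_square of_real_mult) (simp add: mult_ac)
      then show ?thesis unfolding E_def by (simp only: integral_complex_of_real)
    qed
    finally show ?thesis by simp
  qed
  then have "2 * \<bar>E / m\<bar> \<le> E / m + C\<^sup>2"
    using hankel_form_bound[OF \<phi> C _ norm_H, of v'] hardy_cmult[OF h] hardy_cmult[OF v] norm_v
    by (simp add: H_def[abs_def] v'_def[abs_def] del: of_real_divide)
  then have "E \<le> D * m" using m by (simp add: D_def field_simps abs_if split: if_splits)
  have hub: "(\<lambda>x. huber ((cmod (e x))\<^sup>2 - D)) \<in> borel_measurable torus" by measurable
  have hub_le: "huber ((cmod (e x))\<^sup>2 - D) \<le> w x * (cmod (e x))\<^sup>2 - D * w x + \<epsilon> * D" for x
  proof -
    have "w x * (cmod (e x))\<^sup>2 - D * w x + \<epsilon> * D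
        = \<epsilon> * (cmod (e x))\<^sup>2 + unit_clamp ((cmod (e x))\<^sup>2 - D) * ((cmod (e x))\<^sup>2 - D)"
      by (simp add: w_def algebra_simps)
    moreover have "0 \<le> \<epsilon> * (cmod (e x))\<^sup>2" using \<epsilon> by simp
    ultimately show ?thesis using huber_le[of "(cmod (e x))\<^sup>2 - D"] by linarith
  qed
  have hubi: "integrable torus (\<lambda>x. huber ((cmod (e x))\<^sup>2 - D))"
  proof (rule Bochner_Integration.integrable_bound[OF _ hub])
    show "integrable torus (\<lambda>x. w x * (cmod (e x))\<^sup>2 - D * w x + \<epsilon> * D)" using wi wei by simp
    have "norm (huber ((cmod (e x))\<^sup>2 - D)) \<le> norm (w x * (cmod (e x))\<^sup>2 - D * w x + \<epsilon> * D)" for x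
      using order_trans[OF hub_le[of x] abs_ge_self] huber_nonneg by simp
    then show "AE x in torus. norm (huber ((cmod (e x))\<^sup>2 - D)) \<le> norm (w x * (cmod (e x))\<^sup>2 - D * w x + \<epsilon> * D)"
      by simp
  qed
  have "(\<integral>x. huber ((cmod (e x))\<^sup>2 - D) \<partial>torus) \<le> (\<integral>x. w x * (cmod (e x))\<^sup>2 - D * w x + \<epsilon> * D \<partial>torus)"
    by (rule integral_mono) (use hubi wi wei hub_le in auto)
  also have "\<dots> = E - D * m + \<epsilon> * D" using wi wei torus.prob_space by (simp add: E_def m_def)
  finally have hub_int: "(\<integral>x. huber ((cmod (e x))\<^sup>2 - D) \<partial>torus) \<le> \<epsilon> * D" using \<open>E \<le> D * m\<close> by linarith
  have "L2sq torus e \<le> (\<integral>x. huber ((cmod (e x))\<^sup>2 - D) + (D + 1 / 2) \<partial>torus)"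
  proof (rule integral_mono)
    fix x
    show "(cmod (e x))\<^sup>2 \<le> huber ((cmod (e x))\<^sup>2 - D) + (D + 1 / 2)"
      using huber_max[of 1 "(cmod (e x))\<^sup>2 - D"] by simp
  qed (use hubi es in \<open>auto intro: square_integrable_integrable\<close>)
  also have "\<dots> = (\<integral>x. huber ((cmod (e x))\<^sup>2 - D) \<partial>torus) + (D + 1 / 2)"
    using hubi torus.prob_space by simp
  also have "\<dots> \<le> 2 * D + 1"
    using hub_int mult_right_mono[OF \<epsilon>(2) D] by linarith
  finally have norm_e: "L2sq torus e \<le> 2 * D + 1" .
  show ?thesis
    by (rule that[OF g]) (use hub_int norm_e in \<open>simp_all add: e_def[abs_def] \<Phi>_def[abs_def] D_def\<close>)
qed

text \<open>The sets of analytic \<open>g\<close> whose excess is at most \<open>C\<^sup>2 / (n + 1)\<close> are convex, decreasing and, by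
  \<open>nearly_optimal_approximant\<close>, nonempty with a uniform bound.  A limit of their elements has excess zero.\<close>

lemma optimal_approximant:
  assumes \<phi>: "\<phi> \<in> Linf torus" and C: "0 \<le> C" "op_norm (hankel \<phi>) \<le> ennreal C"
  obtains g where "g \<in> hardy (Suc 0)" "AE x in torus. cmod (\<phi> (shear x) - g x) \<le> C"
proof -
  obtain B where B: "AE x in torus. cmod (\<phi> x) \<le> B" and \<phi>m [measurable]: "\<phi> \<in> borel_measurable torus"
    using \<phi> by (elim Linf_bound)
  define \<Phi> where "\<Phi> x = \<phi> (shear x)" for x
  have \<Phi>m [measurable]: "\<Phi> \<in> borel_measurable torus" unfolding \<Phi>_def by measurable
  have \<Phi>s: "square_integrable torus \<Phi>"
    by (rule torus.square_integrable_bounded[OF \<Phi>m]) (unfold \<Phi>_def, rule AE_shear[OF B])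
  define J where "J g = (\<integral>x. huber ((cmod (\<Phi> x - g x))\<^sup>2 - C\<^sup>2) \<partial>torus)" for g
  have J_int: "integrable torus (\<lambda>x. huber ((cmod (\<Phi> x - g x))\<^sup>2 - C\<^sup>2))" if g: "square_integrable torus g" for g
  proof (rule Bochner_Integration.integrable_bound)
    have [measurable]: "g \<in> borel_measurable torus" using g by (rule square_integrable_measurable)
    show "(\<lambda>x. huber ((cmod (\<Phi> x - g x))\<^sup>2 - C\<^sup>2)) \<in> borel_measurable torus" by measurable
    show "integrable torus (\<lambda>x. (cmod (\<Phi> x - g x))\<^sup>2)"
      by (rule square_integrable_integrable[OF square_integrable_diff[OF \<Phi>s g]])
    have "huber (s - C\<^sup>2) \<le> s" if "0 \<le> s" for s
    proof (cases "s \<le> C\<^sup>2")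
      case False
      then have "unit_clamp (s - C\<^sup>2) * (s - C\<^sup>2) \<le> 1 * (s - C\<^sup>2)"
        using unit_clamp_bounds by (intro mult_right_mono) auto
      from order_trans[OF huber_le this] show ?thesis
        by (rule order_trans) simp
    qed (use that in \<open>simp add: huber_nonpos\<close>)
    then show "AE x in torus. norm (huber ((cmod (\<Phi> x - g x))\<^sup>2 - C\<^sup>2)) \<le> norm ((cmod (\<Phi> x - g x))\<^sup>2)"
      by (simp add: huber_nonneg)
  qed
  define \<delta> where "\<delta> n = 1 / real (Suc n)" for n
  have \<delta>: "0 < \<delta> n" "\<delta> n \<le> 1" for n by (auto simp: \<delta>_def)
  define A where "A n = {g \<in> hardy (Suc 0). J g \<le> \<delta> n * C\<^sup>2}" for n
  have "\<exists>f\<in>A n. L2sq torus f \<le> 2 * L2sq torus \<Phi> + 2 * (2 * C\<^sup>2 + 1)" for n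
  proof -
    obtain g where g: "g \<in> hardy (Suc 0)" "J g \<le> \<delta> n * C\<^sup>2"
      "L2sq torus (\<lambda>x. \<Phi> x - g x) \<le> 2 * C\<^sup>2 + 1"
      by (rule nearly_optimal_approximant[OF \<phi> C \<delta>[of n]]) (simp add: J_def \<Phi>_def)
    have gs: "square_integrable torus g" using g(1) by (rule hardy_square_integrable)
    note I = square_integrable_integrable[OF \<Phi>s] square_integrable_integrable[OF square_integrable_diff[OF \<Phi>s gs]]
    have "L2sq torus g \<le> (\<integral>x. 2 * (cmod (\<Phi> x))\<^sup>2 + 2 * (cmod (\<Phi> x - g x))\<^sup>2 \<partial>torus)"
    proof (rule integral_mono)
      show "(cmod (g x))\<^sup>2 \<le> 2 * (cmod (\<Phi> x))\<^sup>2 + 2 * (cmod (\<Phi> x - g x))\<^sup>2" for x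
        using cmod_add_power2_le[of "\<Phi> x" "g x - \<Phi> x"] by (simp add: norm_minus_commute)
    qed (use I square_integrable_integrable[OF gs] in auto)
    also have "\<dots> = 2 * L2sq torus \<Phi> + 2 * L2sq torus (\<lambda>x. \<Phi> x - g x)"
      using I by simp
    also have "\<dots> \<le> 2 * L2sq torus \<Phi> + 2 * (2 * C\<^sup>2 + 1)"
      by (intro add_left_mono mult_left_mono g(3)) simp
    finally have "L2sq torus g \<le> 2 * L2sq torus \<Phi> + 2 * (2 * C\<^sup>2 + 1)" .
    moreover have "g \<in> A n" using g by (simp add: A_def)
    ultimately show ?thesis by blast
  qed
  moreover have "(\<lambda>x. (f x + g x) / 2) \<in> A n" if "f \<in> A n" "g \<in> A n" for f g n
  proof -
    have fg: "f \<in> hardy (Suc 0)" "g \<in> hardy (Suc 0)" "J f \<le> \<delta> n * C\<^sup>2" "J g \<le> \<delta> n * C\<^sup>2"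
      using that by (auto simp: A_def)
    note J = J_int[OF hardy_square_integrable]
    have mid: "(\<lambda>x. (f x + g x) / 2) \<in> hardy (Suc 0)"
      using hardy_cmult[OF hardy_add[OF fg(1,2)], of "1 / 2"] by simp
    have "J (\<lambda>x. (f x + g x) / 2)
        \<le> (\<integral>x. (huber ((cmod (\<Phi> x - f x))\<^sup>2 - C\<^sup>2) + huber ((cmod (\<Phi> x - g x))\<^sup>2 - C\<^sup>2)) / 2 \<partial>torus)"
      unfolding J_def
    proof (rule integral_mono)
      fix x
      have eq: "\<Phi> x - (f x + g x) / 2 = ((\<Phi> x - f x) + (\<Phi> x - g x)) / 2" by (simp add: field_simps)
      show "huber ((cmod (\<Phi> x - (f x + g x) / 2))\<^sup>2 - C\<^sup>2)
          \<le> (huber ((cmod (\<Phi> x - f x))\<^sup>2 - C\<^sup>2) + huber ((cmod (\<Phi> x - g x))\<^sup>2 - C\<^sup>2)) / 2"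
        unfolding eq
      proof (rule subgradient_midpoint[where \<theta> = "\<lambda>s. huber (s - C\<^sup>2)" and \<theta>' = "\<lambda>s. unit_clamp (s - C\<^sup>2)"])
        show "huber (s - C\<^sup>2) + unit_clamp (s - C\<^sup>2) * (t - s) \<le> huber (t - C\<^sup>2)" for s t
          using huber_lower[of "s - C\<^sup>2" "t - C\<^sup>2"] by simp
      qed (rule unit_clamp_bounds)
    qed (use J[OF fg(1)] J[OF fg(2)] J[OF mid] in auto)
    also have "\<dots> = (J f + J g) / 2" unfolding J_def using J[OF fg(1)] J[OF fg(2)] by simp
    also have "\<dots> \<le> \<delta> n * C\<^sup>2" using fg(3,4) by simp
    finally have "J (\<lambda>x. (f x + g x) / 2) \<le> \<delta> n * C\<^sup>2" .
    with mid show ?thesis by (simp add: A_def)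
  qed
  moreover have "decseq A"
    unfolding decseq_def A_def \<delta>_def
    by (auto elim!: order_trans intro!: mult_right_mono divide_left_mono)
  ultimately obtain s g where s: "\<And>n. s n \<in> A n" and g: "square_integrable torus g"
    and ae: "AE x in torus. (\<lambda>n. s n x) \<longlonglongrightarrow> g x"
    and lim: "(\<lambda>n. L2sq torus (\<lambda>x. s n x - g x)) \<longlonglongrightarrow> 0"
    by (rule_tac torus.nested_convex_limit[of A]) (auto simp: A_def intro: hardy_square_integrable)
  have sK: "s n \<in> hardy (Suc 0)" and sJ: "J (s n) \<le> \<delta> n * C\<^sup>2" for n using s[of n] by (auto simp: A_def)
  have gK: "g \<in> hardy (Suc 0)" using hardy_closed[OF sK g lim] .
  have "J g \<le> 0"
    unfolding J_def
  proof (rule Fatou_integral(2)[where X = "\<lambda>n x. huber ((cmod (\<Phi> x - s n x))\<^sup>2 - C\<^sup>2)"])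
    show "(\<lambda>x. huber ((cmod (\<Phi> x - g x))\<^sup>2 - C\<^sup>2)) \<in> borel_measurable torus" using J_int[OF g] by auto
    show "AE x in torus. (\<lambda>n. huber ((cmod (\<Phi> x - s n x))\<^sup>2 - C\<^sup>2)) \<longlonglongrightarrow> huber ((cmod (\<Phi> x - g x))\<^sup>2 - C\<^sup>2)"
      using ae
    proof eventually_elim
      case (elim x)
      then have "(\<lambda>n. (cmod (\<Phi> x - s n x))\<^sup>2 - C\<^sup>2) \<longlonglongrightarrow> (cmod (\<Phi> x - g x))\<^sup>2 - C\<^sup>2" by (intro tendsto_intros)
      then show ?case by (rule continuous_on_tendsto_compose[OF continuous_huber]) auto
    qed
    show "\<forall>\<^sub>F n in sequentially. (\<integral>x. huber ((cmod (\<Phi> x - s n x))\<^sup>2 - C\<^sup>2) \<partial>torus) \<le> \<delta> n * C\<^sup>2"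
      using sJ by (simp add: J_def)
    have "\<delta> \<longlonglongrightarrow> 0"
      using LIMSEQ_inverse_real_of_nat unfolding \<delta>_def by (simp add: inverse_eq_divide)
    from tendsto_mult_right[OF this, of "C\<^sup>2"] show "(\<lambda>n. \<delta> n * C\<^sup>2) \<longlonglongrightarrow> 0" by simp
  qed (use J_int[OF hardy_square_integrable[OF sK]] huber_nonneg in auto)
  then have "J g = 0" unfolding J_def by (intro antisym) (simp_all add: huber_nonneg)
  then have "AE x in torus. huber ((cmod (\<Phi> x - g x))\<^sup>2 - C\<^sup>2) = 0"
    unfolding J_def using integral_nonneg_eq_0_iff_AE[OF J_int[OF g]] huber_nonneg by simp
  then have "AE x in torus. cmod (\<phi> (shear x) - g x) \<le> C"
  proof eventually_elim
    case (elim x)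
    then have "(cmod (\<Phi> x - g x))\<^sup>2 \<le> C\<^sup>2" using huber_eq_0 by fastforce
    then show ?case using C(1) unfolding \<Phi>_def by (rule power2_le_imp_le)
  qed
  with gK that show ?thesis by blast
qed

text \<open>Undoing the change of variables turns the best analytic approximation into an element of \<open>H1\<close>.\<close>

lemma dist_le_op_norm_hankel:
  assumes \<phi>: "\<phi> \<in> Linf torus"
  shows "dist_inf \<phi> H1 \<le> op_norm (hankel \<phi>)"
proof -
  obtain B where B: "AE x in torus. cmod (\<phi> x) \<le> B" and \<phi>m [measurable]: "\<phi> \<in> borel_measurable torus"
    and LB: "Linf_norm torus \<phi> = ennreal B"
    using \<phi> by (elim Linf_bound)
  have "op_norm (hankel \<phi>) < top" using op_norm_hankel_le[OF \<phi>] by (simp add: LB le_less_trans)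
  then obtain C where C: "0 \<le> C" "op_norm (hankel \<phi>) = ennreal C" by (auto simp: less_top_ennreal)
  obtain g where g: "g \<in> hardy (Suc 0)" and close: "AE x in torus. cmod (\<phi> (shear x) - g x) \<le> C"
    by (rule optimal_approximant[OF \<phi> C(1)]) (use C(2) in auto)
  have gs: "square_integrable torus g" using g by (rule hardy_square_integrable)
  have gm [measurable]: "g \<in> borel_measurable torus" using gs by (rule square_integrable_measurable)
  define G where "G x = g (unshear x)" for x
  have Gm [measurable]: "G \<in> borel_measurable torus" unfolding G_def by measurable
  have G_shear: "G (shear x) = g x" if "x \<in> space torus" for x using that by (simp add: G_def unshear_shear)
  have "AE x in torus. cmod (\<phi> (shear (unshear x)) - G x) \<le> C"
    using AE_unshear[OF close] by (simp add: G_def)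
  then have \<phi>G: "AE x in torus. cmod (\<phi> x - G x) \<le> C"
    using AE_space by eventually_elim (simp add: shear_unshear del: space_torus)
  have "AE x in torus. cmod (G x) \<le> B + C"
    using \<phi>G B by eventually_elim (use norm_triangle_ineq2 in \<open>smt (verit) norm_minus_commute\<close>)
  then have GL: "G \<in> Linf torus" by (rule LinfI[OF Gm])
  have "fourier_torus G m n = 0" if mn: "m + n < 0" for m n
  proof -
    define k where "k = nat (- (m + n))"
    have k: "int k = - (m + n)" "Suc 0 \<le> k" using mn by (auto simp: k_def)
    define a where "a l = (if cmod l = 1 then l powi (- n) else 0)" for l :: complex
    have a: "a \<in> borel_measurable circle" "\<forall>l. cmod (a l) \<le> 1"
    proof -
      have "(\<lambda>l. l powi (- n)) \<in> borel_measurable circle" by measurable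
      also have "?this \<longleftrightarrow> a \<in> borel_measurable circle" by (rule measurable_cong) (simp add: a_def)
      finally show "a \<in> borel_measurable circle" .
    qed (simp add: a_def norm_power_int)
    have "fourier_torus G m n = (\<integral>x. G x * fst x powi (- m) * snd x powi (- n) \<partial>torus)"
      unfolding fourier_torus_def case_prod_unfold prod.collapse ..
    also have "\<dots> = (\<integral>x. G (shear x) * fst (shear x) powi (- m) * snd (shear x) powi (- n) \<partial>torus)"
      by (rule integral_shear[symmetric]) measurable
    also have "\<dots> = (\<integral>x. (a (fst x) * snd x ^ k) * g x \<partial>torus)"
    proof (rule Lebesgue_cong)
      fix x assume x: "x \<in> space torus"
      then have nz: "snd x \<noteq> 0" and f1: "cmod (fst x) = 1" by auto
      have "snd x powi (- m) * snd x powi (- n) = snd x powi (int k)"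
        using nz by (simp add: k(1) flip: power_int_add)
      then have *: "snd x powi (- m) * snd x powi (- n) = snd x ^ k" by simp
      have "G (shear x) * fst (shear x) powi (- m) * snd (shear x) powi (- n)
          = fst x powi (- n) * (snd x powi (- m) * snd x powi (- n)) * g x"
        unfolding G_shear[OF x] by (simp add: shear_def power_int_mult_distrib mult_ac)
      also have "\<dots> = (a (fst x) * snd x ^ k) * g x"
        unfolding * using f1 by (simp add: a_def)
      finally show "G (shear x) * fst (shear x) powi (- m) * snd (shear x) powi (- n)
          = (a (fst x) * snd x ^ k) * g x" .
    qed simp
    also have "\<dots> = 0" using g k a unfolding hardy_iff_test by blast
    finally show ?thesis .
  qed
  then have "G \<in> H1" using GL by (simp add: H1_def)
  then have "dist_inf \<phi> H1 \<le> Linf_norm torus (\<lambda>x. \<phi> x - G x)"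
    unfolding dist_inf_def by (rule INF_lower)
  also have "\<dots> \<le> ennreal C" by (rule Linf_norm_le[OF _ \<phi>G]) measurable
  finally show ?thesis by (simp add: C)
qed

theorem theorem1p18:
  fixes \<phi> :: "complex \<times> complex \<Rightarrow> complex"
  assumes "\<phi> \<in> Linf torus"
  shows "op_norm (hankel \<phi>) = dist_inf \<phi> H1"
  using op_norm_hankel_le_dist[OF assms] dist_le_op_norm_hankel[OF assms] by (rule antisym)

end
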